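(* Let $d\geq 3$ be an odd integer and let $\Sigma$ be a finite set of prime numbers. Let $\mathcal{W}_\Sigma$ be the set of rational maps $\phi(z)\in\mathbb{Q}(z)$ of degree $d$ with $2d$-power free resultant and good reduction at all primes $p\in \Sigma$. Then: (1) each rational map $\phi\in \mathcal{W}_\Sigma$ has globally minimal resultant; (2) $\mathcal{W}_\Sigma$ has positive height density. Consequently, with respect to the height density, a positive proportion of rational maps of degree $d$ have good reduction at all primes $p\in \Sigma$ and globally minimal resultant.
   Context: A rational map $\phi\in\mathbb{Q}(z)$ of degree $d$ is written in homogeneous form $\phi(X/Y)=F(X,Y)/G(X,Y)$ with $F=\sum_{i=0}^d A_iX^iY^{d-i}$, $G=\sum_{j=0}^d B_jX^jY^{d-j}$ coprime, where $(A_0,\dots,A_d,B_0,\dots,B_d)\in\mathbb{Z}^{2d+2}$ has $\gcd=1$ and first nonzero coordinate positive; this identifies $\phi$ with a point of $\mathbb{P}^{2d+1}(\mathbb{Q})$. The resultant $\mathrm{Res}(\phi)$ is $\mathrm{Res}(F,G)$. $\phi$ has good reduction at $p$ iff $p\nmid \mathrm{Res}(\phi)$. The height $H(\phi)$ is $\max\{|A_i|,|B_j|\}$. For $\phi$ and $A\in\mathrm{PGL}_2(\mathbb{Q})$, let $\epsilon_p(\phi)$ be the minimum of $\mathrm{ord}_p(\mathrm{Res}(A^{-1}\circ\phi\circ A))$ over $A\in\mathrm{PGL}_2(\mathbb{Q})$; the minimal resultant is $\prod_p p^{\epsilon_p(\phi)}$, and $\phi$ is globally minimal if this equals $|\mathrm{Res}(\phi)|$.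 The height density of a set $\mathcal{S}$ of such points is $\lim_{x\to\infty}\#\{P\in\mathcal{S}: H(P)\le x\}/\#\{P\in\mathbb{P}^{2d+1}(\mathbb{Q}):H(P)\le x\}$ (equivalently with the denominator replaced by the number of degree-$d$ rational maps of height $\le x$). *)

theory Defs
  imports
    "HOL-Computational_Algebra.Computational_Algebra"
    "HOL-Computational_Algebra.Field_as_Ring"
    "HOL-Library.Extended_Real"
    "Subresultants.Resultant_Prelim"
begin

text \<open>The field \<open>\<rat>(z)\<close>. The numerator and denominator returned by \<open>quot_of_fract\<close> are
  coprime, with monic denominator.\<close>

type_synonym rat_fun = "rat poly fract"

definition rat_fun_degree :: "rat_fun \<Rightarrow> nat" where
  "rat_fun_degree \<phi> = max (degree (fst (quot_of_fract \<phi>))) (degree (snd (quot_of_fract \<phi>)))"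

definition rat_maps :: "nat \<Rightarrow> rat_fun set" where
  "rat_maps d = {\<phi>. rat_fun_degree \<phi> = d}"

text \<open>Composition \<open>\<phi> \<circ> \<psi>\<close> in \<open>\<rat>(z)\<close>: substitute \<open>\<psi>\<close> for \<open>z\<close> in numerator and denominator
  of \<open>\<phi>\<close>. The substituted denominator is nonzero when \<open>\<psi>\<close> is nonconstant.\<close>

definition rat_fun_const :: "rat \<Rightarrow> rat_fun" where
  "rat_fun_const c = to_fract [:c:]"

definition rat_fun_compose :: "rat_fun \<Rightarrow> rat_fun \<Rightarrow> rat_fun" where
  "rat_fun_compose \<phi> \<psi> =
     poly (map_poly rat_fun_const (fst (quot_of_fract \<phi>))) \<psi> /
     poly (map_poly rat_fun_const (snd (quot_of_fract \<phi>))) \<psi>"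

text \<open>\<open>(a z + b) / (c z + e)\<close>, the action of the class in \<open>PGL\<^sub>2(\<rat>)\<close> of the matrix with
  rows \<open>(a, b)\<close> and \<open>(c, e)\<close>, where \<open>a e - b c \<noteq> 0\<close>.\<close>

definition lin_frac :: "rat \<Rightarrow> rat \<Rightarrow> rat \<Rightarrow> rat \<Rightarrow> rat_fun" where
  "lin_frac a b c e = Fract [:b, a:] [:e, c:]"

text \<open>\<open>A\<^sup>-\<^sup>1 \<circ> \<phi> \<circ> A\<close>. The inverse of \<open>A\<close> in \<open>PGL\<^sub>2(\<rat>)\<close> is the class of its adjugate
  matrix, with rows \<open>(e, -b)\<close> and \<open>(-c, a)\<close>.\<close>

definition conjugate_map :: "rat \<Rightarrow> rat \<Rightarrow> rat \<Rightarrow> rat \<Rightarrow> rat_fun \<Rightarrow> rat_fun" where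
  "conjugate_map a b c e \<phi> =
     rat_fun_compose (lin_frac e (- b) (- c) a) (rat_fun_compose \<phi> (lin_frac a b c e))"

text \<open>Points of \<open>\<P>\<^sup>N(\<rat>)\<close>, each given by its unique primitive integer coordinate vector whose
  first nonzero coordinate is positive.\<close>

definition proj_points :: "nat \<Rightarrow> int list set" where
  "proj_points N = {P. length P = N + 1 \<and> Gcd (set P) = 1 \<and>
     (\<exists>i\<le>N. 0 < P ! i \<and> (\<forall>j<i. P ! j = 0))}"

definition height :: "int list \<Rightarrow> int" where
  "height P = Max (abs ` set P)"

text \<open>A vector \<open>(A\<^sub>0, \<dots>, A\<^sub>d, B\<^sub>0, \<dots>, B\<^sub>d)\<close> encodes the forms
  \<open>F = \<Sum>i. A\<^sub>i X\<^sup>i Y\<^bsup>d-i\<^esup>\<close> and \<open>G = \<Sum>j. B\<^sub>j X\<^sup>j Y\<^bsup>d-j\<^esup>\<close>; these are handled through their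
  dehomogenizations \<open>F(z, 1)\<close> and \<open>G(z, 1)\<close>.\<close>

definition num_form :: "nat \<Rightarrow> int list \<Rightarrow> int poly" where
  "num_form d P = Poly (take (d + 1) P)"

definition den_form :: "nat \<Rightarrow> int list \<Rightarrow> int poly" where
  "den_form d P = Poly (drop (d + 1) P)"

text \<open>If \<open>\<phi>\<close> has degree \<open>d\<close>, then one of the two polynomials below has degree \<open>d\<close>, so
  coprimality of the dehomogenizations is coprimality of \<open>F\<close> and \<open>G\<close>.\<close>

definition represents :: "nat \<Rightarrow> int list \<Rightarrow> rat_fun \<Rightarrow> bool" where
  "represents d P \<phi> \<longleftrightarrow>
     (let f = map_poly rat_of_int (num_form d P); g = map_poly rat_of_int (den_form d P)
      in coprime f g \<and> g \<noteq> 0 \<and> \<phi> = Fract f g)"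

definition map_point :: "rat_fun \<Rightarrow> int list" where
  "map_point \<phi> = (let d = rat_fun_degree \<phi>
     in (THE P. P \<in> proj_points (2 * d + 1) \<and> represents d P \<phi>))"

text \<open>The resultant of \<open>F\<close> and \<open>G\<close> as forms of degree \<open>d\<close>: the Sylvester matrix has size
  \<open>2 d\<close> even when a leading coefficient vanishes.\<close>

definition map_resultant :: "rat_fun \<Rightarrow> int" where
  "map_resultant \<phi> = (let d = rat_fun_degree \<phi>; P = map_point \<phi>
     in resultant_sub d d (num_form d P) (den_form d P))"

definition good_reduction :: "nat \<Rightarrow> rat_fun \<Rightarrow> bool" where
  "good_reduction p \<phi> \<longleftrightarrow> \<not> int p dvd map_resultant \<phi>"

definition min_res_exponent :: "nat \<Rightarrow> rat_fun \<Rightarrow> nat" where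
  "min_res_exponent p \<phi> = (LEAST n. \<exists>a b c e. a * e - b * c \<noteq> 0 \<and>
     n = multiplicity (int p) (map_resultant (conjugate_map a b c e \<phi>)))"

text \<open>The product over all primes, restricted to the finitely many factors different from 1.\<close>

definition minimal_resultant :: "rat_fun \<Rightarrow> nat" where
  "minimal_resultant \<phi> =
     (\<Prod>p | prime p \<and> min_res_exponent p \<phi> \<noteq> 0. p ^ min_res_exponent p \<phi>)"

definition globally_minimal :: "rat_fun \<Rightarrow> bool" where
  "globally_minimal \<phi> \<longleftrightarrow> int (minimal_resultant \<phi>) = \<bar>map_resultant \<phi>\<bar>"

definition power_free :: "nat \<Rightarrow> int \<Rightarrow> bool" where
  "power_free k n \<longleftrightarrow> (\<forall>p. prime p \<longrightarrow> \<not> p ^ k dvd n)"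

definition height_proportion :: "nat \<Rightarrow> int list set \<Rightarrow> real \<Rightarrow> real" where
  "height_proportion N S x =
     real (card {P \<in> S. real_of_int (height P) \<le> x}) /
     real (card {P \<in> proj_points N. real_of_int (height P) \<le> x})"

definition has_height_density :: "nat \<Rightarrow> rat_fun set \<Rightarrow> real \<Rightarrow> bool" where
  "has_height_density d S \<delta> \<longleftrightarrow>
     (height_proportion (2 * d + 1) (map_point ` S) \<longlongrightarrow> \<delta>) at_top"

text \<open>A set is a positive proportion of all maps if its lower density is positive; this does not
  presuppose that the limit exists.\<close>

definition lower_height_density :: "nat \<Rightarrow> rat_fun set \<Rightarrow> ereal" where
  "lower_height_density d S =
     Liminf at_top (\<lambda>x. ereal (height_proportion (2 * d + 1) (map_point ` S) x))"

definition W :: "nat \<Rightarrow> nat set \<Rightarrow> rat_fun set" where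
  "W d \<Sigma> = {\<phi> \<in> rat_maps d. power_free (2 * d) (map_resultant \<phi>) \<and>
     (\<forall>p\<in>\<Sigma>. good_reduction p \<phi>)}"

end

theory Submission
  imports Defs "Jordan_Normal_Form.Char_Poly"
begin

text \<open>Conjugating \<open>\<phi>\<close> by \<open>A\<close> multiplies the resultant by \<open>\<plusminus> det(A)\<^bsup>d(d+1)\<^esup> \<lambda>\<^bsup>2d\<^esup>\<close>, where \<open>\<lambda>\<close> is the
  factor making the new coordinates primitive. For odd \<open>d\<close> this is a \<open>2d\<close>-th power up to sign, so
  the exponent of \<open>p\<close> cannot drop if it is smaller than \<open>2d\<close>.

  For the density, the conditions at the primes \<open>p \<le> M\<close> define a periodic set of integer vectors, which
  has a density; the limit \<open>M \<rightarrow> \<infinity>\<close> needs a bound on the number of vectors in a box of side \<open>X\<close> for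
  which \<open>p\<^bsup>2d\<^esup>\<close> divides the resultant for some \<open>p > M\<close>. Since the resultant is \<open>O(X\<^bsup>2d\<^esup>)\<close>, only
  \<open>p = O(X)\<close> matter. If \<open>p\<close> does not divide \<open>A\<^sub>d\<close>, the resultant is, up to powers of \<open>\<Delta> = A\<^sub>d\<^sup>d\<close>, a monic
  integral polynomial of degree \<open>d\<close> in \<open>\<Delta> B\<^sub>0\<close>. By divided differences, \<open>p\<^bsup>2d\<^esup>\<close> can divide it only for
  \<open>B\<^sub>0\<close> in at most \<open>d\<close> classes modulo \<open>p\<^sup>2\<close>. The same holds for \<open>B\<^sub>d\<close> and \<open>A\<^sub>0\<close>; and \<open>p\<close> divides both \<open>A\<^sub>d\<close>
  and \<open>B\<^sub>d\<close> for a proportion \<open>O(1/p\<^sup>2)\<close> of the vectors. Summing over \<open>p\<close>, and using that there are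
  \<open>o(X)\<close> primes up to \<open>O(X)\<close>, the tail is \<open>O(1/M) + o(1)\<close>. Positivity follows by applying the same
  bound to the vectors congruent to the point of \<open>z\<^sup>d\<close> modulo all primes \<open>p \<le> M\<close>.\<close>

text \<open>The modulus p^2 balances two demands. Confining a coefficient only modulo p would give a
  proportion of order 1/p, and the sum of 1/p over the primes diverges. Modulo p^2 the sum
  converges, at the price that each of the d divided differences may lose a factor p; of p^(2d)
  there remains p^d, which would have to divide the leading coefficient 1. The rounding error 1 in
  each fibre count is a relative error 1/X per prime. Over all integers up to O(X) this would be
  bounded but not small, which is why a sublinear count of the primes is proved. A resultant equal
  to zero is divisible by the 2d-th power of every prime, so all such vectors are caught by one
  further prime beyond the range. The tail estimate is stated for vectors P0 + Q P: taking P0 = 0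
  and Q = 1 gives the existence of the limit, taking for P0 the point of z^d and for Q the product
  of the small primes gives its positivity. Projective points appear only at the end: the sign
  normalization halves the counts of sieved and of primitive vectors alike, and the height density
  is the quotient of the two densities.\<close>

hide_const (open) module.smult

section \<open>Resultants under linear substitutions\<close>

text \<open>The dehomogenization of \<open>F(aX + bY, cX + eY)\<close> for the form \<open>F\<close> of degree \<open>m\<close> with
  dehomogenization \<open>f\<close>.\<close>

definition hsubst :: "nat \<Rightarrow> 'a::comm_ring_1 \<Rightarrow> 'a \<Rightarrow> 'a \<Rightarrow> 'a \<Rightarrow> 'a poly \<Rightarrow> 'a poly" where
  "hsubst m a b c e f = (\<Sum>i\<le>m. smult (coeff f i) ([:b, a:] ^ i * [:e, c:] ^ (m - i)))"

lemma hsubst_add: "hsubst m a b c e (f + g) = hsubst m a b c e f + hsubst m a b c e g"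
  by (simp add: hsubst_def smult_add_left sum.distrib)

lemma hsubst_smult: "hsubst m a b c e (smult k f) = smult k (hsubst m a b c e f)"
  by (simp add: hsubst_def smult_sum2)

lemma hsubst_pCons:
  "hsubst (Suc m) a b c e (pCons k f) = smult k ([:e, c:] ^ Suc m) + [:b, a:] * hsubst m a b c e f"
proof -
  have "hsubst (Suc m) a b c e (pCons k f) = smult k ([:e, c:] ^ Suc m) +
     (\<Sum>i\<le>m. smult (coeff f i) ([:b, a:] ^ Suc i * [:e, c:] ^ (m - i)))"
    unfolding hsubst_def by (subst sum.atMost_Suc_shift) simp
  also have "(\<Sum>i\<le>m. smult (coeff f i) ([:b, a:] ^ Suc i * [:e, c:] ^ (m - i))) =
      [:b, a:] * hsubst m a b c e f"
    unfolding hsubst_def sum_distrib_left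
    by (intro sum.cong refl) (simp only: power_Suc mult_smult_right mult.assoc)
  finally show ?thesis .
qed

text \<open>Read as a form of degree \<open>k + m\<close>, a form of degree \<open>m\<close>
  acquires the factor Y^k, and Y is replaced by cX + eY.\<close>

lemma hsubst_raise_degree:
  assumes "degree f \<le> m"
  shows "hsubst (k + m) a b c e f = [:e, c:] ^ k * hsubst m a b c e f"
proof -
  have "hsubst (k + m) a b c e f
      = (\<Sum>i\<le>m. smult (coeff f i) ([:b, a:] ^ i * [:e, c:] ^ (k + m - i)))"
    unfolding hsubst_def
    by (rule sum.mono_neutral_right) (use assms in \<open>auto simp: coeff_eq_0\<close>)
  also have "\<dots> = [:e, c:] ^ k * hsubst m a b c e f"
    unfolding hsubst_def sum_distrib_left
    by (intro sum.cong refl) (simp add: power_add[symmetric] ac_simps)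
  finally show ?thesis .
qed

text \<open>Splitting off the constant coefficient of \<open>f\<close>, as in Horner's scheme, gives
  the induction on \<open>m\<close>. The degree bounds matter because the substitution acts on forms
  of prescribed degrees, and these add up in a product.\<close>

lemma hsubst_mult:
  assumes "degree f \<le> m" "degree g \<le> n"
  shows "hsubst (m + n) a b c e (f * g) = hsubst m a b c e f * hsubst n a b c e g"
  using assms
proof (induction m arbitrary: f)
  case 0
  then obtain k where "f = [:k:]" by (auto elim: degree_eq_zeroE)
  then show ?case by (simp add: hsubst_smult) (simp add: hsubst_def)
next
  case (Suc m)
  obtain k f' where f: "f = pCons k f'" by (cases f)
  have df: "degree f' \<le> m" using Suc.prems f by (auto split: if_splits)
  \<comment> \<open>The part \<open>smult k g\<close> has degree at most \<open>n\<close>; reading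
    it as a form of degree \<open>Suc m + n\<close> produces the missing power of
    \<open>[:e, c:]\<close>.\<close>
  have "hsubst (Suc m + n) a b c e (f * g) =
    hsubst (Suc m + n) a b c e (smult k g) + hsubst (Suc (m + n)) a b c e (pCons 0 (f' * g))"
    by (simp add: f hsubst_add)
  also have "\<dots> = smult k ([:e, c:] ^ Suc m * hsubst n a b c e g)
      + [:b, a:] * (hsubst m a b c e f' * hsubst n a b c e g)"
    unfolding hsubst_smult hsubst_pCons hsubst_raise_degree[OF Suc.prems(2)]
      Suc.IH[OF df Suc.prems(2)] by simp
  also have "\<dots> = hsubst (Suc m) a b c e f * hsubst n a b c e g"
    unfolding f hsubst_pCons by (simp add: algebra_simps)
  finally show ?case .
qed

lemma hsubst_linear: "hsubst (Suc 0) a b c e [:\<beta>, \<alpha>:] = [:\<alpha> * b + \<beta> * e, \<alpha> * a + \<beta> * c:]"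
  by (simp add: hsubst_def)

lemma hsubst_power:
  assumes "degree f \<le> m"
  shows "hsubst (k * m) a b c e (f ^ k) = hsubst m a b c e f ^ k"
proof (induction k)
  case 0
  then show ?case by (simp add: hsubst_def)
next
  case (Suc k)
  have "degree (f ^ k) \<le> k * m"
    using order.trans[OF degree_power_le[of f k] mult_le_mono1[OF assms, of k]]
    by (simp add: mult.commute)
  then show ?case using hsubst_mult[OF assms, of "f ^ k" "k * m"] Suc by simp
qed

lemma degree_linear_le: "degree [:\<beta>, \<alpha>:] \<le> 1" by simp

lemma degree_linear_power_le: "degree ([:\<beta>, \<alpha>:] ^ k) \<le> k"
  using order.trans[OF degree_power_le mult_le_mono1[OF degree_linear_le], of \<beta> \<alpha> k] by simp

lemma degree_linear_powers_le: "degree ([:\<beta>, \<alpha>:] ^ k * [:\<delta>, \<gamma>:] ^ l) \<le> k + l"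
  by (rule order.trans[OF degree_mult_le add_mono[OF degree_linear_power_le degree_linear_power_le]])

lemma degree_hsubst_le: "degree (hsubst m a b c e f) \<le> m"
  unfolding hsubst_def
  by (intro degree_sum_le) (auto intro!: order.trans[OF degree_smult_le] order.trans[OF
      degree_linear_powers_le])

text \<open>Linear forms go to linear forms whose coefficients are the entries of a product of 2x2
  matrices, and products are respected.\<close>

lemma hsubst_linear_powers:
  "hsubst (k + l) a b c e ([:b', a':] ^ k * [:e', c':] ^ l) =
     [:a' * b + b' * e, a' * a + b' * c:] ^ k * [:c' * b + e' * e, c' * a + e' * c:] ^ l"
proof -
  have "hsubst (k + l) a b c e ([:b', a':] ^ k * [:e', c':] ^ l) =
    hsubst k a b c e ([:b', a':] ^ k) * hsubst l a b c e ([:e', c':] ^ l)"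
    by (rule hsubst_mult) (rule degree_linear_power_le)+
  then show ?thesis
    using hsubst_power[OF degree_linear_le, of k a b c e b' a']
      hsubst_power[OF degree_linear_le, of l a b c e e' c']
    by (simp add: hsubst_linear)
qed

text \<open>The action on the (n-1)-st symmetric power: row \<open>i\<close> holds the image of
  X^(n-1-i) Y^i. Powers of X descend, to match the columns of the Sylvester matrix.\<close>

definition subst_mat :: "nat \<Rightarrow> 'a::comm_ring_1 \<Rightarrow> 'a \<Rightarrow> 'a \<Rightarrow> 'a \<Rightarrow> 'a mat" where
  "subst_mat n a b c e =
     mat n n (\<lambda>(i, j). coeff ([:b, a:] ^ (n - 1 - i) * [:e, c:] ^ i) (n - 1 - j))"

lemma subst_mat_carrier [simp]: "subst_mat n a b c e \<in> carrier_mat n n"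
  by (simp add: subst_mat_def)

lemma subst_mat_dim [simp]: "dim_row (subst_mat n a b c e) = n" "dim_col (subst_mat n a b c e) = n"
  by (simp_all add: subst_mat_def)

lemma sum_coeff_subst_mat:
  assumes "j < n" "degree p < n"
  shows "(\<Sum>k<n. coeff p (n - 1 - k) * subst_mat n a b c e $$ (k, j)) =
    coeff (hsubst (n - 1) a b c e p) (n - 1 - j)"
proof -
  have "(\<Sum>k<n. coeff p (n - 1 - k) * subst_mat n a b c e $$ (k, j)) =
    (\<Sum>k<n. coeff p (n - 1 - k) * coeff ([:b, a:] ^ (n - 1 - k) * [:e, c:] ^ k) (n - 1 - j))"
    using assms by (intro sum.cong) (auto simp: subst_mat_def)
  also have "\<dots> = (\<Sum>k<n. coeff p k * coeff ([:b, a:] ^ k * [:e, c:] ^ (n - 1 - k)) (n - 1 - j))"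
    by (subst sum.nat_diff_reindex[symmetric]) (auto intro!: sum.cong)
  finally have *: "(\<Sum>k<n. coeff p (n - 1 - k) * subst_mat n a b c e $$ (k, j)) = \<dots>" .
  have "{..<n} = {..n - 1}" using assms by auto
  with * show ?thesis by (simp add: hsubst_def coeff_sum)
qed

text \<open>Substituting twice is substituting by the product matrix. Each row is a product of
  powers of linear forms, on which this can be read off.\<close>

lemma subst_mat_mult:
  "subst_mat n a' b' c' e' * subst_mat n a b c e =
   subst_mat n (a' * a + b' * c) (a' * b + b' * e) (c' * a + e' * c) (c' * b + e' * e)"
  (is "_ * _ = ?R")
proof (rule eq_matI)
  fix i j assume "i < dim_row ?R" "j < dim_col ?R"
  then have i: "i < n" and j: "j < n" by auto
  let ?p = "[:b', a':] ^ (n - 1 - i) * [:e', c':] ^ i"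
  have "degree ?p < n" using degree_linear_powers_le[of b' a' "n - 1 - i" e' c' i] i by linarith
  have "(subst_mat n a' b' c' e' * subst_mat n a b c e) $$ (i, j) =
     (\<Sum>k<n. coeff ?p (n - 1 - k) * subst_mat n a b c e $$ (k, j))"
    using i j by (simp add: scalar_prod_def subst_mat_def atLeast0LessThan)
  also have "\<dots> = coeff (hsubst (n - 1) a b c e ?p) (n - 1 - j)"
    by (rule sum_coeff_subst_mat) fact+
  also have "n - 1 = (n - 1 - i) + i" using i by simp
  also have "hsubst ((n - 1 - i) + i) a b c e ([:b', a':] ^ ((n - 1 - i) + i - i) * [:e', c':] ^ i)
    = [:a' * b + b' * e, a' * a + b' * c:] ^ (n - 1 - i) * [:c' * b + e' * e, c' * a + e' * c:] ^ i"
    unfolding add_diff_cancel_right' by (rule hsubst_linear_powers)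
  finally show "(subst_mat n a' b' c' e' * subst_mat n a b c e) $$ (i, j) = ?R $$ (i, j)"
    using i j by (simp add: subst_mat_def)
qed auto

lemma prod_pow_triangle:
  "(\<Prod>i<n. a ^ (n - 1 - i) * e ^ i) = (a * e :: 'a::comm_ring_1) ^ (n * (n - 1) div 2)"
proof -
  have *: "(\<Prod>i<n. x ^ i) = x ^ (n * (n - 1) div 2)" for x :: 'a
  proof (induction n)
    case (Suc n)
    have "n * (n - 1) div 2 + n = Suc n * n div 2"
      by (cases n) (auto simp: algebra_simps)
    with Suc show ?case by (simp add: power_add[symmetric])
  qed simp
  have "(\<Prod>i<n. a ^ (n - 1 - i)) = (\<Prod>i<n. a ^ i)"
    by (subst prod.nat_diff_reindex[symmetric]) (auto intro!: prod.cong)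
  then show ?thesis by (simp add: prod.distrib * power_mult_distrib)
qed

lemma coeff_linear_power_top: "coeff ([:b, a:] ^ m) m = (a :: 'a::comm_ring_1) ^ m"
proof (induction m)
  case (Suc m)
  have "coeff ([:b, a:] ^ m) (Suc m) = 0"
    using degree_linear_power_le[of b a m] by (intro coeff_eq_0) simp
  with Suc show ?case by (simp add: coeff_pCons)
qed simp

text \<open>With c = 0 the variable Y goes to a multiple of itself, so the power of Y never drops:
  the matrix is triangular with diagonal entries a^(n-1-i) e^i.\<close>

lemma det_subst_mat_upper:
  "det (subst_mat n a b 0 e) = (a * e) ^ (n * (n - 1) div 2)"
proof -
  have ent: "subst_mat n a b 0 e $$ (i, j) = coeff ([:b, a:] ^ (n - 1 - i)) (n - 1 - j) * e ^ i"
    if "i < n" "j < n" for i j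
  proof -
    have "[:e:] ^ i = [:e ^ i:]" by (induction i) (auto simp: one_pCons)
    with that show ?thesis by (simp add: subst_mat_def)
  qed
  have "upper_triangular (subst_mat n a b 0 e)"
  proof (rule upper_triangularI)
    fix i j assume "j < i" "i < dim_row (subst_mat n a b 0 e)"
    then have "degree ([:b, a:] ^ (n - 1 - i)) < n - 1 - j"
      using degree_linear_power_le[of b a "n - 1 - i"] by simp
    with \<open>j < i\<close> \<open>i < _\<close> show "subst_mat n a b 0 e $$ (i, j) = 0"
      by (simp add: ent coeff_eq_0)
  qed
  then have "det (subst_mat n a b 0 e) = (\<Prod>i<n. subst_mat n a b 0 e $$ (i, i))"
    by (subst det_upper_triangular) (auto simp: prod_list_diag_prod atLeast0LessThan)
  also have "\<dots> = (\<Prod>i<n. a ^ (n - 1 - i) * e ^ i)"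
    by (intro prod.cong refl) (simp add: ent coeff_linear_power_top)
  also note prod_pow_triangle
  finally show ?thesis .
qed

text \<open>Swapping twice is the identity, so the determinant squares to 1. The sign is left open,
  since only divisibility matters later.\<close>

lemma subst_mat_swap_square: "det (subst_mat n 0 1 1 (0::'a::idom)) \<in> {1, -1}"
proof -
  have "det (subst_mat n 0 1 1 (0::'a)) * det (subst_mat n 0 1 1 0) = 1"
    by (subst det_mult[symmetric]) (auto simp: subst_mat_mult det_subst_mat_upper)
  then show ?thesis using square_eq_1_iff by auto
qed

text \<open>For nonzero c the Bruhat decomposition writes the matrix as unipotent times swap times
  upper triangular, and each factor has a known determinant up to sign.\<close>

lemma det_subst_mat:
  fixes a b c e :: "'a::field"
  shows "\<exists>s\<in>{1, -1}. det (subst_mat n a b c e) = s * (a * e - b * c) ^ (n * (n - 1) div 2)"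
proof (cases "c = 0")
  case True
  then show ?thesis by (auto simp: det_subst_mat_upper)
next
  case False
  \<comment> \<open>Chosen so that f + (a / c) e = b, the upper right entry of the product; then c f
    = -(a e - b c).\<close>
  define f where "f = b - a * e / c"
  have "subst_mat n a b c e = subst_mat n 1 (a / c) 0 1 * (subst_mat n 0 1 1 0 * subst_mat n c e 0 f)"
    using False by (simp add: subst_mat_mult f_def)
  then have "det (subst_mat n a b c e) = det (subst_mat n 0 1 1 (0::'a)) * (c * f) ^ (n * (n - 1) div 2)"
    by (simp add: det_mult[of _ n] det_subst_mat_upper mult_carrier_mat[of _ n n])
  also have "c * f = - 1 * (a * e - b * c)" using False by (simp add: f_def field_simps)
  finally have "det (subst_mat n a b c e) = (det (subst_mat n 0 1 1 (0::'a)) * (- 1) ^ (n * (n - 1) div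
      2)) *
     (a * e - b * c) ^ (n * (n - 1) div 2)"
    by (simp only: power_mult_distrib mult.assoc)
  moreover have "det (subst_mat n 0 1 1 (0::'a)) * (- 1) ^ (n * (n - 1) div 2) \<in> {1, -1}"
    using subst_mat_swap_square[where 'a = 'a, of n] by (cases "even (n * (n - 1) div 2)") auto
  ultimately show ?thesis by blast
qed

text \<open>The rows are the coefficient vectors of the shifts z^(d-1-i) p and z^(d-1-i) q, highest
  power first. This remains true when a leading coefficient vanishes, because only the bound
  \<open>d\<close> on the degrees enters.\<close>

lemma sylvester_mat_sub_index_shift:
  fixes p q :: "'a::comm_ring_1 poly"
  assumes "i < 2 * d" "j < 2 * d" "degree p \<le> d" "degree q \<le> d"
  shows "sylvester_mat_sub d d p q $$ (i, j) =
    (if i < d then coeff (monom 1 (d - 1 - i) * p) (2 * d - 1 - j)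
     else coeff (monom 1 (d - 1 - (i - d)) * q) (2 * d - 1 - j))"
proof -
  have *: "(if i' \<le> j \<and> j - i' \<le> d then coeff r (d + i' - j) else 0)
      = coeff (monom 1 (d - 1 - i') * r) (2 * d - 1 - j)"
    if "i' < d" "degree r \<le> d" for i' and r :: "'a poly"
  proof (cases "i' \<le> j")
    case True
    moreover have "2 * d - 1 - j - (d - 1 - i') = d + i' - j"
      using that assms by simp
    moreover have "d - 1 - i' \<le> 2 * d - 1 - j \<longleftrightarrow> j - i' \<le> d"
      using that assms True by auto
    ultimately show ?thesis by (simp add: coeff_monom_mult)
  next
    case False
    then have "coeff r (2 * d - 1 - j - (d - 1 - i')) = 0"
      using that by (intro coeff_eq_0) simp
    with False show ?thesis by (simp add: coeff_monom_mult)
  qed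
  show ?thesis
  proof (cases "i < d")
    case True
    then show ?thesis using assms *[of i p] by (simp add: sylvester_mat_sub_index)
  next
    case False
    moreover from this have "(if i - d \<le> j \<and> j \<le> i then coeff q (i - j) else 0) =
       (if i - d \<le> j \<and> j - (i - d) \<le> d then coeff q (d + (i - d) - j) else 0)" by auto
    ultimately show ?thesis using assms *[of "i - d" q] by (simp add: sylvester_mat_sub_index)
  qed
qed

lemma index_mult_mat_sum:
  fixes A B :: "'a::semiring_0 mat"
  assumes "A \<in> carrier_mat n l" "B \<in> carrier_mat l m" "i < n" "j < m"
  shows "(A * B) $$ (i, j) = (\<Sum>k<l. A $$ (i, k) * B $$ (k, j))"
  using assms by (auto simp: scalar_prod_def atLeast0LessThan intro!: sum.cong)

lemma sum_lessThan_add: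
  fixes m n :: nat
  shows "(\<Sum>k<m + n. h k) = (\<Sum>k<m. h k) + (\<Sum>k<n. h (m + k) :: 'a::comm_monoid_add)"
  by (induction n) (simp_all add: ac_simps)

text \<open>The Sylvester matrix represents the map sending (u, v) to u f + v g, from pairs of forms
  of degree d-1 to forms of degree 2d-1. Substitution is compatible with it: it acts on the pairs by
  two copies of \<open>subst_mat d\<close> and on the target by
  \<open>subst_mat (2 * d)\<close>.\<close>

lemma sylvester_mat_sub_hsubst:
  fixes f g :: "'a::comm_ring_1 poly"
  assumes f: "degree f \<le> d" and g: "degree g \<le> d"
  shows "sylvester_mat_sub d d f g * subst_mat (2 * d) a b c e =
    four_block_mat (subst_mat d a b c e) (0\<^sub>m d d) (0\<^sub>m d d) (subst_mat d a b c e) *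
    sylvester_mat_sub d d (hsubst d a b c e f) (hsubst d a b c e g)"
  (is "?S * ?T = ?B * ?S'")
proof (rule eq_matI)
  fix i j assume "i < dim_row (?B * ?S')" "j < dim_col (?B * ?S')"
  then have i: "i < 2 * d" and j: "j < 2 * d" by auto
  have sumB: "(\<Sum>k<2 * d. ?B $$ (i, k) * ?S' $$ (k, j)) =
      (\<Sum>k<d. ?B $$ (i, k) * ?S' $$ (k, j)) + (\<Sum>k<d. ?B $$ (i, d + k) * ?S' $$ (d + k, j))"
    by (simp add: mult_2 sum_lessThan_add del: index_mat_four_block)
  \<comment> \<open>One row: the shift z^(d-1-i') p is substituted factor by factor, and the image
    of the monomial is expanded in monomials again, with coefficients from row i' of
    \<open>subst_mat d\<close>.\<close>
  have key: "(\<Sum>k<2 * d. coeff (monom 1 (d - 1 - i') * p) (2 * d - 1 - k) * ?T $$ (k, j)) =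
     (\<Sum>k<d. subst_mat d a b c e $$ (i', k) *
        coeff (monom 1 (d - 1 - k) * hsubst d a b c e p) (2 * d - 1 - j))"
    if i': "i' < d" and p: "degree p \<le> d" for i' p
  proof -
    let ?l = "[:b, a:] ^ (d - 1 - i') * [:e, c:] ^ i'"
    have "degree (monom 1 (d - 1 - i') * p) \<le> (d - 1 - i') + d"
      by (rule order.trans[OF degree_mult_le add_mono[OF degree_monom_le p]])
    then have "(\<Sum>k<2 * d. coeff (monom 1 (d - 1 - i') * p) (2 * d - 1 - k) * ?T $$ (k, j)) =
      coeff (hsubst (2 * d - 1) a b c e (monom 1 (d - 1 - i') * p)) (2 * d - 1 - j)"
      using i' j by (intro sum_coeff_subst_mat) auto
    also have "2 * d - 1 = (d - 1) + d" using i' by simp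
    also have "hsubst ((d - 1) + d) a b c e (monom 1 (d - 1 - i') * p) =
       hsubst (d - 1) a b c e (monom 1 (d - 1 - i')) * hsubst d a b c e p"
      by (rule hsubst_mult) (auto intro: order.trans[OF degree_monom_le] p)
    also have "hsubst (d - 1) a b c e (monom 1 (d - 1 - i')) = ?l"
      unfolding hsubst_def using i'
      by (subst sum.remove[of _ "d - 1 - i'"]) (auto intro!: sum.neutral)
    also have "?l = (\<Sum>k<d. smult (subst_mat d a b c e $$ (i', k)) (monom 1 (d - 1 - k)))"
    proof -
      have "?l = (\<Sum>k\<le>d - 1. monom (coeff ?l k) k)"
        using degree_linear_powers_le[of b a "d - 1 - i'" e c i'] i'
        by (intro poly_as_sum_of_monoms'[symmetric]) simp
      also have "{..d - 1} = {..<d}" using i' by auto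
      also have "(\<Sum>k<d. monom (coeff ?l k) k) = (\<Sum>k<d. monom (coeff ?l (d - 1 - k)) (d - 1 - k))"
        by (subst sum.nat_diff_reindex[symmetric]) (auto intro!: sum.cong)
      also have "\<dots> = (\<Sum>k<d. smult (subst_mat d a b c e $$ (i', k)) (monom 1 (d - 1 - k)))"
        using i' by (intro sum.cong) (auto simp: subst_mat_def smult_monom)
      finally show ?thesis .
    qed
    finally show ?thesis using i' by (simp add: sum_distrib_right coeff_sum mult_2)
  qed
  have "(?S * ?T) $$ (i, j) = (\<Sum>k<2 * d. ?S $$ (i, k) * ?T $$ (k, j))"
    using i j by (simp add: scalar_prod_def atLeast0LessThan mult_2)
  also have "\<dots> = (\<Sum>k<2 * d. ?B $$ (i, k) * ?S' $$ (k, j))"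
  proof (cases "i < d")
    case True
    then have "(\<Sum>k<2 * d. ?S $$ (i, k) * ?T $$ (k, j)) =
       (\<Sum>k<2 * d. coeff (monom 1 (d - 1 - i) * f) (2 * d - 1 - k) * ?T $$ (k, j))"
      by (intro sum.cong refl) (use i f g in \<open>simp add: sylvester_mat_sub_index_shift\<close>)
    also note key[OF True f]
    also have "(\<Sum>k<d. subst_mat d a b c e $$ (i, k) *
        coeff (monom 1 (d - 1 - k) * hsubst d a b c e f) (2 * d - 1 - j)) =
        (\<Sum>k<d. ?B $$ (i, k) * ?S' $$ (k, j))"
      using True j by (intro sum.cong refl) (simp add: sylvester_mat_sub_index_shift degree_hsubst_le)
    also have "\<dots> = (\<Sum>k<2 * d. ?B $$ (i, k) * ?S' $$ (k, j))"
      unfolding sumB using True by simp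
    finally show ?thesis .
  next
    case False
    with i have i': "i - d < d" by simp
    have "(\<Sum>k<2 * d. ?S $$ (i, k) * ?T $$ (k, j)) =
       (\<Sum>k<2 * d. coeff (monom 1 (d - 1 - (i - d)) * g) (2 * d - 1 - k) * ?T $$ (k, j))"
      by (intro sum.cong refl) (use False i f g in \<open>simp add: sylvester_mat_sub_index_shift\<close>)
    also note key[OF i' g]
    also have "(\<Sum>k<d. subst_mat d a b c e $$ (i - d, k) *
        coeff (monom 1 (d - 1 - k) * hsubst d a b c e g) (2 * d - 1 - j)) =
        (\<Sum>k<d. ?B $$ (i, d + k) * ?S' $$ (d + k, j))"
      using False i i' j by (intro sum.cong refl) (simp add: sylvester_mat_sub_index_shift degree_hsubst_le)
    also have "\<dots> = (\<Sum>k<2 * d. ?B $$ (i, k) * ?S' $$ (k, j))"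
      unfolding sumB using False i by simp
    finally show ?thesis .
  qed
  also have "\<dots> = (?B * ?S') $$ (i, j)"
    by (rule index_mult_mat_sum[symmetric, of _ "2 * d"]) (use i j in \<open>auto simp: mult_2\<close>)
  finally show "(?S * ?T) $$ (i, j) = (?B * ?S') $$ (i, j)" .
qed auto

lemma det_block_diag:
  fixes A :: "'a::idom mat"
  assumes "A \<in> carrier_mat n n" "D \<in> carrier_mat n n"
  shows "det (four_block_mat A (0\<^sub>m n n) (0\<^sub>m n n) D) = det A * det D"
proof -
  have "det (four_block_mat A (0\<^sub>m n n) (0\<^sub>m n n) D) = det (A * D - 0\<^sub>m n n * 0\<^sub>m n n)"
    by (rule det_four_block_mat) (use assms in auto)
  also have "A * D - 0\<^sub>m n n * 0\<^sub>m n n = A * D"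
    by (rule eq_matI) (use assms in auto)
  finally show ?thesis using assms by (simp add: det_mult[of _ n])
qed

text \<open>Taking determinants in the compatibility of the Sylvester matrix with substitution, the
  exponent of a e - b c is d(2d-1) - d(d-1) = d^2. Invertibility allows the common power to be
  cancelled.\<close>

lemma resultant_sub_hsubst:
  fixes f g :: "'a::field poly"
  assumes "degree f \<le> d" "degree g \<le> d" "a * e - b * c \<noteq> 0"
  shows "\<exists>s\<in>{1, -1}. resultant_sub d d (hsubst d a b c e f) (hsubst d a b c e g) =
    s * (a * e - b * c) ^ (d * d) * resultant_sub d d f g"
proof -
  let ?\<delta> = "a * e - b * c"
  obtain s where s: "s \<in> {1, -1}"
    "det (subst_mat d a b c e) = s * ?\<delta> ^ (d * (d - 1) div 2)" using det_subst_mat by blast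
  obtain t where t: "t \<in> {1, -1}"
    "det (subst_mat (2 * d) a b c e) = t * ?\<delta> ^ (2 * d * (2 * d - 1) div 2)"
    using det_subst_mat by blast
  let ?S = "sylvester_mat_sub d d f g"
  let ?S' = "sylvester_mat_sub d d (hsubst d a b c e f) (hsubst d a b c e g)"
  have "det (?S * subst_mat (2 * d) a b c e) = det ?S * det (subst_mat (2 * d) a b c e)"
    by (rule det_mult) (auto simp: mult_2)
  moreover have "det (four_block_mat (subst_mat d a b c e) (0\<^sub>m d d) (0\<^sub>m d d) (subst_mat d a b c e)
      * ?S') =
      det (four_block_mat (subst_mat d a b c e) (0\<^sub>m d d) (0\<^sub>m d d) (subst_mat d a b c e)) * det ?S'"
    by (rule det_mult[of _ "d + d"]) auto
  ultimately have "resultant_sub d d f g * det (subst_mat (2 * d) a b c e) =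
     det (subst_mat d a b c e) ^ 2 * det ?S'"
    unfolding resultant_sub_def
    using arg_cong[OF sylvester_mat_sub_hsubst[OF assms(1,2), of a b c e], of det]
    by (simp add: det_block_diag[of _ d] power2_eq_square)
  also have "det (subst_mat d a b c e) ^ 2 = s ^ 2 * ?\<delta> ^ (2 * (d * (d - 1) div 2))"
    unfolding s by (simp add: power_mult_distrib power_mult[symmetric] mult.commute)
  also have "s ^ 2 = 1" using s(1) by auto
  also have "2 * (d * (d - 1) div 2) = d * (d - 1)" by (cases d) auto
  finally have eq: "resultant_sub d d f g * (t * ?\<delta> ^ (2 * d * (2 * d - 1) div 2)) =
     ?\<delta> ^ (d * (d - 1)) * det ?S'" by (simp add: t)
  have "2 * d * (2 * d - 1) div 2 = d * (d - 1) + d * d"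
    by (cases d) (auto simp: algebra_simps)
  with eq have "?\<delta> ^ (d * (d - 1)) * (t * ?\<delta> ^ (d * d) * resultant_sub d d f g) =
     ?\<delta> ^ (d * (d - 1)) * det ?S'"
    by (simp add: power_add ac_simps)
  then have "det ?S' = t * ?\<delta> ^ (d * d) * resultant_sub d d f g"
    using assms(3) by simp
  with t(1) show ?thesis unfolding resultant_sub_def by blast
qed

text \<open>Linear combinations of the two forms multiply the Sylvester matrix on the left by a 2x2
  array of scalar blocks of size d. These blocks commute, so the determinant of the array is the
  d-th power of the 2x2 determinant.\<close>

lemma resultant_sub_linear_combination:
  fixes f g :: "'a::idom poly"
  shows "resultant_sub d d (smult \<alpha> f + smult \<beta> g) (smult \<gamma> f + smult \<zeta> g) =
    (\<alpha> * \<zeta> - \<beta> * \<gamma>) ^ d * resultant_sub d d f g"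
proof -
  let ?I = "1\<^sub>m d :: 'a mat"
  let ?B = "four_block_mat (\<alpha> \<cdot>\<^sub>m ?I) (\<beta> \<cdot>\<^sub>m ?I) (\<gamma> \<cdot>\<^sub>m ?I) (\<zeta> \<cdot>\<^sub>m ?I)"
  let ?S = "sylvester_mat_sub d d f g"
  have "sylvester_mat_sub d d (smult \<alpha> f + smult \<beta> g) (smult \<gamma> f + smult \<zeta> g) = ?B * ?S"
    (is "?L = _")
  proof (rule eq_matI)
    fix i j assume "i < dim_row (?B * ?S)" "j < dim_col (?B * ?S)"
    then have i: "i < d + d" and j: "j < d + d" by auto
    have "(?B * ?S) $$ (i, j) = (\<Sum>k<d + d. ?B $$ (i, k) * ?S $$ (k, j))"
      by (rule index_mult_mat_sum[of _ "d + d"]) (use i j in auto)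
    also have "\<dots> = (\<Sum>k<d. ?B $$ (i, k) * ?S $$ (k, j)) + (\<Sum>k<d. ?B $$ (i, d + k) * ?S $$ (d + k, j))"
      by (rule sum_lessThan_add)
    also have "\<dots> = ?L $$ (i, j)"
    proof (cases "i < d")
      case True
      have "(\<Sum>k<d. ?B $$ (i, k) * ?S $$ (k, j)) = (\<Sum>k<d. if k = i then \<alpha> * ?S $$ (i, j) else 0)"
        by (intro sum.cong) (use True in auto)
      moreover have "(\<Sum>k<d. ?B $$ (i, d + k) * ?S $$ (d + k, j)) =
          (\<Sum>k<d. if k = i then \<beta> * ?S $$ (d + i, j) else 0)"
        by (intro sum.cong) (use True in auto)
      ultimately have "(\<Sum>k<d. ?B $$ (i, k) * ?S $$ (k, j)) + (\<Sum>k<d. ?B $$ (i, d + k) * ?S $$ (d + k, j))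
          = \<alpha> * ?S $$ (i, j) + \<beta> * ?S $$ (d + i, j)" using True by simp
      also have "\<dots> = ?L $$ (i, j)"
        using True i j by (auto simp: sylvester_mat_sub_index)
      finally show ?thesis .
    next
      case False
      then have i': "i - d < d" using i by simp
      have "(\<Sum>k<d. ?B $$ (i, k) * ?S $$ (k, j)) = (\<Sum>k<d. if k = i - d then \<gamma> * ?S $$ (i - d, j) else 0)"
        by (intro sum.cong) (use False i in auto)
      moreover have "(\<Sum>k<d. ?B $$ (i, d + k) * ?S $$ (d + k, j)) =
          (\<Sum>k<d. if k = i - d then \<zeta> * ?S $$ (i, j) else 0)"
        by (intro sum.cong) (use False i in auto)
      ultimately have "(\<Sum>k<d. ?B $$ (i, k) * ?S $$ (k, j)) + (\<Sum>k<d. ?B $$ (i, d + k) * ?S $$ (d + k, j))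
          = \<gamma> * ?S $$ (i - d, j) + \<zeta> * ?S $$ (i, j)" using i' by simp
      also have "\<dots> = ?L $$ (i, j)"
        using False i i' j by (auto simp: sylvester_mat_sub_index)
      finally show ?thesis .
    qed
    finally show "?L $$ (i, j) = (?B * ?S) $$ (i, j)" by simp
  qed auto
  moreover have "det ?B = (\<alpha> * \<zeta> - \<beta> * \<gamma>) ^ d"
  proof -
    have "det ?B = det (\<alpha> \<cdot>\<^sub>m ?I * (\<zeta> \<cdot>\<^sub>m ?I) - \<beta> \<cdot>\<^sub>m ?I * (\<gamma> \<cdot>\<^sub>m ?I))"
      by (rule det_four_block_mat) (auto simp: ac_simps)
    also have "\<alpha> \<cdot>\<^sub>m ?I * (\<zeta> \<cdot>\<^sub>m ?I) - \<beta> \<cdot>\<^sub>m ?I * (\<gamma> \<cdot>\<^sub>m ?I) = (\<alpha> * \<zeta> - \<beta> * \<gamma>) \<cdot>\<^sub>m ?I"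
      by (rule eq_matI) auto
    finally show ?thesis by simp
  qed
  moreover have "det (?B * ?S) = det ?B * det ?S"
    by (rule det_mult[of _ "d + d"]) auto
  ultimately show ?thesis unfolding resultant_sub_def by simp
qed

lemma resultant_sub_smult:
  "resultant_sub d d (smult k f) (smult k g) = (k :: 'a::idom) ^ (2 * d) * resultant_sub d d f g"
  using resultant_sub_linear_combination[of d k f 0 g 0 k]
  by (simp add: power_mult power2_eq_square)

lemma resultant_sub_swap:
  "resultant_sub d d g f = (- 1 :: 'a::idom) ^ d * resultant_sub d d f g"
  using resultant_sub_linear_combination[of d 0 f 1 g 1 0] by simp

text \<open>The relation u f + v g = 0 is a linear dependence between the rows, with the
  coefficients of \<open>u\<close> and \<open>v\<close> as weights.\<close>

lemma resultant_sub_eq_0I: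
  fixes f g :: "'a::idom poly"
  assumes "degree f \<le> d" "degree g \<le> d" "degree u < d" "degree v < d"
    and "u \<noteq> 0 \<or> v \<noteq> 0" and eq: "u * f + v * g = 0"
  shows "resultant_sub d d f g = 0"
proof -
  let ?S = "sylvester_mat_sub d d f g"
  \<comment> \<open>Coefficients are listed from the top, since row \<open>i\<close> of either half
    belongs to the shift by d - 1 - i.\<close>
  define w where "w = vec (d + d) (\<lambda>i. if i < d then coeff u (d - 1 - i) else coeff v (d - 1 - (i - d)))"
  have expand: "(\<Sum>i<d. coeff (monom 1 (d - 1 - i) * h) m * coeff r (d - 1 - i)) = coeff (r * h) m"
    if "degree r < d" for r h :: "'a poly" and m
  proof -
    have "r = (\<Sum>k\<le>d - 1. monom (coeff r k) k)"
      using that by (intro poly_as_sum_of_monoms'[symmetric]) simp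
    also have "{..d - 1} = {..<d}" using that by auto
    also have "(\<Sum>k<d. monom (coeff r k) k) = (\<Sum>k<d. monom (coeff r (d - 1 - k)) (d - 1 - k))"
      by (subst sum.nat_diff_reindex[symmetric]) (auto intro!: sum.cong)
    finally have "r * h = (\<Sum>k<d. smult (coeff r (d - 1 - k)) (monom 1 (d - 1 - k) * h))"
      by (metis (no_types, lifting) mult_smult_left smult_monom mult.right_neutral sum.cong
          sum_distrib_right)
    then show ?thesis by (simp add: coeff_sum mult.commute)
  qed
  have "transpose_mat ?S *\<^sub>v w = 0\<^sub>v (d + d)"
  proof (rule eq_vecI)
    fix j assume "j < dim_vec (0\<^sub>v (d + d) :: 'a vec)"
    then have j: "j < d + d" by simp
    have "(transpose_mat ?S *\<^sub>v w) $ j = (\<Sum>i<d + d. ?S $$ (i, j) * w $ i)"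
      using j by (simp add: scalar_prod_def atLeast0LessThan w_def)
    also have "\<dots> = (\<Sum>i<d. ?S $$ (i, j) * w $ i) + (\<Sum>i<d. ?S $$ (d + i, j) * w $ (d + i))"
      by (rule sum_lessThan_add)
    also have "(\<Sum>i<d. ?S $$ (i, j) * w $ i) =
        (\<Sum>i<d. coeff (monom 1 (d - 1 - i) * f) (2 * d - 1 - j) * coeff u (d - 1 - i))"
      using j assms(1,2) by (intro sum.cong) (auto simp: w_def sylvester_mat_sub_index_shift)
    also have "\<dots> = coeff (u * f) (2 * d - 1 - j)" by (rule expand) fact
    also have "(\<Sum>i<d. ?S $$ (d + i, j) * w $ (d + i)) =
        (\<Sum>i<d. coeff (monom 1 (d - 1 - i) * g) (2 * d - 1 - j) * coeff v (d - 1 - i))"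
      using j assms(1,2) by (intro sum.cong) (auto simp: w_def sylvester_mat_sub_index_shift)
    also have "\<dots> = coeff (v * g) (2 * d - 1 - j)" by (rule expand) fact
    also have "coeff (u * f) (2 * d - 1 - j) + coeff (v * g) (2 * d - 1 - j) = 0"
      using eq by (metis coeff_0 coeff_add)
    finally show "(transpose_mat ?S *\<^sub>v w) $ j = 0\<^sub>v (d + d) $ j" using j by simp
  qed auto
  moreover have "w \<noteq> 0\<^sub>v (d + d)"
  proof
    assume w0: "w = 0\<^sub>v (d + d)"
    have "coeff u k = 0 \<and> coeff v k = 0" if "k < d" for k
    proof -
      have "w $ (d - 1 - k) = 0" "w $ (d + (d - 1 - k)) = 0"
        using that by (auto simp: w0)
      moreover have "w $ m = coeff u (d - 1 - m)" "w $ (d + m) = coeff v (d - 1 - m)" if "m < d" for m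
        using that by (simp_all add: w_def)
      moreover have "d - 1 - k < d" "d - 1 - (d - 1 - k) = k" using that by auto
      ultimately show ?thesis by metis
    qed
    then have "u = 0" "v = 0" using assms(3,4)
      by (metis leading_coeff_0_iff)+
    with assms(5) show False by simp
  qed
  moreover have "w \<in> carrier_vec (d + d)" by (simp add: w_def)
  ultimately have "det (transpose_mat ?S) = 0"
    by (subst det_0_iff_vec_prod_zero[of _ "d + d"]) auto
  then show ?thesis
    unfolding resultant_sub_def by (subst (asm) det_transpose[of _ "d + d"]) auto
qed

text \<open>Two forms of degree d that both lack X^d share the zero at infinity. Algebraically, g f
  - f g = 0 is then a relation with cofactors of degree below d; if both forms vanish, the cofactors
  1 and 0 serve.\<close>

lemma resultant_sub_nonzero_degree:
  fixes f g :: "'a::idom poly"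
  assumes "degree f \<le> d" "degree g \<le> d" "0 < d" "resultant_sub d d f g \<noteq> 0"
  shows "degree f = d \<or> degree g = d"
proof (rule ccontr)
  assume "\<not> ?thesis"
  then have lt: "degree f < d" "degree g < d" using assms by auto
  show False
  proof (cases "f = 0 \<and> g = 0")
    case True
    then show False using resultant_sub_eq_0I[of f d g 1 0] assms by auto
  next
    case False
    then show False using resultant_sub_eq_0I[of f d g g "- f"] assms lt by (auto simp: mult.commute)
  qed
qed

text \<open>A nonconstant common factor leaves cofactors f', g' of degree below d with g' f - f' g =
  0.\<close>

lemma resultant_sub_nonzero_coprime:
  fixes f g :: "'a::field_gcd poly"
  assumes "degree f \<le> d" "degree g \<le> d" "0 < d" "resultant_sub d d f g \<noteq> 0"
  shows "coprime f g"
proof (rule ccontr)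
  assume "\<not> coprime f g"
  then obtain h where h: "h dvd f" "h dvd g" "\<not> is_unit h" by (auto elim: not_coprimeE)
  have nz: "f \<noteq> 0 \<or> g \<noteq> 0" using resultant_sub_nonzero_degree[OF assms] assms(3) by auto
  then have "h \<noteq> 0" using h by auto
  with h(3) have dh: "0 < degree h" by (auto simp: is_unit_iff_degree)
  obtain f' g' where f': "f = h * f'" and g': "g = h * g'" using h by (auto elim!: dvdE)
  have lt: "degree r < d" if "degree (h * r) \<le> d" for r
    using that dh \<open>h \<noteq> 0\<close> assms(3) by (cases "r = 0") (auto simp: degree_mult_eq)
  have "resultant_sub d d f g = 0"
    by (rule resultant_sub_eq_0I[of _ _ _ g' "- f'"])
      (use assms lt[of f'] lt[of g'] nz f' g' in auto)
  with assms show False by simp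
qed

section \<open>Rational maps and primitive points\<close>

lemma quot_of_fract_Fract:
  fixes f g :: "rat poly"
  assumes "coprime f g" "g \<noteq> 0"
  obtains k where "k \<noteq> 0" "f = smult k (fst (quot_of_fract (Fract f g)))"
    "g = smult k (snd (quot_of_fract (Fract f g)))"
proof -
  have q: "quot_of_fract (Fract f g) = normalize_quot (f, g)"
    using assms(2) quot_of_fract_quot_to_fract[of "(f, g)"] by (simp add: quot_to_fract_def)
  obtain r where r: "f = fst (normalize_quot (f, g)) * r" "g = snd (normalize_quot (f, g)) * r"
    "r dvd f" "r dvd g" "r \<noteq> 0"
    using normalize_quotE[OF assms(2)] .
  have "is_unit r" by (rule coprime_common_divisor[OF assms(1) r(3,4)])
  then obtain k where k: "r = [:k:]" "k \<noteq> 0"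
    using is_unit_poly_iff[of r] r(5) by auto
  obtain u v where uv: "normalize_quot (f, g) = (u, v)" by fastforce
  have "f = smult k u" "g = smult k v" using r(1,2)[unfolded uv k(1)] by simp_all
  then have "f = smult k (fst (quot_of_fract (Fract f g)))" "g = smult k (snd (quot_of_fract (Fract f g)))"
    unfolding q uv by simp_all
  with k(2) show ?thesis by (rule that)
qed

lemma quot_of_fract_props:
  fixes \<phi> :: rat_fun
  shows "\<phi> = Fract (fst (quot_of_fract \<phi>)) (snd (quot_of_fract \<phi>))"
    "coprime (fst (quot_of_fract \<phi>)) (snd (quot_of_fract \<phi>))" "snd (quot_of_fract \<phi>) \<noteq> 0"
proof -
  show "\<phi> = Fract (fst (quot_of_fract \<phi>)) (snd (quot_of_fract \<phi>))"
    using quot_to_fract_quot_of_fract[of \<phi>] by (simp add: quot_to_fract_def case_prod_unfold)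
  have "quot_of_fract \<phi> \<in> normalized_fracts" by simp
  then show "coprime (fst (quot_of_fract \<phi>)) (snd (quot_of_fract \<phi>))" "snd (quot_of_fract \<phi>) \<noteq> 0"
    by (auto simp: normalized_fracts_def)
qed

lemma rat_fun_degree_Fract:
  assumes "coprime f g" "g \<noteq> 0"
  shows "rat_fun_degree (Fract f g) = max (degree f) (degree g)"
proof -
  obtain k where k: "k \<noteq> 0" "f = smult k (fst (quot_of_fract (Fract f g)))"
    "g = smult k (snd (quot_of_fract (Fract f g)))"
    using quot_of_fract_Fract[OF assms] .
  have "degree f = degree (fst (quot_of_fract (Fract f g)))"
    using arg_cong[OF k(2), of degree] k(1) by (simp only: degree_smult_eq if_False)
  moreover have "degree g = degree (snd (quot_of_fract (Fract f g)))"
    using arg_cong[OF k(3), of degree] k(1) by (simp only: degree_smult_eq if_False)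
  ultimately show ?thesis by (simp add: rat_fun_degree_def)
qed

lemma clear_denominators:
  fixes v :: "rat list"
  obtains D :: int and w where "D \<noteq> 0" "map rat_of_int w = map (\<lambda>x. rat_of_int D * x) v"
proof -
  have "\<exists>(D::int) w. D \<noteq> 0 \<and> map rat_of_int w = map (\<lambda>x. rat_of_int D * x) v"
  proof (induction v)
    case Nil
    then show ?case by (intro exI[of _ 1]) simp
  next
    case (Cons x v)
    then obtain D :: int and w where D: "D \<noteq> 0" "map rat_of_int w = map (\<lambda>x. rat_of_int D * x) v" by blast
    obtain r s where rs: "quotient_of x = (r, s)" by fastforce
    then have s: "s > 0" "x = rat_of_int r / rat_of_int s"
      using quotient_of_denom_pos quotient_of_div by blast+
    have "map rat_of_int (map (\<lambda>y. s * y) w) = map (\<lambda>x. rat_of_int s * x) (map rat_of_int w)" by simp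
    also have "\<dots> = map (\<lambda>x. rat_of_int (s * D) * x) v" unfolding D(2) by simp
    finally have "map rat_of_int (map (\<lambda>y. s * y) w) = map (\<lambda>x. rat_of_int (s * D) * x) v" .
    moreover have "rat_of_int (D * r) = rat_of_int (s * D) * x" using s(1) by (subst s(2)) simp
    ultimately have "map rat_of_int ((D * r) # map (\<lambda>y. s * y) w)
        = map (\<lambda>x. rat_of_int (s * D) * x) (x # v)"
      by simp
    moreover have "s * D \<noteq> 0" using D s by simp
    ultimately show ?case by blast
  qed
  then show ?thesis using that by blast
qed

lemma primitive_multiple:
  fixes v :: "rat list"
  assumes "length v = N + 1" "\<exists>x\<in>set v. x \<noteq> 0"
  obtains P \<kappa> where "P \<in> proj_points N" "\<kappa> \<noteq> 0" "map rat_of_int P = map (\<lambda>x. \<kappa> * x) v"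
proof -
  obtain D :: int and w where D: "D \<noteq> 0" "map rat_of_int w = map (\<lambda>x. rat_of_int D * x) v"
    using clear_denominators .
  have lw: "length w = N + 1" using arg_cong[OF D(2), of length] assms(1) by simp
  obtain m where m: "m < N + 1" "v ! m \<noteq> 0" using assms by (metis in_set_conv_nth)
  have wi: "rat_of_int (w ! i) = rat_of_int D * v ! i" if "i < N + 1" for i
    using arg_cong[OF D(2), of "\<lambda>l. l ! i"] that lw assms(1) by simp
  have "w ! m \<noteq> 0" using wi[OF m(1)] m(2) D(1) by auto
  define G where "G = Gcd (set w)"
  have "w ! m \<in> set w" using m(1) lw by simp
  with \<open>w ! m \<noteq> 0\<close> have "G \<noteq> 0" unfolding G_def Gcd_0_iff by blast
  have Gd: "G dvd x" if "x \<in> set w" for x using that unfolding G_def by (rule Gcd_dvd)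
  define i where "i = (LEAST i. w ! i \<noteq> 0)"
  have wi0: "w ! i \<noteq> 0" unfolding i_def by (rule LeastI) fact
  have i_min: "w ! j = 0" if "j < i" for j using not_less_Least that unfolding i_def by blast
  have "i \<le> m" unfolding i_def by (rule Least_le) fact
  then have iN: "i < N + 1" using m(1) by simp
  \<comment> \<open>Dividing by the content with the sign of the first nonzero coordinate makes the
    vector primitive and that coordinate positive at once.\<close>
  define s where "s = G * sgn (w ! i)"
  have s: "s \<noteq> 0" "\<bar>s\<bar> = G" using \<open>G \<noteq> 0\<close> wi0
    by (auto simp: s_def abs_mult abs_sgn_eq sgn_0_0 G_def)
  have sd: "s dvd x" if "x \<in> set w" for x using Gd[OF that] s(2) by (metis abs_dvd_iff)
  define P where "P = map (\<lambda>x. x div s) w"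
  have Pw: "w = map (\<lambda>x. s * x) P" unfolding P_def by (auto simp: sd o_def intro!: map_idI[symmetric])
  have lP: "length P = N + 1" by (simp add: P_def lw)
  have "\<bar>s\<bar> * 1 = \<bar>s\<bar> * Gcd (set P)"
  proof -
    have "Gcd (set w) = Gcd ((*) s ` set P)" by (subst Pw) simp
    also have "\<dots> = normalize (s * Gcd (set P))" by (rule Gcd_mult)
    finally show ?thesis using s by (simp add: G_def[symmetric] abs_mult)
  qed
  then have gcd1: "Gcd (set P) = 1" using s \<open>G \<noteq> 0\<close> by simp
  have wP: "w ! j = s * P ! j" if "j < N + 1" for j
    using that lP by (subst Pw) simp
  have "P \<in> proj_points N"
    unfolding proj_points_def
  proof (intro CollectI conjI exI allI impI)
    show "i \<le> N" using iN by simp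
    have "sgn (w ! i) * w ! i = (sgn (w ! i) * sgn (w ! i)) * (G * P ! i)"
      using arg_cong[OF wP[OF iN], of "\<lambda>x. sgn (w ! i) * x"] by (simp only: s_def ac_simps)
    moreover have "sgn (w ! i) * sgn (w ! i) = 1" "0 < sgn (w ! i) * w ! i"
      using wi0 by (simp_all add: sgn_if)
    ultimately have "0 < G * P ! i" by simp
    moreover have "0 < G" using \<open>G \<noteq> 0\<close> s(2) by simp
    ultimately show "0 < P ! i" by (simp add: zero_less_mult_iff)
    show "P ! j = 0" if "j < i" for j
      using i_min[OF that] wP[of j] iN that s(1) by simp
  qed (use lP gcd1 in auto)
  moreover have "map rat_of_int P = map (\<lambda>x. (rat_of_int D / rat_of_int s) * x) v"
  proof (rule nth_equalityI)
    fix j assume "j < length (map rat_of_int P)"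
    then have j: "j < N + 1" using lP by simp
    then have "rat_of_int s * rat_of_int (P ! j) = rat_of_int D * v ! j"
      using wi[OF j] wP[OF j] by simp
    then show "map rat_of_int P ! j = map (\<lambda>x. (rat_of_int D / rat_of_int s) * x) v ! j"
      using j lP assms(1) s(1) by (simp add: field_simps)
  qed (use lP assms(1) in auto)
  moreover have "rat_of_int D / rat_of_int s \<noteq> 0" using D s by simp
  ultimately show ?thesis using that by blast
qed

text \<open>With the ratio written as r / s, comparing contents gives |r| = |s|. The first nonzero
  coordinates sit at the same position and are both positive, which forces r = s.\<close>

lemma proj_points_unique:
  assumes P: "P \<in> proj_points N" and P': "P' \<in> proj_points N"
    and eq: "map rat_of_int P' = map (\<lambda>x. \<mu> * x) (map rat_of_int P)"
  shows "P = P'"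
proof -
  obtain r s where rs: "quotient_of \<mu> = (r, s)" by fastforce
  then have s: "s > 0" "\<mu> = rat_of_int r / rat_of_int s"
    using quotient_of_denom_pos quotient_of_div by blast+
  have l: "length P = N + 1" "length P' = N + 1" and g: "Gcd (set P) = 1" "Gcd (set P') = 1"
    using P P' by (auto simp: proj_points_def)
  have nth: "s * P' ! i = r * P ! i" if "i < N + 1" for i
  proof -
    have "rat_of_int (P' ! i) = \<mu> * rat_of_int (P ! i)"
      using arg_cong[OF eq, of "\<lambda>l. l ! i"] that l by simp
    then have "rat_of_int (s * P' ! i) = rat_of_int (r * P ! i)"
      using s by (simp add: field_simps)
    then show ?thesis by (simp only: of_int_eq_iff)
  qed
  have "map ((*) s) P' = map ((*) r) P"
    by (rule nth_equalityI) (use l nth in auto)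
  then have "(*) s ` set P' = (*) r ` set P" by (metis set_map)
  then have "Gcd ((*) s ` set P') = Gcd ((*) r ` set P)" by simp
  then have "\<bar>s\<bar> = \<bar>r\<bar>" by (simp add: Gcd_mult g)
  moreover obtain i where i: "i \<le> N" "0 < P ! i" "\<forall>j<i. P ! j = 0"
    using P by (auto simp: proj_points_def)
  obtain i' where i': "i' \<le> N" "0 < P' ! i'" "\<forall>j<i'. P' ! j = 0"
    using P' by (auto simp: proj_points_def)
  have "r \<noteq> 0" using \<open>\<bar>s\<bar> = \<bar>r\<bar>\<close> s by auto
  have "i = i'"
  proof (rule ccontr)
    assume "i \<noteq> i'"
    then consider "i < i'" | "i' < i" by linarith
    then show False
      using nth[of i] nth[of i'] i i' s \<open>r \<noteq> 0\<close> by cases auto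
  qed
  have "0 < s * P' ! i'" using i' s by simp
  then have "0 < r * P ! i" using nth[of i] \<open>i = i'\<close> i by simp
  then have "r > 0" using i by (simp add: zero_less_mult_iff)
  ultimately have "r = s" using s by simp
  then show ?thesis using nth s l by (intro nth_equalityI) auto
qed

section \<open>Coordinate vectors and the pairs of forms they encode\<close>

lemma coeff_num_form: "length P = 2 * d + 2 \<Longrightarrow> coeff (num_form d P) i = (if i \<le> d then P ! i else 0)"
  by (auto simp: num_form_def nth_default_def)

lemma coeff_den_form: "length P = 2 * d + 2 \<Longrightarrow> coeff (den_form d P) i = (if i
    \<le> d then P ! (d + 1 + i) else 0)"
  by (auto simp: den_form_def nth_default_def)

lemma degree_num_form: "length P = 2 * d + 2 \<Longrightarrow> degree (num_form d P) \<le> d"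
  by (intro degree_le) (auto simp: coeff_num_form)

lemma degree_den_form: "length P = 2 * d + 2 \<Longrightarrow> degree (den_form d P) \<le> d"
  by (intro degree_le) (auto simp: coeff_den_form)

definition form_coeffs :: "nat \<Rightarrow> rat poly \<Rightarrow> rat poly \<Rightarrow> rat list" where
  "form_coeffs d f g = map (coeff f) [0..<d + 1] @ map (coeff g) [0..<d + 1]"

lemma form_coeffs_forms:
  assumes "length P = 2 * d + 2"
  shows "map rat_of_int P =
    form_coeffs d (map_poly rat_of_int (num_form d P)) (map_poly rat_of_int (den_form d P))"
  by (rule nth_equalityI)
    (use assms in \<open>auto simp: form_coeffs_def nth_append coeff_map_poly coeff_num_form coeff_den_form
        simp del: upt_Suc\<close>)

lemma coprime_smult:
  fixes f g :: "'a::field_gcd poly"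
  assumes "k \<noteq> 0" "coprime f g"
  shows "coprime (smult k f) (smult k g)"
  by (rule coprimeI, rule coprime_common_divisor[OF assms(2)]) (use assms(1) in \<open>simp_all add:
      dvd_smult_iff\<close>)

lemma form_coeffs_smult:
  "form_coeffs d (smult k f) (smult k g) = map (\<lambda>x. k * x) (form_coeffs d f g)"
  by (simp add: form_coeffs_def)

lemma form_coeffs_inj:
  assumes "form_coeffs d f g = form_coeffs d f' g'" "degree f \<le> d" "degree f' \<le> d" "degree g
      \<le> d" "degree g' \<le> d"
  shows "f = f' \<and> g = g'"
proof -
  have "coeff f i = coeff f' i \<and> coeff g i = coeff g' i" for i
  proof (cases "i \<le> d")
    case True
    then show ?thesis using assms(1) by (auto simp: form_coeffs_def simp del: upt_Suc)
  next
    case False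
    then show ?thesis using assms(2-) by (simp add: coeff_eq_0)
  qed
  then show ?thesis by (auto intro: poly_eqI)
qed

lemma primitive_point_exists:
  assumes "degree f \<le> d" "degree g \<le> d" "f \<noteq> 0 \<or> g \<noteq> 0"
  obtains P \<kappa> where "P \<in> proj_points (2 * d + 1)" "\<kappa> \<noteq> 0"
    "map_poly rat_of_int (num_form d P) = smult \<kappa> f" "map_poly rat_of_int (den_form d P) = smult \<kappa> g"
proof -
  have "\<exists>x\<in>set (form_coeffs d f g). x \<noteq> 0"
  proof (rule ccontr)
    assume "\<not> ?thesis"
    then have "coeff f i = 0 \<and> coeff g i = 0" if "i \<le> d" for i
      using that by (auto simp: form_coeffs_def simp del: upt_Suc)
    then have "coeff f (degree f) = 0" "coeff g (degree g) = 0" using assms by auto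
    then show False using assms(3) by simp
  qed
  moreover have "length (form_coeffs d f g) = (2 * d + 1) + 1" by (simp add: form_coeffs_def)
  ultimately obtain P \<kappa> where P: "P \<in> proj_points (2 * d + 1)" "\<kappa> \<noteq> 0"
    "map rat_of_int P = map (\<lambda>x. \<kappa> * x) (form_coeffs d f g)"
    using primitive_multiple by blast
  then have l: "length P = 2 * d + 2" by (simp add: proj_points_def)
  have "form_coeffs d (map_poly rat_of_int (num_form d P)) (map_poly rat_of_int (den_form d P))
     = form_coeffs d (smult \<kappa> f) (smult \<kappa> g)"
    using form_coeffs_forms[OF l] P(3) by (simp add: form_coeffs_smult)
  then have "map_poly rat_of_int (num_form d P) = smult \<kappa> f \<and> map_poly rat_of_int (den_form d P)
      = smult \<kappa> g"
    by (rule form_coeffs_inj)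
      (use l assms in \<open>auto intro: order.trans[OF degree_map_poly_le] order.trans[OF degree_smult_le]
          degree_num_form degree_den_form\<close>)
  then show ?thesis using that P by blast
qed

text \<open>Both vectors are multiples of the coefficient vector of the normalized numerator and
  denominator, hence of each other.\<close>

lemma represents_unique:
  assumes "P \<in> proj_points (2 * d + 1)" "P' \<in> proj_points (2 * d + 1)"
    "represents d P \<phi>" "represents d P' \<phi>"
  shows "P = P'"
proof -
  have l: "length P = 2 * d + 2" "length P' = 2 * d + 2" using assms by (auto simp: proj_points_def)
  have *: "\<exists>k. k \<noteq> 0 \<and> map_poly rat_of_int (num_form d P) = smult k (fst (quot_of_fract \<phi>)) \<and>
     map_poly rat_of_int (den_form d P) = smult k (snd (quot_of_fract \<phi>))"
    if "represents d P \<phi>" for P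
  proof -
    let ?f = "map_poly rat_of_int (num_form d P)" and ?g = "map_poly rat_of_int (den_form d P)"
    have r: "coprime ?f ?g" "?g \<noteq> 0" "\<phi> = Fract ?f ?g"
      using that unfolding represents_def Let_def by blast+
    show ?thesis by (rule quot_of_fract_Fract[OF r(1,2), folded r(3)]) blast
  qed
  obtain k where k: "k \<noteq> 0" "map_poly rat_of_int (num_form d P) = smult k (fst (quot_of_fract \<phi>))"
     "map_poly rat_of_int (den_form d P) = smult k (snd (quot_of_fract \<phi>))"
    using *[OF assms(3)] by blast
  obtain k' where k': "k' \<noteq> 0" "map_poly rat_of_int (num_form d P') = smult k' (fst (quot_of_fract \<phi>))"
     "map_poly rat_of_int (den_form d P') = smult k' (snd (quot_of_fract \<phi>))"
    using *[OF assms(4)] by blast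
  have "map rat_of_int P' = map (\<lambda>x. k' / k * x) (map rat_of_int P)"
    unfolding form_coeffs_forms[OF l(1)] form_coeffs_forms[OF l(2)] k k' form_coeffs_smult
    using k(1) by simp
  then show ?thesis using proj_points_unique assms(1,2) by blast
qed

lemma map_point_eq:
  assumes "rat_fun_degree \<phi> = d" "P \<in> proj_points (2 * d + 1)" "represents d P \<phi>"
  shows "map_point \<phi> = P"
  unfolding map_point_def Let_def assms(1)
  by (rule the_equality) (use assms represents_unique in blast)+

definition point_resultant :: "nat \<Rightarrow> int list \<Rightarrow> int" where
  "point_resultant d P = resultant_sub d d (num_form d P) (den_form d P)"

lemma map_resultant_eq:
  "rat_fun_degree \<phi> = d \<Longrightarrow> map_resultant \<phi> = point_resultant d (map_point \<phi>)"
  by (simp add: map_resultant_def point_resultant_def Let_def)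

lemma of_int_resultant_sub:
  "of_int (resultant_sub m n p q) = (resultant_sub m n (map_poly of_int p) (map_poly of_int q) ::
      'a::comm_ring_1)"
proof -
  interpret of_int_hom: comm_ring_hom "of_int :: int \<Rightarrow> 'a" by unfold_locales auto
  show ?thesis unfolding resultant_sub_def
    by (subst of_int_hom.hom_det[symmetric]) (simp add: sylvester_mat_sub_map)
qed

text \<open>Passes from an arbitrary rational lift \<open>(f, g)\<close> to the primitive one. A
  nonzero formal resultant yields coprimality and the exact degree \<open>d\<close>; rescaling by
  \<kappa> multiplies the resultant, which is homogeneous of degree 2d, by \<kappa>^(2d).\<close>

lemma map_point_Fract:
  assumes d: "0 < d" and f: "degree f \<le> d" "degree g \<le> d" "resultant_sub d d f g \<noteq> 0"
  obtains \<kappa> where "\<kappa> \<noteq> 0" "rat_fun_degree (Fract f g) = d"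
    "map_point (Fract f g) \<in> proj_points (2 * d + 1)"
    "map_poly rat_of_int (num_form d (map_point (Fract f g))) = smult \<kappa> f"
    "map_poly rat_of_int (den_form d (map_point (Fract f g))) = smult \<kappa> g"
    "rat_of_int (map_resultant (Fract f g)) = \<kappa> ^ (2 * d) * resultant_sub d d f g"
proof -
  have cop: "coprime f g" by (rule resultant_sub_nonzero_coprime) fact+
  have deg: "degree f = d \<or> degree g = d" by (rule resultant_sub_nonzero_degree) fact+
  \<comment> \<open>Were \<open>g\<close> zero, coprimality would make \<open>f\<close> constant,
    whereas one of the two degrees is d > 0.\<close>
  have g0: "g \<noteq> 0" using cop deg d by (auto simp: is_unit_iff_degree)
  have rd: "rat_fun_degree (Fract f g) = d"
    using rat_fun_degree_Fract[OF cop g0] deg f by auto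
  obtain P \<kappa> where P: "P \<in> proj_points (2 * d + 1)" "\<kappa> \<noteq> 0"
    "map_poly rat_of_int (num_form d P) = smult \<kappa> f" "map_poly rat_of_int (den_form d P) = smult \<kappa> g"
    using primitive_point_exists[of f d g] f g0 by blast
  have "represents d P (Fract f g)"
    using P cop g0 by (simp add: represents_def eq_fract mult.commute coprime_smult)
  then have mp: "map_point (Fract f g) = P" using rd P(1) by (intro map_point_eq)
  have "rat_of_int (map_resultant (Fract f g)) = \<kappa> ^ (2 * d) * resultant_sub d d f g"
    unfolding map_resultant_eq[OF rd] mp point_resultant_def of_int_resultant_sub P(3,4)
    by (rule resultant_sub_smult)
  then show ?thesis using that P mp rd by blast
qed

lemma map_point_in_proj_points:
  assumes "rat_fun_degree \<phi> = d"
  shows "map_point \<phi> \<in> proj_points (2 * d + 1)" "represents d (map_point \<phi>) \<phi>"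
proof -
  let ?f = "fst (quot_of_fract \<phi>)" and ?g = "snd (quot_of_fract \<phi>)"
  have "degree ?f \<le> d" "degree ?g \<le> d" using assms by (auto simp: rat_fun_degree_def)
  then obtain P \<kappa> where P: "P \<in> proj_points (2 * d + 1)" "\<kappa> \<noteq> 0"
    "map_poly rat_of_int (num_form d P) = smult \<kappa> ?f" "map_poly rat_of_int (den_form d P) = smult \<kappa> ?g"
    using primitive_point_exists[of ?f d ?g] quot_of_fract_props(3)[of \<phi>] by blast
  have "Fract (smult \<kappa> ?f) (smult \<kappa> ?g) = Fract ?f ?g"
    using P(2) quot_of_fract_props(3)[of \<phi>] by (subst eq_fract) (auto simp: mult.commute)
  then have r: "represents d P \<phi>"
    using P quot_of_fract_props[of \<phi>]
    by (simp add: represents_def coprime_smult)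
  then show "map_point \<phi> \<in> proj_points (2 * d + 1)" "represents d (map_point \<phi>) \<phi>"
    using map_point_eq[OF assms P(1) r] P(1) by auto
qed

text \<open>A primitive vector is the point of a map of degree \<open>d\<close> only if its two
  forms are coprime, so the condition has to exclude resultant zero for every listed point to be
  attained.\<close>

lemma map_point_image:
  assumes d: "0 < d" and nz: "\<And>n. Q n \<Longrightarrow> n \<noteq> 0"
  shows "map_point ` {\<phi> \<in> rat_maps d. Q (map_resultant \<phi>)} =
    {P \<in> proj_points (2 * d + 1). Q (point_resultant d P)}"
proof (intro equalityI subsetI)
  fix P assume "P \<in> map_point ` {\<phi> \<in> rat_maps d. Q (map_resultant \<phi>)}"
  then show "P \<in> {P \<in> proj_points (2 * d + 1). Q (point_resultant d P)}"
    using map_point_in_proj_points map_resultant_eq by (auto simp: rat_maps_def)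
next
  fix P assume "P \<in> {P \<in> proj_points (2 * d + 1). Q (point_resultant d P)}"
  then have P: "P \<in> proj_points (2 * d + 1)" "Q (point_resultant d P)" by auto
  then have l: "length P = 2 * d + 2" by (simp add: proj_points_def)
  let ?f = "map_poly rat_of_int (num_form d P)" and ?g = "map_poly rat_of_int (den_form d P)"
  have deg: "degree ?f \<le> d" "degree ?g \<le> d"
    using l by (auto intro: order.trans[OF degree_map_poly_le] degree_num_form degree_den_form)
  have R: "resultant_sub d d ?f ?g \<noteq> 0"
    using nz[OF P(2)] unfolding point_resultant_def
    by (metis of_int_resultant_sub of_int_eq_0_iff)
  have cop: "coprime ?f ?g" by (rule resultant_sub_nonzero_coprime) fact+
  have "degree ?f = d \<or> degree ?g = d" by (rule resultant_sub_nonzero_degree) fact+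
  then have g0: "?g \<noteq> 0" using cop d by (auto simp: is_unit_iff_degree)
  have "represents d P (Fract ?f ?g)" using cop g0 by (simp add: represents_def)
  moreover obtain \<kappa> where "rat_fun_degree (Fract ?f ?g) = d"
    using map_point_Fract[OF d deg R] .
  ultimately have "map_point (Fract ?f ?g) = P" "Fract ?f ?g \<in> rat_maps d"
      "map_resultant (Fract ?f ?g) = point_resultant d P"
    using map_point_eq P(1) map_resultant_eq by (auto simp: rat_maps_def)
  then show "P \<in> map_point ` {\<phi> \<in> rat_maps d. Q (map_resultant \<phi>)}"
    using P(2) by (intro image_eqI[of _ _ "Fract ?f ?g"]) simp_all
qed

section \<open>Conjugation and minimality\<close>

definition fun_eval :: "rat poly \<Rightarrow> rat_fun \<Rightarrow> rat_fun" where
  "fun_eval f \<psi> = poly (map_poly rat_fun_const f) \<psi>"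

lemma rat_fun_const_hom [simp]:
  "rat_fun_const 0 = 0" "rat_fun_const 1 = 1"
  "rat_fun_const (x + y) = rat_fun_const x + rat_fun_const y"
  "rat_fun_const (x * y) = rat_fun_const x * rat_fun_const y"
  by (simp_all add: rat_fun_const_def one_pCons[symmetric] del: to_fract_add to_fract_mult
      flip: to_fract_add to_fract_mult)

lemma fun_eval_smult: "fun_eval (smult k f) \<psi> = rat_fun_const k * fun_eval f \<psi>"
  by (simp add: fun_eval_def map_poly_smult)

lemma fun_eval_sum:
  assumes "degree f \<le> m"
  shows "fun_eval f \<psi> = (\<Sum>i\<le>m. rat_fun_const (coeff f i) * \<psi> ^ i)"
proof -
  have "degree (map_poly rat_fun_const f) \<le> m"
    using degree_map_poly_le[of rat_fun_const f] assms by linarith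
  then show ?thesis
    unfolding fun_eval_def poly_altdef
    by (intro sum.mono_neutral_cong_left) (auto simp: coeff_map_poly[symmetric] coeff_eq_0)
qed

text \<open>The normalized pair differs from \<open>(f, g)\<close> by a nonzero constant, which
  cancels in the quotient.\<close>

lemma rat_fun_compose_Fract:
  assumes "coprime f g" "g \<noteq> 0"
  shows "rat_fun_compose (Fract f g) \<psi> = fun_eval f \<psi> / fun_eval g \<psi>"
proof -
  obtain u v where uv: "quot_of_fract (Fract f g) = (u, v)" by fastforce
  obtain k where k: "k \<noteq> 0" "f = smult k u" "g = smult k v"
    using quot_of_fract_Fract[OF assms] unfolding uv by auto
  have "rat_fun_const k \<noteq> 0" using k(1) by (simp add: rat_fun_const_def)
  then have "fun_eval f \<psi> / fun_eval g \<psi> = fun_eval u \<psi> / fun_eval v \<psi>"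
    by (simp add: k fun_eval_smult)
  then show ?thesis by (simp add: rat_fun_compose_def uv fun_eval_def)
qed

text \<open>Multiplying by the m-th power of the denominator turns each power of the linear fraction
  into a product of m linear factors, which is the homogeneous substitution.\<close>

lemma fun_eval_lin_frac:
  assumes "degree f \<le> m" "[:e, c:] \<noteq> 0"
  shows "fun_eval f (lin_frac a b c e) = to_fract (hsubst m a b c e f) / to_fract [:e, c:] ^ m"
proof -
  let ?N = "to_fract [:b, a:]" and ?D = "to_fract [:e, c:]"
  have D: "?D \<noteq> 0" using assms(2) by simp
  have lf: "lin_frac a b c e = ?N / ?D" by (simp only: lin_frac_def Fract_conv_to_fract)
  have pow: "(y ^ i * z) * (r * (x / y) ^ i) = r * (x ^ i * z)" if "y \<noteq> 0" for x y z r :: rat_fun and i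
    using that by (simp add: power_divide)
  have "?D ^ m * fun_eval f (lin_frac a b c e) =
    (\<Sum>i\<le>m. rat_fun_const (coeff f i) * (?N ^ i * ?D ^ (m - i)))"
    unfolding fun_eval_sum[OF assms(1)] sum_distrib_left
  proof (intro sum.cong refl)
    fix i assume "i \<in> {..m}"
    then have Dm: "?D ^ m = ?D ^ i * ?D ^ (m - i)" by (simp flip: power_add)
    show "?D ^ m * (rat_fun_const (coeff f i) * lin_frac a b c e ^ i) =
        rat_fun_const (coeff f i) * (?N ^ i * ?D ^ (m - i))"
      unfolding lf by (subst Dm) (rule pow[OF D])
  qed
  also have "\<dots> = to_fract (hsubst m a b c e f)"
  proof -
    have "to_fract (\<Sum>i\<in>A. h i) = (\<Sum>i\<in>A. to_fract (h i))" for h :: "nat \<Rightarrow> rat poly" and A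
      by (induction A rule: infinite_finite_induct) (simp_all add: to_fract_add)
    moreover have "to_fract (p ^ i) = to_fract p ^ i" for p :: "rat poly" and i
      by (induction i) (simp_all add: to_fract_mult)
    moreover have "to_fract (smult k p) = rat_fun_const k * to_fract p" for k and p :: "rat poly"
      by (simp add: rat_fun_const_def flip: to_fract_mult)
    ultimately show ?thesis by (simp add: hsubst_def to_fract_mult)
  qed
  finally have "fun_eval f (lin_frac a b c e) * ?D ^ m = to_fract (hsubst m a b c e f)"
    by (simp only: mult.commute)
  then show ?thesis by (rule nonzero_eq_divide_eq[THEN iffD2, OF power_not_zero[OF D]])
qed

text \<open>In homogeneous coordinates, conjugation substitutes A into both forms and then applies
  the adjugate to the pair. For the quotients to be cancelled, \<open>g\<close> and
  \<open>g'\<close> must be nonzero; both facts come from nonzero resultants.\<close>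

lemma conjugate_map_Fract:
  assumes d: "0 < d" and f: "degree f \<le> d" "degree g \<le> d" "resultant_sub d d f g \<noteq> 0"
    and \<delta>: "a * e - b * c \<noteq> 0"
  defines "f' \<equiv> hsubst d a b c e f" and "g' \<equiv> hsubst d a b c e g"
  shows "conjugate_map a b c e (Fract f g) =
    Fract (smult e f' + smult (- b) g') (smult (- c) f' + smult a g')"
proof -
  have nonzero: "q \<noteq> 0" if "coprime p q" "degree p = d \<or> degree q = d" for p q :: "rat poly"
    using that d by (auto simp: is_unit_iff_degree)
  have cop: "coprime f g" by (rule resultant_sub_nonzero_coprime) fact+
  have g0: "g \<noteq> 0"
    by (rule nonzero[OF cop]) (rule resultant_sub_nonzero_degree, fact+)
  obtain s where s: "s \<in> {1, -1}" "resultant_sub d d f' g'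
      = s * (a * e - b * c) ^ (d * d) * resultant_sub d d f g"
    unfolding f'_def g'_def using resultant_sub_hsubst[OF f(1,2) \<delta>] by blast
  then have R': "resultant_sub d d f' g' \<noteq> 0" using f(3) \<delta> by auto
  have deg': "degree f' \<le> d" "degree g' \<le> d" unfolding f'_def g'_def by (rule degree_hsubst_le)+
  have g'0: "g' \<noteq> 0"
    by (rule nonzero[OF resultant_sub_nonzero_coprime[OF deg' d R'] resultant_sub_nonzero_degree[OF deg'
        d R']])
  have D: "[:e, c:] \<noteq> 0" using \<delta> by auto
  have cancel: "x / z / (y / z) = x / y" if "z \<noteq> 0" for x y z :: rat_fun
    using that by simp
  have "rat_fun_compose (Fract f g) (lin_frac a b c e) = to_fract f' / to_fract g'"
    unfolding rat_fun_compose_Fract[OF cop g0] fun_eval_lin_frac[OF f(1) D] fun_eval_lin_frac[OF f(2) D]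
    unfolding f'_def g'_def by (rule cancel) (use D in \<open>simp only: power_not_zero to_fract_eq_0_iff
        not_False_eq_True\<close>)
  moreover have "coprime [:- b, e:] [:a, - c:]"
  proof (rule coprimeI)
    fix r assume "r dvd [:- b, e:]" "r dvd [:a, - c:]"
    \<comment> \<open>This combination eliminates z and leaves the nonzero determinant as a
      constant.\<close>
    then have "r dvd smult c [:- b, e:] + smult e [:a, - c:]" by (intro dvd_add dvd_smult)
    also have "smult c [:- b, e:] + smult e [:a, - c:] = [:a * e - b * c:]" by (simp add: algebra_simps)
    finally show "is_unit r" using \<delta> by (meson dvd_trans is_unit_pCons_iff dvd_field_iff
        is_unit_iff_degree degree_pCons_0 pCons_eq_0_iff)
  qed
  moreover have "[:a, - c:] \<noteq> 0" using \<delta> by auto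
  ultimately have "conjugate_map a b c e (Fract f g) =
      fun_eval [:- b, e:] (to_fract f' / to_fract g') / fun_eval [:a, - c:] (to_fract f' / to_fract g')"
    unfolding conjugate_map_def lin_frac_def by (subst rat_fun_compose_Fract) auto
  moreover have "fun_eval [:y, x:] (to_fract f' / to_fract g')
      = to_fract (smult x f' + smult y g') / to_fract g'"
    for x y
  proof -
    have "to_fract (smult k p) = rat_fun_const k * to_fract p" for k and p :: "rat poly"
      by (simp add: rat_fun_const_def flip: to_fract_mult)
    then show ?thesis
      using g'0 by (subst fun_eval_sum[of _ 1]) (auto simp: to_fract_add field_simps)
  qed
  ultimately show ?thesis using g'0 by (simp only: Fract_conv_to_fract) simp
qed

lemma hsubst_identity:
  assumes "degree f \<le> m"
  shows "hsubst m 1 0 0 1 f = f"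
proof -
  have "hsubst m 1 0 0 1 f = (\<Sum>i\<le>m. monom (coeff f i) i)"
    unfolding hsubst_def by (intro sum.cong) (auto simp: monom_altdef simp flip: one_pCons)
  then show ?thesis using poly_as_sum_of_monoms'[OF assms] by simp
qed

text \<open>The substitution contributes the determinant to the power d^2, the adjugate to the power
  d, and the return to primitive coordinates a 2d-th power.\<close>

lemma map_resultant_conjugate:
  assumes d: "0 < d" "odd d" and \<phi>: "\<phi> \<in> rat_maps d" "map_resultant \<phi> \<noteq> 0"
    and \<delta>: "a * e - b * c \<noteq> 0"
  obtains u s where "s \<in> {1, -1}" "u \<noteq> 0"
    "rat_of_int (map_resultant (conjugate_map a b c e \<phi>)) = s * u ^ (2 * d) * rat_of_int (map_resultant \<phi>)"
proof -
  let ?P = "map_point \<phi>"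
  let ?f = "map_poly rat_of_int (num_form d ?P)" and ?g = "map_poly rat_of_int (den_form d ?P)"
  have rd: "rat_fun_degree \<phi> = d" using \<phi> by (simp add: rat_maps_def)
  note P = map_point_in_proj_points[OF rd]
  have l: "length ?P = 2 * d + 2" using P(1) by (simp add: proj_points_def)
  have deg: "degree ?f \<le> d" "degree ?g \<le> d"
    using l by (auto intro: order.trans[OF degree_map_poly_le] degree_num_form degree_den_form)
  have \<phi>_eq: "\<phi> = Fract ?f ?g" using P(2) unfolding represents_def Let_def by blast
  have Req: "rat_of_int (map_resultant \<phi>) = resultant_sub d d ?f ?g"
    unfolding map_resultant_eq[OF rd] point_resultant_def by (rule of_int_resultant_sub)
  then have R: "resultant_sub d d ?f ?g \<noteq> 0" using \<phi>(2) by (metis of_int_eq_0_iff)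
  let ?f' = "hsubst d a b c e ?f" and ?g' = "hsubst d a b c e ?g"
  let ?f'' = "smult e ?f' + smult (- b) ?g'" and ?g'' = "smult (- c) ?f' + smult a ?g'"
  let ?\<delta> = "a * e - b * c"
  obtain s where s: "s \<in> {1, -1}"
    "resultant_sub d d ?f' ?g' = s * ?\<delta> ^ (d * d) * resultant_sub d d ?f ?g"
    using resultant_sub_hsubst[OF deg \<delta>] by blast
  have "resultant_sub d d ?f'' ?g'' = (e * a - (- b) * (- c)) ^ d * resultant_sub d d ?f' ?g'"
    by (rule resultant_sub_linear_combination)
  also have "e * a - (- b) * (- c) = ?\<delta>" by simp
  finally have R'': "resultant_sub d d ?f'' ?g'' = s * ?\<delta> ^ (d + d * d) * resultant_sub d d ?f ?g"
    unfolding s(2) by (simp add: power_add ac_simps)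
  \<comment> \<open>Oddness enters here: d + 1 = 2 (j + 1), so that d + d^2 = (j + 1) 2d.\<close>
  obtain j where j: "d = 2 * j + 1" using d(2) by (auto elim: oddE)
  have "d + d * d = (j + 1) * (2 * d)" by (simp add: j algebra_simps)
  with R'' have R'': "resultant_sub d d ?f'' ?g'' = s * (?\<delta> ^ (j + 1)) ^ (2 * d) * resultant_sub d d ?f ?g"
    by (simp only: power_mult)
  have deg'': "degree ?f'' \<le> d" "degree ?g'' \<le> d"
    by (intro degree_add_le order.trans[OF degree_smult_le] degree_hsubst_le)+
  have "resultant_sub d d ?f'' ?g'' \<noteq> 0" unfolding R'' using R \<delta> s(1) by auto
  then obtain k where k: "k \<noteq> 0"
    "rat_of_int (map_resultant (Fract ?f'' ?g'')) = k ^ (2 * d) * resultant_sub d d ?f'' ?g''"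
    using map_point_Fract[OF d(1) deg''] by metis
  have "conjugate_map a b c e \<phi> = Fract ?f'' ?g''"
    by (subst \<phi>_eq) (rule conjugate_map_Fract[OF d(1) deg R \<delta>])
  with k(2) have "rat_of_int (map_resultant (conjugate_map a b c e \<phi>)) =
      s * (k * ?\<delta> ^ (j + 1)) ^ (2 * d) * rat_of_int (map_resultant \<phi>)"
    unfolding R'' Req by (simp only: power_mult_distrib ac_simps)
  then show ?thesis using that[OF s(1)] k(1) \<delta> by (metis mult_eq_0_iff power_eq_0_iff)
qed

lemma conjugate_map_identity:
  assumes d: "0 < d" and \<phi>: "\<phi> \<in> rat_maps d" "map_resultant \<phi> \<noteq> 0"
  shows "conjugate_map 1 0 0 1 \<phi> = \<phi>"
proof -
  let ?P = "map_point \<phi>"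
  let ?f = "map_poly rat_of_int (num_form d ?P)" and ?g = "map_poly rat_of_int (den_form d ?P)"
  have rd: "rat_fun_degree \<phi> = d" using \<phi> by (simp add: rat_maps_def)
  note P = map_point_in_proj_points[OF rd]
  have l: "length ?P = 2 * d + 2" using P(1) by (simp add: proj_points_def)
  have deg: "degree ?f \<le> d" "degree ?g \<le> d"
    using l by (auto intro: order.trans[OF degree_map_poly_le] degree_num_form degree_den_form)
  have \<phi>_eq: "\<phi> = Fract ?f ?g" using P(2) unfolding represents_def Let_def by blast
  have "rat_of_int (map_resultant \<phi>) = resultant_sub d d ?f ?g"
    unfolding map_resultant_eq[OF rd] point_resultant_def by (rule of_int_resultant_sub)
  then have R: "resultant_sub d d ?f ?g \<noteq> 0" using \<phi>(2) by (metis of_int_eq_0_iff)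
  have "conjugate_map 1 0 0 1 (Fract ?f ?g) = Fract ?f ?g"
    using conjugate_map_Fract[OF d deg R, of 1 1 0 0]
    by (simp add: hsubst_identity[OF deg(1)] hsubst_identity[OF deg(2)])
  then show ?thesis by (simp only: \<phi>_eq[symmetric])
qed

text \<open>Write u = m / n in lowest terms. If p divided n, then p^k would divide m^k R with m
  prime to p, hence R, against power-freeness. So n contributes nothing at p and the exponent can
  only grow.\<close>

lemma multiplicity_le_of_power_free:
  fixes R R' :: int
  assumes "power_free k R" "prime p" "0 < k" "u \<noteq> 0" "s \<in> {1, -1}"
    and eq: "rat_of_int R' = s * u ^ k * rat_of_int R"
  shows "multiplicity p R \<le> multiplicity p R'"
proof -
  obtain m n where mn: "quotient_of u = (m, n)" by fastforce
  have n: "n > 0" "u = rat_of_int m / rat_of_int n" and cop: "coprime m n"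
    using quotient_of_denom_pos[OF mn] quotient_of_div[OF mn] quotient_of_coprime[OF mn] by auto
  have R0: "R \<noteq> 0" using assms(1,2) unfolding power_free_def by (metis dvd_0_right)
  have "rat_of_int R' * rat_of_int n ^ k = s * rat_of_int m ^ k * rat_of_int R"
    using n(1) by (simp add: eq n(2) power_divide)
  moreover obtain t :: int where t: "s = rat_of_int t" "t \<in> {1, -1}"
    using assms(5) by (auto intro: that[of 1] that[of "-1"])
  ultimately have "rat_of_int (R' * n ^ k) = rat_of_int (t * m ^ k * R)" by simp
  then have int_eq: "R' * n ^ k = t * m ^ k * R" by (simp only: of_int_eq_iff)
  have m0: "m \<noteq> 0" using n assms(4) by auto
  have R'0: "R' \<noteq> 0" using int_eq m0 R0 t(2) by auto
  have pn: "\<not> p dvd n"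
  proof
    assume "p dvd n"
    then have "\<not> p dvd m" using cop assms(2) by (meson coprime_common_divisor not_prime_unit)
    then have "coprime (p ^ k) (m ^ k)"
      using assms(2) by (simp add: prime_imp_coprime)
    moreover have "p ^ k dvd n ^ k" using \<open>p dvd n\<close> by (rule dvd_power_same)
    then have "p ^ k dvd t * m ^ k * R" unfolding int_eq[symmetric] by simp
    then have "p ^ k dvd m ^ k * R" using t(2) by auto
    ultimately have "p ^ k dvd R" by (simp add: coprime_dvd_mult_right_iff)
    then show False using assms(1,2) by (simp add: power_free_def)
  qed
  have pe: "prime_elem p" using assms(2) by (rule prime_imp_prime_elem)
  have "multiplicity p R \<le> multiplicity p (t * m ^ k) + multiplicity p R" by simp
  also have "\<dots> = multiplicity p (t * m ^ k * R)"
    using t(2) m0 R0 by (intro prime_elem_multiplicity_mult_distrib[symmetric] pe) auto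
  also have "\<dots> = multiplicity p R' + multiplicity p (n ^ k)"
    unfolding int_eq[symmetric] using R'0 n
    by (intro prime_elem_multiplicity_mult_distrib pe) auto
  also have "multiplicity p (n ^ k) = 0"
    using pn prime_dvd_power[OF assms(2)] by (intro not_dvd_imp_multiplicity_0) blast
  finally show ?thesis by simp
qed

lemma multiplicity_int: "multiplicity (int p) (int n) = multiplicity p n"
  unfolding multiplicity_def by (simp flip: of_nat_power)

text \<open>At each prime the minimal exponent is attained at the identity matrix, so the product
  defining the minimal resultant is the prime factorization of the absolute resultant.\<close>

lemma globally_minimal_of_power_free:
  assumes d: "0 < d" "odd d" and \<phi>: "\<phi> \<in> rat_maps d" "power_free (2 * d) (map_resultant \<phi>)"
  shows "globally_minimal \<phi>"
proof -
  have nz: "map_resultant \<phi> \<noteq> 0"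
  proof
    assume "map_resultant \<phi> = 0"
    moreover have "prime (2::int)" by simp
    ultimately show False using \<phi>(2) unfolding power_free_def by (metis dvd_0_right)
  qed
  let ?n = "nat \<bar>map_resultant \<phi>\<bar>"
  have n0: "?n \<noteq> 0" using nz by simp
  have exp: "min_res_exponent p \<phi> = multiplicity p ?n" if p: "prime p" for p
  proof -
    have "min_res_exponent p \<phi> = multiplicity (int p) (map_resultant \<phi>)"
      unfolding min_res_exponent_def
    proof (rule Least_equality)
      show "\<exists>a b c e. a * e - b * c \<noteq> (0::rat) \<and>
          multiplicity (int p) (map_resultant \<phi>)
              = multiplicity (int p) (map_resultant (conjugate_map a b c e \<phi>))"
        using conjugate_map_identity[OF d(1) \<phi>(1) nz]
        by (intro exI[of _ 1] exI[of _ 0]) simp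
    next
      fix k assume "\<exists>a b c e. a * e - b * c \<noteq> 0 \<and> k
          = multiplicity (int p) (map_resultant (conjugate_map a b c e \<phi>))"
      then obtain a b c e where \<delta>: "a * e - b * c \<noteq> 0"
        and k: "k = multiplicity (int p) (map_resultant (conjugate_map a b c e \<phi>))" by blast
      obtain u s where "s \<in> {1, -1}" "u \<noteq> 0"
        "rat_of_int (map_resultant (conjugate_map a b c e \<phi>))
            = s * u ^ (2 * d) * rat_of_int (map_resultant \<phi>)"
        using map_resultant_conjugate[OF d \<phi>(1) nz \<delta>] .
      then show "multiplicity (int p) (map_resultant \<phi>) \<le> k"
        unfolding k using p d(1) by (intro multiplicity_le_of_power_free[OF \<phi>(2)]) auto
    qed
    also have "\<dots> = multiplicity (int p) (int ?n)"
      using multiplicity_normalize_right[of "int p" "map_resultant \<phi>"] by (simp add: normalize_int_def)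
    also have "\<dots> = multiplicity p ?n" by (rule multiplicity_int)
    finally show ?thesis .
  qed
  have "{p. prime p \<and> min_res_exponent p \<phi> \<noteq> 0} = prime_factors ?n"
    using exp n0 by (auto simp: prime_factors_multiplicity)
  then have "minimal_resultant \<phi> = (\<Prod>p\<in>prime_factors ?n. p ^ multiplicity p ?n)"
    unfolding minimal_resultant_def by (intro prod.cong) (auto simp: exp in_prime_factors_imp_prime)
  also have "\<dots> = ?n" using prod_prime_factors[OF n0] by simp
  finally show ?thesis by (simp add: globally_minimal_def)
qed

section \<open>Resultants divisible by a high prime power\<close>

text \<open>The left half of the rows belonging to \<open>p\<close> is upper triangular with the
  leading coefficient on the diagonal. The right half is lower triangular with the constant
  coefficient there, so changing that coefficient adds a scalar matrix to the right half and leaves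
  the left half alone.\<close>

definition sylvester_left :: "nat \<Rightarrow> 'a::zero poly \<Rightarrow> 'a mat" where
  "sylvester_left d p = mat d d (\<lambda>(i, j). if i \<le> j then coeff p (d + i - j) else 0)"

definition sylvester_right :: "nat \<Rightarrow> 'a::zero poly \<Rightarrow> 'a mat" where
  "sylvester_right d p = mat d d (\<lambda>(i, j). if j \<le> i then coeff p (i - j) else 0)"

lemma sylvester_half_carrier [simp]:
  "sylvester_left d p \<in> carrier_mat d d" "sylvester_right d p \<in> carrier_mat d d"
  by (simp_all add: sylvester_left_def sylvester_right_def)

lemma sylvester_mat_sub_blocks:
  "sylvester_mat_sub d d p q = four_block_mat (sylvester_left d p) (sylvester_right d p)
     (sylvester_left d q) (sylvester_right d q)"
  (is "?S = ?B")
proof (rule eq_matI)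
  fix i j assume "i < dim_row ?B" "j < dim_col ?B"
  then have "i < d + d" "j < d + d" by (simp_all add: sylvester_left_def sylvester_right_def)
  then show "?S $$ (i, j) = ?B $$ (i, j)"
    by (auto simp: sylvester_mat_sub_index sylvester_left_def sylvester_right_def intro: arg_cong[of _ _
        "coeff p"])
qed (simp_all add: sylvester_left_def sylvester_right_def)

lemma det_sylvester_left: "det (sylvester_left d p) = coeff p d ^ d"
proof -
  have "upper_triangular (sylvester_left d p)"
    by (rule upper_triangularI) (auto simp: sylvester_left_def)
  then have "det (sylvester_left d p) = (\<Prod>i<d. sylvester_left d p $$ (i, i))"
    by (subst det_upper_triangular[of _ d])
      (auto simp: prod_list_diag_prod atLeast0LessThan sylvester_left_def)
  also have "\<dots> = (\<Prod>i<d. coeff p d)" by (intro prod.cong) (auto simp: sylvester_left_def)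
  finally show ?thesis by simp
qed

lemma sylvester_left_add_const: "0 < d \<Longrightarrow> sylvester_left d (p + [:t:])
    = sylvester_left d (p :: 'a::comm_ring_1 poly)"
  by (rule eq_matI) (auto simp: sylvester_left_def coeff_pCons split: nat.splits)

lemma sylvester_right_add_const:
  "sylvester_right d (p + [:t:]) = sylvester_right d p + (t :: 'a::comm_ring_1) \<cdot>\<^sub>m 1\<^sub>m d"
  by (rule eq_matI) (auto simp: sylvester_right_def coeff_pCons split: nat.splits)

lemma poly_char_poly:
  assumes "A \<in> carrier_mat n n"
  shows "poly (char_poly A) k = det (k \<cdot>\<^sub>m 1\<^sub>m n - A)"
  unfolding char_poly_def
  by (rule poly_det_cong[of _ n]) (use assms in \<open>auto simp: char_poly_matrix_def\<close>)

text \<open>Block elimination with the adjugate keeps all entries in the ground ring.\<close>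

lemma det_four_block_mat_add_scalar:
  fixes H L H' L' :: "'a::idom mat"
  assumes H: "H \<in> carrier_mat n n" and L: "L \<in> carrier_mat n n"
    and H': "H' \<in> carrier_mat n n" and L': "L' \<in> carrier_mat n n"
  shows "det H ^ n * det (four_block_mat H L H' (L' + t \<cdot>\<^sub>m 1\<^sub>m n)) =
    det H * det ((det H * t) \<cdot>\<^sub>m 1\<^sub>m n - (H' * adj_mat H * L - det H \<cdot>\<^sub>m L'))"
proof -
  define K where "K = adj_mat H"
  have K: "K \<in> carrier_mat n n" "K * H = det H \<cdot>\<^sub>m 1\<^sub>m n"
    unfolding K_def using adj_mat[OF H] by auto
  define N where "N = H' * K"
  have N: "N \<in> carrier_mat n n" using H' K by (simp add: N_def)
  define M where "M = N * L"
  have M: "M \<in> carrier_mat n n" using N L by (simp add: M_def)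
  have NH: "N * H = det H \<cdot>\<^sub>m H'"
  proof -
    have "N * H = H' * (K * H)" unfolding N_def by (rule assoc_mult_mat[OF H' K(1) H])
    also have "\<dots> = det H \<cdot>\<^sub>m (H' * 1\<^sub>m n)" unfolding K(2)
        by (rule mult_smult_distrib[OF H' one_carrier_mat])
    finally show ?thesis using H' by simp
  qed
  have smult_one: "det H \<cdot>\<^sub>m 1\<^sub>m n * X = det H \<cdot>\<^sub>m X" if "X \<in> carrier_mat n n" for X
    using mult_smult_assoc_mat[OF one_carrier_mat that, of "det H"] that by simp
  let ?T = "L' + t \<cdot>\<^sub>m 1\<^sub>m n"
  \<comment> \<open>Left multiplication by this matrix clears the lower left block, because
    \<open>H' * adj_mat H * H\<close> is \<open>det H\<close> times \<open>H'\<close>. Its own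
    determinant is the power of \<open>det H\<close> on the left of the claim.\<close>
  let ?E = "four_block_mat (1\<^sub>m n) (0\<^sub>m n n) (- N) (det H \<cdot>\<^sub>m 1\<^sub>m n)"
  let ?S = "four_block_mat H L H' ?T"
  have T: "?T \<in> carrier_mat n n" using L' by simp
  have detE: "det ?E = det H ^ n"
    using det_four_block_mat_upper_right_zero[of "1\<^sub>m n" n "0\<^sub>m n n" n "- N" "det H \<cdot>\<^sub>m 1\<^sub>m n"] N by simp
  have "?E * ?S = four_block_mat (1\<^sub>m n * H + 0\<^sub>m n n * H') (1\<^sub>m n * L + 0\<^sub>m n n * ?T)
     (- N * H + det H \<cdot>\<^sub>m 1\<^sub>m n * H') (- N * L + det H \<cdot>\<^sub>m 1\<^sub>m n * ?T)"
    by (rule mult_four_block_mat) (use assms N T in auto)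
  also have "1\<^sub>m n * H + 0\<^sub>m n n * H' = H" using H H' by simp
  also have "1\<^sub>m n * L + 0\<^sub>m n n * ?T = L" using L T by simp
  also have "- N * H + det H \<cdot>\<^sub>m 1\<^sub>m n * H' = 0\<^sub>m n n"
    using uminus_mult_left_mat[of N H] N H H' unfolding smult_one[OF H']
    by (simp add: NH uminus_l_inv_mat)
  also have "- N * L + det H \<cdot>\<^sub>m 1\<^sub>m n * ?T = (det H * t) \<cdot>\<^sub>m 1\<^sub>m n - (M - det H \<cdot>\<^sub>m L')"
  proof -
    have "- N * L = - M" using uminus_mult_left_mat[of N L] N L by (simp add: M_def)
    then show ?thesis unfolding smult_one[OF T]
      by (intro eq_matI) (use M L' in \<open>auto simp: algebra_simps\<close>)
  qed
  finally have "det (?E * ?S) = det H * det ((det H * t) \<cdot>\<^sub>m 1\<^sub>m n - (M - det H \<cdot>\<^sub>m L'))"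
    using det_four_block_mat_lower_left_zero[OF H L refl, of "(det H * t) \<cdot>\<^sub>m 1\<^sub>m n - (M - det H \<cdot>\<^sub>m
        L')"] M L'
    by (simp add: minus_carrier_mat)
  moreover have "det (?E * ?S) = det ?E * det ?S"
    by (rule det_mult[of _ "n + n"]) (use assms N T in auto)
  ultimately show ?thesis unfolding detE by (simp only: M_def N_def K_def)
qed

text \<open>\<chi> is the characteristic polynomial of a matrix over the ground ring, hence monic of
  degree d. The powers of \<Delta>, the determinant of the left half for \<open>f\<close>, are kept
  on both sides to stay within that ring.\<close>

lemma resultant_sub_add_const:
  fixes f g :: "'a::idom poly"
  assumes d: "0 < d"
  defines "\<Delta> \<equiv> coeff f d ^ d"
  obtains \<chi> where "degree \<chi> = d" "coeff \<chi> d = 1"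
    "\<And>t. \<Delta> ^ d * resultant_sub d d f (g + [:t:]) = \<Delta> * poly \<chi> (\<Delta> * t)"
proof -
  let ?H = "sylvester_left d f"
  let ?A = "sylvester_left d g * adj_mat ?H * sylvester_right d f - det ?H \<cdot>\<^sub>m sylvester_right d g"
  have A: "?A \<in> carrier_mat d d"
    by (intro minus_carrier_mat smult_carrier_mat sylvester_half_carrier)
  have "\<Delta> ^ d * resultant_sub d d f (g + [:t:]) = \<Delta> * poly (char_poly ?A) (\<Delta> * t)" for t
    using det_four_block_mat_add_scalar[OF sylvester_half_carrier(1) sylvester_half_carrier(2)
        sylvester_half_carrier(1) sylvester_half_carrier(2), of d f f g g t]
    unfolding resultant_sub_def sylvester_mat_sub_blocks sylvester_left_add_const[OF d]
      sylvester_right_add_const poly_char_poly[OF A]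
    by (simp only: det_sylvester_left \<Delta>_def)
  then show ?thesis
    using that[of "char_poly ?A"] degree_monic_char_poly[OF A] by blast
qed

text \<open>At most one factor p is absorbed by \<open>a\<close>.\<close>

lemma prime_power_dvd_mult_of_not_square_dvd:
  fixes p a b :: int
  assumes "prime p" "p ^ N dvd a * b" "\<not> p ^ 2 dvd a"
  shows "p ^ (N - 1) dvd b"
proof (cases "p dvd a")
  case False
  then have "coprime (p ^ N) a" using assms(1) by (simp add: prime_imp_coprime)
  then have "p ^ N dvd b" using assms(2) by (simp add: coprime_dvd_mult_right_iff)
  then show ?thesis by (meson diff_le_self dvd_trans le_imp_power_dvd)
next
  case True
  then obtain a' where a': "a = p * a'" by blast
  with assms have "\<not> p dvd a'" by (auto simp: power2_eq_square)
  then have cop: "coprime (p ^ (N - 1)) a'" using assms(1) by (simp add: prime_imp_coprime)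
  show ?thesis
  proof (cases N)
    case (Suc n)
    with assms(2) a' have "p * p ^ (N - 1) dvd p * (a' * b)" by (simp add: mult.assoc)
    then have "p ^ (N - 1) dvd a' * b" using assms(1) by (subst (asm) dvd_mult_cancel_left) auto
    then show ?thesis using cop by (simp add: coprime_dvd_mult_right_iff)
  qed simp
qed

text \<open>Iterated divided differences: each of the \<open>n\<close> steps loses at most one factor \<open>p\<close>, because
  no two of the sample points agree modulo \<open>p\<^sup>2\<close>.\<close>

lemma power_dvd_lead_coeff_of_samples:
  fixes h :: "int poly" and p :: int
  assumes "prime p" "degree h \<le> n" "finite S" "card S > n"
    and "\<And>x y. x \<in> S \<Longrightarrow> y \<in> S \<Longrightarrow> x \<noteq> y \<Longrightarrow> \<not> p ^ 2 dvd x - y"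
    and "\<And>x. x \<in> S \<Longrightarrow> p ^ N dvd poly h x"
  shows "p ^ (N - n) dvd coeff h n"
  using assms(2-)
proof (induction n arbitrary: h S N)
  case 0
  then obtain x where "x \<in> S" by (metis card.empty ex_in_conv less_irrefl)
  moreover obtain c where "h = [:c:]" using 0 by (auto elim: degree_eq_zeroE)
  ultimately show ?case using 0(5)[of x] by simp
next
  case (Suc n)
  then obtain x0 where x0: "x0 \<in> S" by (metis card.empty ex_in_conv not_less_zero)
  \<comment> \<open>The divided difference at \<open>x0\<close>: the quotient \<open>h1\<close> has
    its degree bound lowered by one and keeps the top coefficient.\<close>
  have "poly (h - [:poly h x0:]) x0 = 0" by simp
  then obtain h1 where "h - [:poly h x0:] = [:- x0, 1:] * h1"
    unfolding poly_eq_0_iff_dvd by blast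
  then have h: "h = [:poly h x0:] + [:- x0, 1:] * h1" by (simp add: algebra_simps)
  have deg: "degree h1 \<le> n"
  proof (cases "h1 = 0")
    case False
    then have "degree ([:- x0, 1:] * h1) = Suc (degree h1)" by (subst degree_mult_eq) auto
    then have "degree h = Suc (degree h1)"
      by (subst h, subst degree_add_eq_right) (simp_all del: mult_pCons_left)
    then show ?thesis using Suc.prems(1) by simp
  qed simp
  have "coeff h1 (Suc n) = 0" using deg by (simp add: coeff_eq_0)
  then have lead: "coeff h (Suc n) = coeff h1 n" by (subst h) (simp add: coeff_pCons)
  have "p ^ (N - 1 - n) dvd coeff h1 n"
  proof (rule Suc.IH[OF deg, of "S - {x0}"])
    fix x assume x: "x \<in> S - {x0}"
    have "p ^ N dvd poly h x - poly h x0" using Suc.prems(5) x x0 by (intro dvd_diff) auto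
    also have "poly h x - poly h x0 = (x - x0) * poly h1 x"
      by (subst h) (simp add: algebra_simps)
    finally show "p ^ (N - 1) dvd poly h1 x"
      using Suc.prems(4) x x0 by (intro prime_power_dvd_mult_of_not_square_dvd[OF assms(1)]) auto
  qed (use Suc.prems x0 in auto)
  then show ?case by (simp add: lead)
qed

text \<open>More than d such samples would make p^(2d-d) divide the leading coefficient 1 of \<chi>.
  They are evaluated at \<Delta> Q x; as p divides neither \<Delta> nor Q, they stay incongruent
  modulo p^2, and the outer factor \<Delta> can be cancelled.\<close>

lemma card_incongruent_resultant_le:
  fixes f g :: "int poly" and p Q :: int
  assumes d: "0 < d" and p: "prime p" "\<not> p dvd coeff f d" "\<not> p dvd Q"
    and S: "finite S" "\<And>x y. x \<in> S \<Longrightarrow> y \<in> S \<Longrightarrow> x \<noteq> y \<Longrightarrow> \<not> p ^ 2 dvd x - y"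
      "\<And>x. x \<in> S \<Longrightarrow> p ^ (2 * d) dvd resultant_sub d d f (g + [:Q * x:])"
  shows "card S \<le> d"
proof (rule ccontr)
  assume "\<not> card S \<le> d"
  define \<Delta> where "\<Delta> = coeff f d ^ d"
  obtain \<chi> where \<chi>: "degree \<chi> = d" "coeff \<chi> d = 1"
    "\<And>t. \<Delta> ^ d * resultant_sub d d f (g + [:t:]) = \<Delta> * poly \<chi> (\<Delta> * t)"
    unfolding \<Delta>_def using resultant_sub_add_const[OF d, of f g] by blast
  have "\<not> p dvd \<Delta>" unfolding \<Delta>_def using p prime_dvd_power by blast
  then have pQ: "\<not> p dvd \<Delta> * Q" using p by (simp add: prime_dvd_mult_iff)
  then have cop: "coprime (p ^ k) (\<Delta> * Q)" for k
    using prime_imp_coprime[OF p(1) pQ] by (simp del: coprime_mult_right_iff)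
  have "\<Delta> * Q \<noteq> 0" using pQ by (metis dvd_0_right)
  then have inj: "inj_on (\<lambda>x. \<Delta> * Q * x) S" by (intro inj_onI) simp
  have "p ^ (2 * d - d) dvd coeff \<chi> d"
  proof (rule power_dvd_lead_coeff_of_samples[OF p(1), of _ _ "(\<lambda>x. \<Delta> * Q * x) ` S"])
    show "card ((\<lambda>x. \<Delta> * Q * x) ` S) > d" using \<open>\<not> card S \<le> d\<close> card_image[OF inj] by simp
  next
    fix x y assume "x \<in> (\<lambda>x. \<Delta> * Q * x) ` S" "y \<in> (\<lambda>x. \<Delta> * Q * x) ` S" "x \<noteq> y"
    then obtain x' y' where "x' \<in> S" "y' \<in> S" "x' \<noteq> y'" "x - y = \<Delta> * Q * (x' - y')"
      by (auto simp: algebra_simps)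
    then show "\<not> p ^ 2 dvd x - y"
      using S(2) cop[of 2] by (simp add: coprime_dvd_mult_right_iff)
  next
    fix y assume "y \<in> (\<lambda>x. \<Delta> * Q * x) ` S"
    then obtain x where x: "x \<in> S" "y = \<Delta> * (Q * x)" by auto
    have "p ^ (2 * d) dvd \<Delta> ^ d * resultant_sub d d f (g + [:Q * x:])" using S(3)[OF x(1)] by simp
    then have "p ^ (2 * d) dvd \<Delta> * poly \<chi> y" unfolding \<chi>(3) x(2) .
    moreover have "coprime (p ^ (2 * d)) \<Delta>" using cop[of "2 * d"] by simp
    ultimately show "p ^ (2 * d) dvd poly \<chi> y" by (simp add: coprime_dvd_mult_right_iff)
  qed (use \<chi> S in auto)
  then have "p ^ d dvd 1" using \<chi>(2) by simp
  then have "p dvd 1" using d by (metis is_unit_power_iff not_gr_zero)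
  then show False using p(1) not_prime_unit by blast
qed

section \<open>Counting the integers of an interval by residue classes\<close>

lemma card_residue_class_bounds:
  fixes m r :: int
  fixes B :: nat
  assumes "m > 0" "0 \<le> r" "r < m"
  defines "C \<equiv> card {x \<in> {- int B..int B}. x mod m = r}"
  shows "real C \<le> real (2 * B + 1) / real_of_int m + 1" "real (2 * B + 1) / real_of_int m - 2 \<le> real C"
proof -
  define l where "l = \<lceil>(- real B - real_of_int r) / real_of_int m\<rceil>"
  define u where "u = \<lfloor>(real B - real_of_int r) / real_of_int m\<rfloor>"
  have "{x \<in> {- int B..int B}. x mod m = r} = (\<lambda>k. m * k + r) ` {l..u}"
  proof (intro equalityI subsetI)
    fix x assume "x \<in> {x \<in> {- int B..int B}. x mod m = r}"
    then have x: "- int B \<le> x" "x \<le> int B" "x = m * (x div m) + r" by auto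
    have "real_of_int (- int B) \<le> real_of_int x" "real_of_int x \<le> real_of_int (int B)"
      using x(1,2) by (simp_all only: of_int_le_iff)
    then have "- real B - real_of_int r \<le> real_of_int (x div m) * real_of_int m"
        "real_of_int (x div m) * real_of_int m \<le> real B - real_of_int r"
      using arg_cong[OF x(3), of real_of_int] by (simp_all add: mult.commute)
    then have "x div m \<in> {l..u}"
      using assms by (simp add: l_def u_def ceiling_le_iff le_floor_iff field_simps)
    then show "x \<in> (\<lambda>k. m * k + r) ` {l..u}" using x(3) by (rule_tac image_eqI)
  next
    fix x assume "x \<in> (\<lambda>k. m * k + r) ` {l..u}"
    then obtain k where k: "l \<le> k" "k \<le> u" "x = m * k + r" by auto
    then have "- real B - real_of_int r \<le> real_of_int k * real_of_int m"
       "real_of_int k * real_of_int m \<le> real B - real_of_int r"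
      using assms by (simp_all add: l_def u_def ceiling_le_iff le_floor_iff field_simps)
    then have "real_of_int (- int B) \<le> real_of_int x" "real_of_int x \<le> real_of_int (int B)"
      using k(3) by (simp_all add: mult.commute)
    then have "- int B \<le> x" "x \<le> int B" by (simp_all only: of_int_le_iff)
    then show "x \<in> {x \<in> {- int B..int B}. x mod m = r}"
      using assms k(3) by simp
  qed
  moreover have "inj_on (\<lambda>k. m * k + r) {l..u}" using assms by (auto intro: inj_onI)
  ultimately have C: "C = nat (u - l + 1)" unfolding C_def by (simp add: card_image)
  define y where "y = (real B - real_of_int r) / real_of_int m"
  define z where "z = (- real B - real_of_int r) / real_of_int m"
  have yz: "y - z = 2 * real B / real_of_int m" using assms by (simp add: y_def z_def field_simps)
  have bnd: "real_of_int u \<le> y" "y - 1 < real_of_int u" "z \<le> real_of_int l" "real_of_int l < z + 1"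
    unfolding u_def l_def y_def[symmetric] z_def[symmetric] by linarith+
  have frac: "real (2 * B + 1) / real_of_int m = 2 * real B / real_of_int m + 1 / real_of_int m"
      "0 < 1 / real_of_int m" "1 / real_of_int m \<le> 1" "0 \<le> 2 * real B / real_of_int m"
    using assms by (simp_all add: add_divide_distrib)
  \<comment> \<open>If the range of quotients is empty, \<open>nat\<close> truncates, and both
    bounds follow from the nonpositive length. Passing from 2B to 2B + 1 costs at most 1, hence the
    2 in the lower bound.\<close>
  have "real C = 0 \<and> real_of_int u - real_of_int l + 1 \<le> 0 \<or> real C = real_of_int u - real_of_int l + 1"
    unfolding C by (cases "0 \<le> u - l + 1") auto
  then show "real C \<le> real (2 * B + 1) / real_of_int m + 1" "real (2 * B + 1) / real_of_int m - 2 \<le> real C"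
    unfolding frac(1) using bnd yz frac(2-4) by linarith+
qed

text \<open>One representative per occupied class gives an incongruent subset, so at most
  \<open>c\<close> classes are occupied, and each is counted separately.\<close>

lemma card_le_residue_classes:
  fixes m :: int
  assumes m: "m > 0" and T: "T \<subseteq> {- int B..int B}"
    and few: "\<And>S. S \<subseteq> T \<Longrightarrow> (\<And>x y. x \<in> S \<Longrightarrow> y \<in> S \<Longrightarrow> x \<noteq> y \<Longrightarrow> \<not> m dvd x - y) \<Longrightarrow> card S \<le> c"
  shows "real (card T) \<le> real c * (real (2 * B + 1) / real_of_int m + 1)"
proof -
  have finT: "finite T" using T finite_subset by blast
  define R where "R = (\<lambda>x. x mod m) ` T"
  have "\<forall>r\<in>R. \<exists>x\<in>T. x mod m = r" by (auto simp: R_def)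
  then obtain rep where rep: "\<And>r. r \<in> R \<Longrightarrow> rep r \<in> T \<and> rep r mod m = r" by metis
  have "card (rep ` R) \<le> c"
  proof (rule few)
    fix x y assume "x \<in> rep ` R" "y \<in> rep ` R" "x \<noteq> y"
    then obtain r r' where "r \<in> R" "r' \<in> R" "x = rep r" "y = rep r'" "r \<noteq> r'" by blast
    then have "x mod m \<noteq> y mod m" using rep by simp
    then show "\<not> m dvd x - y" by (simp add: mod_eq_dvd_iff)
  qed (use rep in auto)
  moreover have "inj_on rep R" using rep by (metis inj_onI)
  ultimately have R: "card R \<le> c" by (simp add: card_image)
  have "T \<subseteq> (\<Union>r\<in>R. {x \<in> {- int B..int B}. x mod m = r})" using T unfolding R_def by blast
  then have "card T \<le> card (\<Union>r\<in>R. {x \<in> {- int B..int B}. x mod m = r})"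
    by (intro card_mono finite_UN_I finite_subset[of "{x \<in> {- int B..int B}. x mod m
        = _}" "{- int B..int B}"])
      (auto simp only: R_def finT intro: finite_imageI)
  also have "\<dots> \<le> (\<Sum>r\<in>R. card {x \<in> {- int B..int B}. x mod m = r})"
    by (rule card_UN_le) (simp add: R_def finT)
  finally have "real (card T) \<le> (\<Sum>r\<in>R. real (card {x \<in> {- int B..int B}. x mod m = r}))"
    by (simp flip: of_nat_sum)
  also have "\<dots> \<le> (\<Sum>r\<in>R. real (2 * B + 1) / real_of_int m + 1)"
    by (intro sum_mono card_residue_class_bounds) (use m in \<open>auto simp: R_def\<close>)
  also have "\<dots> = real (card R) * (real (2 * B + 1) / real_of_int m + 1)" by simp
  also have "\<dots> \<le> real c * (real (2 * B + 1) / real_of_int m + 1)"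
    using R m by (intro mult_right_mono) auto
  finally show ?thesis .
qed

lemma card_resultant_fibre_le:
  fixes f g :: "int poly" and p Q :: int
  assumes "0 < d" "prime p" "\<not> p dvd coeff f d" "\<not> p dvd Q"
  shows "real (card {x \<in> {- int B..int B}. p ^ (2 * d) dvd resultant_sub d d f (g + [:Q * x:])})
    \<le> real d * (real (2 * B + 1) / real_of_int (p ^ 2) + 1)"
proof (rule card_le_residue_classes)
  fix S assume "S \<subseteq> {x \<in> {- int B..int B}. p ^ (2 * d) dvd resultant_sub d d f (g + [:Q * x:])}"
    and inc: "\<And>x y. x \<in> S \<Longrightarrow> y \<in> S \<Longrightarrow> x \<noteq> y \<Longrightarrow> \<not> p ^ 2 dvd x - y"
  then have S: "S \<subseteq> {- int B..int B}" "\<And>x. x \<in> S \<Longrightarrow> p ^ (2 * d) dvd resultant_sub d d f (g + [:Q * x:])"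
    by blast+
  have "finite S" by (rule finite_subset[OF S(1)]) simp
  then show "card S \<le> d"
    using card_incongruent_resultant_le[OF assms, of S g] inc S(2) by blast
qed (use assms(2) prime_gt_0_int in auto)

section \<open>Densities of sieved sets of integer vectors\<close>

definition box :: "nat \<Rightarrow> nat \<Rightarrow> int list set" where
  "box n B = {P. length P = n \<and> set P \<subseteq> {- int B..int B}}"

lemma box_alt: "box n B = {P. set P \<subseteq> {- int B..int B} \<and> length P = n}"
  by (auto simp: box_def)

lemma finite_box [simp]: "finite (box n B)"
  unfolding box_alt by (rule finite_lists_length_eq) simp

lemma card_box: "card (box n B) = (2 * B + 1) ^ n"
proof -
  have "card {- int B..int B} = 2 * B + 1" by simp
  then show ?thesis unfolding box_alt by (subst card_lists_length_eq) simp_all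
qed

text \<open>Only inhabited fibres are counted on the right, so that two coordinates can be bounded
  one after the other.\<close>

lemma card_fibre_le:
  assumes T: "T \<subseteq> box (Suc n) B" and i: "i \<le> n"
    and c: "\<And>q. q \<in> box n B \<Longrightarrow> real (card {t \<in> {- int B..int B}. take i q @ t # drop i q \<in> T}) \<le> c"
  shows "real (card T) \<le> c * real (card {q \<in> box n B. \<exists>t. take i q @ t # drop i q \<in> T})"
proof -
  let ?g = "\<lambda>(q, t). take i q @ t # drop i q"
  let ?Q = "{q \<in> box n B. \<exists>t. take i q @ t # drop i q \<in> T}"
  let ?F = "\<lambda>q. {t \<in> {- int B..int B}. take i q @ t # drop i q \<in> T}"
  have "T \<subseteq> ?g ` (SIGMA q:?Q. ?F q)"
  proof
    fix P assume P: "P \<in> T"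
    then have P': "length P = Suc n" "set P \<subseteq> {- int B..int B}" using T by (auto simp: box_def)
    define q where "q = take i P @ drop (Suc i) P"
    have eq: "P = take i q @ P ! i # drop i q"
      using P' i id_take_nth_drop[of i P] by (simp add: q_def)
    have "q \<in> box n B"
      using P' i set_take_subset[of i P] set_drop_subset[of "Suc i" P] by (auto simp: box_def q_def)
    moreover have "P ! i \<in> {- int B..int B}"
    proof -
      have "P ! i \<in> set P" using P' i by (intro nth_mem) simp
      then show ?thesis using P' by blast
    qed
    moreover have "take i q @ P ! i # drop i q \<in> T" using P by (simp only: eq[symmetric])
    ultimately have "(q, P ! i) \<in> (SIGMA q:?Q. ?F q)" by blast
    then have "?g (q, P ! i) \<in> ?g ` (SIGMA q:?Q. ?F q)" by (rule imageI)
    then show "P \<in> ?g ` (SIGMA q:?Q. ?F q)" by (simp only: prod.case eq[symmetric])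
  qed
  moreover have finF: "finite (?F q)" for q by (rule finite_subset[of _ "{- int B..int B}"]) auto
  then have "finite (SIGMA q:?Q. ?F q)" by (intro finite_SigmaI) simp_all
  ultimately have "card T \<le> card (SIGMA q:?Q. ?F q)" using surj_card_le by blast
  also have "\<dots> = (\<Sum>q\<in>?Q. card (?F q))" by (rule card_SigmaI, simp, rule ballI, rule finF)
  finally have "real (card T) \<le> (\<Sum>q\<in>?Q. real (card (?F q)))" by (simp flip: of_nat_sum)
  also have "\<dots> \<le> (\<Sum>q\<in>?Q. c)" by (intro sum_mono c) auto
  finally show ?thesis by (simp add: mult.commute)
qed

section \<open>Periodic sets and sieving by all primes\<close>

definition periodic :: "nat \<Rightarrow> int \<Rightarrow> int list set \<Rightarrow> bool" where
  "periodic n m S \<longleftrightarrow> (\<forall>P P'. length P = n \<longrightarrow> length P' = n \<longrightarrow>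
     (\<forall>i<n. m dvd P ! i - P' ! i) \<longrightarrow> P \<in> S \<longrightarrow> P' \<in> S)"

definition density :: "nat \<Rightarrow> int list set \<Rightarrow> nat \<Rightarrow> real" where
  "density n S B = real (card (S \<inter> box n B)) / real (2 * B + 1) ^ n"

lemma density_mono: "S \<inter> box n B \<subseteq> S' \<Longrightarrow> density n S B \<le> density n S' B"
  unfolding density_def by (intro divide_right_mono of_nat_mono card_mono) auto

lemma residue_density_tendsto:
  fixes m r :: int
  assumes "m > 0" "0 \<le> r" "r < m"
  shows "(\<lambda>B. real (card {x \<in> {- int B..int B}. x mod m = r}) / real (2 * B + 1)) \<longlonglongrightarrow> 1 / real_of_int m"
proof (rule tendsto_sandwich)
  have X: "filterlim (\<lambda>B. real (2 * B + 1)) at_top sequentially"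
    by (intro filterlim_compose[OF filterlim_real_sequentially] filterlim_subseq) (auto simp:
        strict_mono_def)
  have inv: "(\<lambda>B. c / real (2 * B + 1)) \<longlonglongrightarrow> 0" for c :: real
    by (intro tendsto_divide_0[OF tendsto_const] filterlim_at_top_imp_at_infinity X)
  show "(\<lambda>B. 1 / real_of_int m - 2 / real (2 * B + 1)) \<longlonglongrightarrow> 1 / real_of_int m"
    using tendsto_diff[OF tendsto_const inv[of 2], of "1 / real_of_int m"] by simp
  show "(\<lambda>B. 1 / real_of_int m + 1 / real (2 * B + 1)) \<longlonglongrightarrow> 1 / real_of_int m"
    using tendsto_add[OF tendsto_const inv[of 1], of "1 / real_of_int m"] by simp
  have X0: "real (2 * B + 1) > 0" for B by simp
  have eq: "(real (2 * B + 1) / real_of_int m + c) / real (2 * B + 1)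
      = 1 / real_of_int m + c / real (2 * B + 1)" for B c
    using X0[of B] by (simp only: add_divide_distrib) simp
  show "\<forall>\<^sub>F B in sequentially. 1 / real_of_int m - 2 / real (2 * B + 1)
      \<le> real (card {x \<in> {- int B..int B}. x mod m = r}) / real (2 * B + 1)"
  proof (intro always_eventually allI)
    fix B
    have "(real (2 * B + 1) / real_of_int m + - 2) / real (2 * B + 1) \<le>
        real (card {x \<in> {- int B..int B}. x mod m = r}) / real (2 * B + 1)"
      by (rule divide_right_mono) (use card_residue_class_bounds(2)[OF assms, of B] in simp_all)
    then show "1 / real_of_int m - 2 / real (2 * B + 1) \<le>
        real (card {x \<in> {- int B..int B}. x mod m = r}) / real (2 * B + 1)"
      unfolding eq by simp
  qed
  show "\<forall>\<^sub>F B in sequentially. real (card {x \<in> {- int B..int B}. x mod m = r}) / real (2 * B + 1)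
      \<le> 1 / real_of_int m + 1 / real (2 * B + 1)"
  proof (intro always_eventually allI)
    fix B
    have "real (card {x \<in> {- int B..int B}. x mod m = r}) / real (2 * B + 1) \<le>
        (real (2 * B + 1) / real_of_int m + 1) / real (2 * B + 1)"
      by (rule divide_right_mono) (use card_residue_class_bounds(1)[OF assms, of B] in simp_all)
    then show "real (card {x \<in> {- int B..int B}. x mod m = r}) / real (2 * B + 1)
        \<le> 1 / real_of_int m + 1 / real (2 * B + 1)"
      unfolding eq by simp
  qed
qed

lemma card_residue_vector:
  "card {P \<in> box (length r) B. map (\<lambda>x. x mod m) P = r} =
     prod_list (map (\<lambda>s. card {x \<in> {- int B..int B}. x mod m = s}) r)"
proof (induction r)
  case Nil
  have "{P \<in> box (length []) B. map (\<lambda>x. x mod m) P = []} = {[]}" by (auto simp: box_def)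
  then show ?case by simp
next
  case (Cons s r)
  have "{P \<in> box (length (s # r)) B. map (\<lambda>x. x mod m) P = s # r} =
     (\<lambda>(x, P). x # P) ` ({x \<in> {- int B..int B}. x mod m
         = s} \<times> {P \<in> box (length r) B. map (\<lambda>x. x mod m) P = r})"
    by (auto simp: box_def map_eq_Cons_conv)
  also have "card \<dots> = card ({x \<in> {- int B..int B}. x mod m
      = s} \<times> {P \<in> box (length r) B. map (\<lambda>x. x mod m) P = r})"
    by (rule card_image) (auto intro: inj_onI)
  finally show ?case by (simp add: card_cartesian_product Cons)
qed

text \<open>On vectors of length n, a periodic set is a finite union of residue classes modulo m,
  and each class has density m^(-n) as a product over the coordinates.\<close>

lemma periodic_density_convergent:
  assumes m: "m > 0" and S: "periodic n m S"
  shows "convergent (density n S)"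
proof -
  let ?mod = "map (\<lambda>x. x mod m)"
  define R where "R = ?mod ` (S \<inter> {P. length P = n})"
  have R: "R \<subseteq> {r. set r \<subseteq> {0..<m} \<and> length r = n}" using m by (auto simp: R_def)
  then have finR: "finite R" by (rule finite_subset) (simp add: finite_lists_length_eq)
  have class_sub: "P \<in> S" if P: "length P = n" "?mod P \<in> R" for P
  proof -
    obtain P' where P': "P' \<in> S" "length P' = n" "?mod P = ?mod P'" using P(2) unfolding R_def
        by (elim imageE) blast
    have "m dvd P' ! i - P ! i" if "i < n" for i
      using arg_cong[OF P'(3)[symmetric], of "\<lambda>l. l ! i"] that P'(2) P(1) by (simp add: mod_eq_dvd_iff)
    then show ?thesis using S P' P(1) unfolding periodic_def by blast
  qed
  have density_eq: "density n S B = (\<Sum>r\<in>R. prod_list (map (\<lambda>s. real (card {x \<in> {- int B..int B}. x mod m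
      = s}) / real (2 * B + 1)) r))" for B
  proof -
    have "S \<inter> box n B = (\<Union>r\<in>R. {P \<in> box n B. ?mod P = r})"
      using class_sub by (auto simp: R_def box_def)
    also have "card \<dots> = (\<Sum>r\<in>R. card {P \<in> box n B. ?mod P = r})"
      by (intro card_UN_disjoint finR) auto
    also have "\<dots> = (\<Sum>r\<in>R. prod_list (map (\<lambda>s. card {x \<in> {- int B..int B}. x mod m = s}) r))"
    proof (intro sum.cong refl)
      fix r assume "r \<in> R"
      then have "length r = n" using R by auto
      then show "card {P \<in> box n B. ?mod P = r}
          = prod_list (map (\<lambda>s. card {x \<in> {- int B..int B}. x mod m = s}) r)"
        using card_residue_vector[of r B m] by (simp only:)
    qed
    finally have "density n S B = (\<Sum>r\<in>R. real (prod_list (map (\<lambda>s. card {x \<in> {- int B..int B}. x mod m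
        = s}) r)) / real (2 * B + 1) ^ n)"
      by (simp add: density_def sum_divide_distrib)
    also have "\<dots> = (\<Sum>r\<in>R. prod_list (map (\<lambda>s. real (card {x \<in> {- int B..int B}. x mod m
        = s}) / real (2 * B + 1)) r))"
    proof (intro sum.cong refl)
      fix r assume "r \<in> R"
      have "real (prod_list (map h r)) / y ^ length r
          = prod_list (map (\<lambda>s. real (h s) / y) r)" for h :: "int \<Rightarrow> nat" and y :: real
      proof (induction r)
        case (Cons a r)
        have "real (prod_list (map h (a # r))) / y ^ length (a # r) =
            real (h a) / y * (real (prod_list (map h r)) / y ^ length r)" by simp
        then show ?case unfolding Cons.IH by simp
      qed simp
      moreover have "length r = n" using \<open>r \<in> R\<close> R by auto
      ultimately show "real (prod_list (map (\<lambda>s. card {x \<in> {- int B..int B}. x mod m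
          = s}) r)) / real (2 * B + 1) ^ n
         = prod_list (map (\<lambda>s. real (card {x \<in> {- int B..int B}. x mod m = s}) / real (2 * B + 1)) r)"
             by blast
    qed
    finally show ?thesis .
  qed
  have "(\<lambda>B. \<Sum>r\<in>R. prod_list (map (\<lambda>s. real (card {x \<in> {- int B..int B}. x mod m
      = s}) / real (2 * B + 1)) r))
    \<longlonglongrightarrow> (\<Sum>r\<in>R. prod_list (map (\<lambda>s. 1 / real_of_int m) r))"
  proof (intro tendsto_sum)
    fix r assume "r \<in> R"
    then have "set r \<subseteq> {0..<m}" using R by auto
    then show "(\<lambda>B. prod_list (map (\<lambda>s. real (card {x \<in> {- int B..int B}. x mod m
        = s}) / real (2 * B + 1)) r))
        \<longlonglongrightarrow> prod_list (map (\<lambda>s. 1 / real_of_int m) r)"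
    proof (induction r)
      case (Cons s r)
      have "(\<lambda>B. real (card {x \<in> {- int B..int B}. x mod m = s}) / real (2 * B + 1)) \<longlonglongrightarrow> 1 / real_of_int m"
        using Cons.prems m by (intro residue_density_tendsto) auto
      moreover have "(\<lambda>B. prod_list (map (\<lambda>s. real (card {x \<in> {- int B..int B}. x mod m
          = s}) / real (2 * B + 1)) r))
        \<longlonglongrightarrow> prod_list (map (\<lambda>s. 1 / real_of_int m) r)" using Cons by simp
      ultimately show ?case unfolding list.map prod_list.Cons by (rule tendsto_mult)
    qed simp
  qed
  then have "density n S \<longlonglongrightarrow> (\<Sum>r\<in>R. prod_list (map (\<lambda>s. 1 / real_of_int m) r))"
    unfolding density_eq[symmetric] .
  then show ?thesis by (rule convergentI)
qed

lemma periodic_mono: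
  assumes "periodic n m S" "m dvd m'"
  shows "periodic n m' S"
  unfolding periodic_def
proof (intro allI impI)
  fix P P' assume P: "length P = n" "length P' = n" "\<forall>i<n. m' dvd P ! i - P' ! i" "P \<in> S"
  then have "\<forall>i<n. m dvd P ! i - P' ! i" using assms(2) dvd_trans by blast
  then show "P' \<in> S" using assms(1) P unfolding periodic_def by blast
qed

lemma periodic_Int: "periodic n m S \<Longrightarrow> periodic n m S' \<Longrightarrow> periodic n m (S \<inter> S')"
  unfolding periodic_def by blast

lemma periodic_Compl:
  assumes "periodic n m S"
  shows "periodic n m (- S)"
  unfolding periodic_def
proof (intro allI impI)
  fix P P' assume P: "length P = n" "length P' = n" "\<forall>i<n. m dvd P ! i - P' ! i" "P \<in> - S"
  then have "\<forall>i<n. m dvd P' ! i - P ! i" by (metis dvd_minus_iff minus_diff_eq)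
  then show "P' \<in> - S" using assms P unfolding periodic_def by blast
qed

text \<open>Sieving by the primes up to M is a periodic condition, so its density converges. As the
  tail is small for all large B, the full density is Cauchy. This gives no formula for the limit, so
  positivity takes a separate argument.\<close>

lemma sieve_density_convergent:
  fixes Bad :: "nat \<Rightarrow> int list set"
  assumes per: "\<And>p. prime p \<Longrightarrow> \<exists>m>0. periodic n m (Bad p)"
    and tail: "\<And>\<epsilon>. \<epsilon> > 0 \<Longrightarrow> \<exists>M. \<forall>\<^sub>F B in sequentially. density n {P. \<exists>p>M. prime p \<and> P \<in> Bad p} B \<le> \<epsilon>"
  shows "convergent (density n {P. \<forall>p. prime p \<longrightarrow> P \<notin> Bad p})"
proof -
  let ?S = "{P. \<forall>p. prime p \<longrightarrow> P \<notin> Bad p}"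
  let ?SM = "\<lambda>M. {P. \<forall>p\<le>M. prime p \<longrightarrow> P \<notin> Bad p}"
  have "\<exists>m>0. periodic n m (?SM M)" for M
  proof (induction M)
    case 0
    have "?SM 0 = UNIV" by auto
    then show ?case by (intro exI[of _ 1]) (simp add: periodic_def)
  next
    case (Suc M)
    then obtain m where m: "m > 0" "periodic n m (?SM M)" by blast
    have SM: "?SM (Suc M) = (if prime (Suc M) then ?SM M \<inter> - Bad (Suc M) else ?SM M)"
      by (auto simp: le_Suc_eq)
    show ?case
    proof (cases "prime (Suc M)")
      case True
      then obtain m' where m': "m' > 0" "periodic n m' (Bad (Suc M))" using per by blast
      have "periodic n (m * m') (Bad (Suc M))" using m'(2) by (rule periodic_mono) simp
      moreover have "periodic n (m * m') (?SM M)" using m(2) by (rule periodic_mono) simp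
      ultimately have "periodic n (m * m') (?SM (Suc M))"
        unfolding SM using True by (simp only: if_True periodic_Int periodic_Compl)
      then show ?thesis using m m' by (intro exI[of _ "m * m'"]) simp
    next
      case False
      then show ?thesis unfolding SM using m by auto
    qed
  qed
  then have conv: "convergent (density n (?SM M))" for M
    using periodic_density_convergent by blast
  have approx: "density n ?S B \<le> density n (?SM M) B"
    "density n (?SM M) B \<le> density n ?S B + density n {P. \<exists>p>M. prime p \<and> P \<in> Bad p} B" for M B
  proof -
    let ?T = "{P. \<exists>p>M. prime p \<and> P \<in> Bad p}"
    show "density n ?S B \<le> density n (?SM M) B" by (rule density_mono) auto
    have "card (?SM M \<inter> box n B) \<le> card ((?S \<inter> box n B) \<union> (?T \<inter> box n B))"
      by (rule card_mono) (simp, use not_le_imp_less in blast)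
    also have "\<dots> \<le> card (?S \<inter> box n B) + card (?T \<inter> box n B)" by (rule card_Un_le)
    finally show "density n (?SM M) B \<le> density n ?S B + density n ?T B"
      by (simp add: density_def add_divide_distrib[symmetric] divide_right_mono flip: of_nat_add)
  qed
  have "Cauchy (density n ?S)"
  proof (rule metric_CauchyI)
    fix e :: real assume "0 < e"
    then have e3: "e / 3 > 0" by simp
    then obtain M where "\<forall>\<^sub>F B in sequentially. density n {P. \<exists>p>M. prime p \<and> P \<in> Bad p} B \<le> e / 3"
      using tail by blast
    then obtain B1 where B1: "\<And>B. B \<ge> B1 \<Longrightarrow> density n {P. \<exists>p>M. prime p \<and> P \<in> Bad p} B \<le> e / 3"
      by (auto simp: eventually_sequentially)
    have "Cauchy (density n (?SM M))" using conv by (rule convergent_Cauchy)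
    then obtain B2 where B2: "\<And>B B'. B \<ge> B2 \<Longrightarrow> B' \<ge> B2
        \<Longrightarrow> dist (density n (?SM M) B) (density n (?SM M) B') < e / 3"
      using metric_CauchyD[OF _ e3] by blast
    show "\<exists>M. \<forall>B\<ge>M. \<forall>B'\<ge>M. dist (density n ?S B) (density n ?S B') < e"
    proof (intro exI allI impI)
      fix B B' assume B: "max B1 B2 \<le> B" "max B1 B2 \<le> B'"
      show "dist (density n ?S B) (density n ?S B') < e"
        using B1[of B] B1[of B'] B2[of B B'] B
          approx[where B = B and M = M] approx[where B = B' and M = M]
        unfolding dist_real_def by linarith
    qed
  qed
  then show ?thesis by (rule Cauchy_convergent)
qed

section \<open>The number of primes is sublinear\<close>

definition prime_count :: "nat \<Rightarrow> nat" where
  "prime_count x = card {p. prime p \<and> p \<le> x}"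

lemma prod_primes_dvd:
  fixes N :: nat
  assumes "finite A" "\<And>p. p \<in> A \<Longrightarrow> prime p \<and> p dvd N"
  shows "\<Prod>A dvd N"
  using assms
proof (induction A rule: finite_induct)
  case (insert p A)
  have "coprime p (\<Prod>A)"
    using insert by (intro prod_coprime_right) (metis insertI1 insertI2 primes_coprime)
  then show ?case using insert by (simp add: divides_mult)
qed simp

text \<open>Chebyshev's argument: the primes in (n, 2n] all divide the central binomial coefficient,
  which is at most 4^n, and each of them exceeds n.\<close>

lemma power_card_primes_le: "n ^ card {p. prime p \<and> n < p \<and> p \<le> 2 * n} \<le> (4::nat) ^ n"
proof -
  let ?A = "{p. prime p \<and> n < p \<and> p \<le> 2 * n}"
  have fin: "finite ?A" by (rule finite_subset[of _ "{..2 * n}"]) auto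
  have "\<Prod>?A dvd (2 * n choose n)"
  proof (rule prod_primes_dvd[OF fin])
    fix p assume "p \<in> ?A"
    then have p: "prime p" "n < p" "p \<le> 2 * n" by auto
    have eq: "fact n * fact (2 * n - n) * (2 * n choose n) = (fact (2 * n) :: nat)"
      by (rule binomial_fact_lemma) simp
    have "p dvd fact (2 * n)" using p by (simp add: prime_dvd_fact_iff)
    then have "p dvd fact n * fact (2 * n - n) * (2 * n choose n)" by (simp only: eq)
    moreover have "\<not> p dvd fact n" using p by (simp add: prime_dvd_fact_iff)
    ultimately have "p dvd (2 * n choose n)" using p(1) by (simp add: prime_dvd_mult_iff)
    with p(1) show "prime p \<and> p dvd (2 * n choose n)" by simp
  qed
  then have "\<Prod>?A \<le> (2 * n choose n)" by (rule dvd_imp_le) simp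
  also have "\<dots> \<le> 2 ^ (2 * n)" by (rule binomial_le_pow2)
  also have "\<dots> = 4 ^ n" by (simp add: power_mult)
  finally have "\<Prod>?A \<le> 4 ^ n" .
  moreover have "n ^ card ?A = (\<Prod>p\<in>?A. n)" by simp
  moreover have "(\<Prod>p\<in>?A. n) \<le> \<Prod>?A" by (rule prod_mono) auto
  ultimately show ?thesis by linarith
qed

lemma card_primes_dyadic_le: "k * card {p. prime p \<and> (2::nat) ^ k < p \<and> p \<le> 2 ^ Suc k} \<le> 2 ^ Suc k"
proof -
  have "(2::nat) ^ (k * card {p. prime p \<and> (2::nat) ^ k < p \<and> p \<le> 2 ^ Suc k}) \<le> 4 ^ (2 ^ k)"
    using power_card_primes_le[of "2 ^ k"] by (simp add: power_mult)
  also have "\<dots> = (2::nat) ^ (2 * 2 ^ k)" by (simp add: power_mult)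
  finally show ?thesis by simp
qed

lemma finite_primes_le [simp]: "finite {p::nat. prime p \<and> p \<le> x}"
  by (rule finite_subset[of _ "{..x}"]) auto

lemma prime_count_le: "prime_count x \<le> x"
proof -
  have "prime_count x \<le> card {1..x}"
    unfolding prime_count_def by (rule card_mono) (auto dest: prime_gt_0_nat)
  then show ?thesis by simp
qed

lemma prime_count_mono: "x \<le> y \<Longrightarrow> prime_count x \<le> prime_count y"
  unfolding prime_count_def by (rule card_mono) auto

text \<open>For K at least j, the dyadic block (2^K, 2^(K+1)] holds at most 2^(K+1) / j primes when
  j > 0, and these bounds form a geometric series. Up to 2^j every integer is counted. The fixed
  \<open>j\<close> plays the part of the logarithm.\<close>

lemma prime_count_power_two:
  assumes "j \<le> K"
  shows "j * prime_count (2 ^ K) \<le> j * 2 ^ j + 2 ^ Suc K"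
  using assms
proof (induction K rule: dec_induct)
  case base
  have "j * prime_count (2 ^ j) \<le> j * 2 ^ j" by (rule mult_le_mono2) (rule prime_count_le)
  then show ?case by linarith
next
  case (step K)
  let ?A = "{p. prime p \<and> (2::nat) ^ K < p \<and> p \<le> 2 ^ Suc K}"
  have "prime_count (2 ^ Suc K) \<le> card ({p. prime p \<and> p \<le> 2 ^ K} \<union> ?A)"
    unfolding prime_count_def by (rule card_mono) auto
  also have "\<dots> \<le> prime_count (2 ^ K) + card ?A" unfolding prime_count_def by (rule card_Un_le)
  finally have "j * prime_count (2 ^ Suc K) \<le> j * prime_count (2 ^ K) + j * card ?A"
    by (metis add_mult_distrib2 mult_le_mono2)
  also have "j * card ?A \<le> K * card ?A" using step by (intro mult_le_mono1) simp
  also have "\<dots> \<le> 2 ^ Suc K" by (rule card_primes_dyadic_le)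
  finally show ?case using step.IH by simp
qed

text \<open>Rounding x up to a power of two costs a factor 2, and the geometric series over the
  dyadic blocks another.\<close>

lemma prime_count_bound:
  assumes "x \<ge> 1"
  shows "j * prime_count x \<le> j * 2 ^ j + 4 * x"
proof -
  obtain K where K: "x \<le> 2 ^ K" "2 ^ K \<le> 2 * x"
  proof -
    have "\<exists>K. x \<le> 2 ^ K \<and> 2 ^ K \<le> 2 * x" using assms
    proof (induction x rule: dec_induct)
      case base
      show ?case by (rule exI[of _ 0]) simp
    next
      case (step x)
      then obtain K where K: "x \<le> 2 ^ K" "2 ^ K \<le> 2 * x" by blast
      show ?case
      proof (cases "Suc x \<le> 2 ^ K")
        case True
        then show ?thesis using K by (intro exI[of _ K]) simp
      next
        case False
        then have "x = 2 ^ K" using K by simp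
        then show ?thesis by (intro exI[of _ "Suc K"]) simp
      qed
    qed
    then show ?thesis using that by blast
  qed
  show ?thesis
  proof (cases "j \<le> K")
    case True
    have "j * prime_count x \<le> j * prime_count (2 ^ K)" by (intro mult_le_mono2 prime_count_mono K)
    also have "\<dots> \<le> j * 2 ^ j + 2 ^ Suc K" by (rule prime_count_power_two[OF True])
    finally show ?thesis using K(2) by simp
  next
    case False
    then have "(2::nat) ^ K \<le> 2 ^ j" by (intro power_increasing) auto
    then have "prime_count x \<le> 2 ^ j" using K(1) prime_count_le[of x] by linarith
    then have "j * prime_count x \<le> j * 2 ^ j" by (rule mult_le_mono2)
    then show ?thesis by linarith
  qed
qed

text \<open>Shaped for the tail estimate: \<open>C * (2 * B + 1)\<close> will bound the relevant
  primes, and the summand 2 makes room for the extra prime that catches resultant zero.\<close>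

lemma prime_count_sublinear:
  assumes "\<epsilon> > 0" "C \<ge> 1"
  shows "\<forall>\<^sub>F B in sequentially. real (prime_count (C * (2 * B + 1))) + 2 \<le> \<epsilon> * real (2 * B + 1)"
proof -
  \<comment> \<open>With this \<open>j\<close> the linear term 4 C X / j is at most half of
    \<epsilon> X; \<open>N\<close> is then taken so large that the other half absorbs 2^j +
    2.\<close>
  obtain j :: nat where j: "8 * real C / \<epsilon> < real j" using reals_Archimedean2 by blast
  then have j0: "j > 0" using assms by (cases j) (auto simp: field_simps)
  obtain N :: nat where N: "2 * (2 ^ j + 2) / \<epsilon> < real N" using reals_Archimedean2 by blast
  show ?thesis unfolding eventually_sequentially
  proof (intro exI allI impI)
    fix B assume "N \<le> B"
    define X where "X = real (2 * B + 1)"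
    have X: "X > 0" "real N \<le> X" using \<open>N \<le> B\<close> by (simp_all add: X_def)
    have "real (j * prime_count (C * (2 * B + 1))) \<le> real (j * 2 ^ j + 4 * (C * (2 * B + 1)))"
      using prime_count_bound[of "C * (2 * B + 1)" j] assms(2) by (simp only: of_nat_le_iff) simp
    then have "real j * real (prime_count (C * (2 * B + 1))) \<le> real j * 2 ^ j + 4 * real C * X"
      unfolding X_def by (simp add: algebra_simps)
    also have "8 * real C \<le> \<epsilon> * real j" using j assms by (simp add: field_simps)
    then have "4 * real C * X \<le> real j * (\<epsilon> / 2 * X)"
      using mult_right_mono[of "8 * real C" "\<epsilon> * real j" X] X by (simp add: algebra_simps)
    finally have "real j * real (prime_count (C * (2 * B + 1))) \<le> real j * (2 ^ j + \<epsilon> / 2 * X)"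
      by (simp add: algebra_simps)
    then have "real (prime_count (C * (2 * B + 1))) \<le> 2 ^ j + \<epsilon> / 2 * X" using j0 by simp
    moreover have "2 * (2 ^ j + 2) \<le> \<epsilon> * X"
    proof -
      have "2 * (2 ^ j + 2) \<le> \<epsilon> * real N" using N assms by (simp add: field_simps)
      also have "\<dots> \<le> \<epsilon> * X" using X assms by simp
      finally show ?thesis .
    qed
    ultimately show "real (prime_count (C * (2 * B + 1))) + 2 \<le> \<epsilon> * real (2 * B + 1)"
      unfolding X_def[symmetric] by (simp add: algebra_simps)
  qed
qed

section \<open>The tail of the sieve\<close>

text \<open>Treats at once all vectors (\<open>P0\<close> zero, \<open>Q\<close> equal to 1) and
  those in a fixed residue class modulo \<open>Q\<close>.\<close>

definition affine :: "int list \<Rightarrow> nat \<Rightarrow> int list \<Rightarrow> int list" where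
  "affine P0 Q P = map2 (\<lambda>a x. a + int Q * x) P0 P"

lemma length_affine [simp]: "length (affine P0 Q P) = min (length P0) (length P)"
  by (simp add: affine_def)

lemma nth_affine: "k < length P0 \<Longrightarrow> k < length P \<Longrightarrow> affine P0 Q P ! k = P0 ! k + int Q * P ! k"
  by (simp add: affine_def)

definition insert_at :: "nat \<Rightarrow> 'a list \<Rightarrow> 'a \<Rightarrow> 'a list" where
  "insert_at i q t = take i q @ t # drop i q"

lemma length_insert_at [simp]: "length (insert_at i q t) = Suc (length q)"
  by (simp add: insert_at_def)

lemma nth_insert_at:
  "i \<le> length q \<Longrightarrow> insert_at i q t ! k = (if k < i then q ! k else if k = i then t else q ! (k - 1))"
  by (auto simp: insert_at_def nth_append nth_Cons' min_def)

text \<open>\<open>Q\<close> is invertible modulo p, so the condition selects a single residue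
  class.\<close>

lemma card_affine_multiple_le:
  assumes p: "prime p" "\<not> p dvd Q"
  shows "real (card {t \<in> {- int B..int B}. int p dvd a + int Q * t}) \<le> real (2 * B + 1) / real p + 1"
proof -
  have "real (card {t \<in> {- int B..int B}. int p dvd a + int Q * t}) \<le>
      real 1 * (real (2 * B + 1) / real_of_int (int p) + 1)"
  proof (rule card_le_residue_classes)
    fix S assume S: "S \<subseteq> {t \<in> {- int B..int B}. int p dvd a + int Q * t}"
      and inc: "\<And>x y. x \<in> S \<Longrightarrow> y \<in> S \<Longrightarrow> x \<noteq> y \<Longrightarrow> \<not> int p dvd x - y"
    have "x = y" if "x \<in> S" "y \<in> S" for x y
    proof (rule ccontr)
      assume "x \<noteq> y"
      have "int p dvd (a + int Q * x) - (a + int Q * y)" using S that by (intro dvd_diff) auto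
      also have "\<dots> = int Q * (x - y)" by (simp add: algebra_simps)
      finally have "int p dvd int Q \<or> int p dvd x - y" using p(1) by (simp add: prime_dvd_mult_iff)
      then show False using inc[OF that \<open>x \<noteq> y\<close>] p(2) by simp
    qed
    then have "card S \<le> Suc 0" by (metis card_le_Suc0_iff_eq card.infinite le0)
    then show "card S \<le> 1" by simp
  qed (use p prime_gt_0_nat in auto)
  then show ?thesis by simp
qed

section \<open>Vectors whose resultant is divisible by p^(2d), for a single prime p\<close>

context
  fixes d :: nat and P0 :: "int list" and Q p :: nat
  assumes d: "0 < d" and P0: "length P0 = 2 * d + 2" and p: "prime p" "\<not> p dvd Q"
begin

text \<open>Position \<open>d + 1\<close> holds B_0, the constant coefficient of the denominator;
  moving along it shifts that form by a constant and leaves A_d fixed.\<close>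

lemma forms_insert_middle:
  assumes "length q = 2 * d + 1"
  shows "num_form d (affine P0 Q (insert_at (d + 1) q t))
      = num_form d (affine P0 Q (insert_at (d + 1) q 0))"
    "den_form d (affine P0 Q (insert_at (d + 1) q t)) =
       den_form d (affine P0 Q (insert_at (d + 1) q 0)) + [:int Q * t:]"
proof -
  show "num_form d (affine P0 Q (insert_at (d + 1) q t)) = num_form d (affine P0 Q (insert_at (d + 1) q 0))"
    by (rule poly_eqI) (use assms P0 in \<open>simp add: coeff_num_form nth_affine nth_insert_at\<close>)
  show "den_form d (affine P0 Q (insert_at (d + 1) q t)) =
       den_form d (affine P0 Q (insert_at (d + 1) q 0)) + [:int Q * t:]"
    by (rule poly_eqI) (use assms P0 in
      \<open>auto simp: coeff_den_form nth_affine nth_insert_at coeff_pCons split: nat.splits\<close>)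
qed

text \<open>Position 0 holds A_0: the mirror case, with the two forms exchanged.\<close>

lemma forms_insert_first:
  assumes "length q = 2 * d + 1"
  shows "den_form d (affine P0 Q (insert_at 0 q t)) = den_form d (affine P0 Q (insert_at 0 q 0))"
    "num_form d (affine P0 Q (insert_at 0 q t)) =
       num_form d (affine P0 Q (insert_at 0 q 0)) + [:int Q * t:]"
proof -
  show "den_form d (affine P0 Q (insert_at 0 q t)) = den_form d (affine P0 Q (insert_at 0 q 0))"
    by (rule poly_eqI) (use assms P0 in \<open>simp add: coeff_den_form nth_affine nth_insert_at\<close>)
  show "num_form d (affine P0 Q (insert_at 0 q t)) =
       num_form d (affine P0 Q (insert_at 0 q 0)) + [:int Q * t:]"
    by (rule poly_eqI) (use assms P0 in
      \<open>auto simp: coeff_num_form nth_affine nth_insert_at coeff_pCons split: nat.splits\<close>)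
qed

text \<open>The first term accounts for vectors with A_d or B_d prime to p, where one constant
  coefficient is confined to d classes modulo p^2. The second accounts for those with p dividing
  both, two independent conditions modulo p.\<close>

lemma card_resultant_divisible_le:
  "real (card {P \<in> box (2 * d + 2) B. int p ^ (2 * d) dvd point_resultant d (affine P0 Q P)}) \<le>
     2 * real d * (real (2 * B + 1) / real p ^ 2 + 1) * real (2 * B + 1) ^ (2 * d + 1) +
     (real (2 * B + 1) / real p + 1) ^ 2 * real (2 * B + 1) ^ (2 * d)"
proof -
  let ?N = "{P \<in> box (2 * d + 2) B. int p ^ (2 * d) dvd point_resultant d (affine P0 Q P)}"
  let ?X = "real (2 * B + 1)"
  let ?c = "real d * (?X / real p ^ 2 + 1)"
  \<comment> \<open>Indices \<open>d\<close> and \<open>2 * d + 1\<close> carry A_d and B_d.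
    \<open>T1\<close> is fibred over the choices of B_0 and \<open>T2\<close> over those of A_0.
    \<open>T3\<close> is fibred over those of B_d; deleting that coordinate lands in
    \<open>T4\<close>, where A_d is varied in turn.\<close>
  define T1 where "T1 = {P \<in> ?N. \<not> int p dvd affine P0 Q P ! d}"
  define T2 where "T2 = {P \<in> ?N. \<not> int p dvd affine P0 Q P ! (2 * d + 1)}"
  define T3 where "T3 = {P \<in> box (2 * d + 2) B. int p dvd affine P0 Q P ! d
      \<and> int p dvd affine P0 Q P ! (2 * d + 1)}"
  define T4 where "T4 = {P \<in> box (2 * d + 1) B. int p dvd P0 ! d + int Q * P ! d}"
  have pZ: "prime (int p)" "\<not> int p dvd int Q" using p by simp_all
  have cardQ: "real (card {q \<in> box n B. R q}) \<le> ?X ^ n" for n R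
  proof -
    have "card {q \<in> box n B. R q} \<le> card (box n B)" by (rule card_mono) auto
    then show ?thesis unfolding card_box by (metis of_nat_le_iff of_nat_power)
  qed
  have c0: "0 \<le> ?c" by simp
  have T1: "real (card T1) \<le> ?c * ?X ^ (2 * d + 1)"
  proof -
    have "real (card {t \<in> {- int B..int B}. take (d + 1) q @ t # drop (d + 1) q \<in> T1}) \<le> ?c"
      if "q \<in> box (2 * d + 1) B" for q
    proof -
      have lq: "length q = 2 * d + 1" using that by (simp add: box_def)
      let ?f = "num_form d (affine P0 Q (insert_at (d + 1) q 0))"
      let ?g = "den_form d (affine P0 Q (insert_at (d + 1) q 0))"
      let ?S = "{t \<in> {- int B..int B}. int p ^ (2 * d) dvd resultant_sub d d ?f (?g + [:int Q * t:])}"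
      have fd: "affine P0 Q (insert_at (d + 1) q t) ! d = coeff ?f d" for t
        using lq P0 by (simp add: coeff_num_form nth_affine nth_insert_at)
      show ?thesis
      proof (cases "int p dvd coeff ?f d")
        case True
        then have "{t \<in> {- int B..int B}. take (d + 1) q @ t # drop (d + 1) q \<in> T1} = {}"
          using fd unfolding T1_def insert_at_def[symmetric] by auto
        then show ?thesis using c0 by (simp only: card.empty of_nat_0)
      next
        case False
        have "{t \<in> {- int B..int B}. take (d + 1) q @ t # drop (d + 1) q \<in> T1} \<subseteq> ?S"
        proof
          fix t assume "t \<in> {t \<in> {- int B..int B}. take (d + 1) q @ t # drop (d + 1) q \<in> T1}"
          then have "t \<in> {- int B..int B}"
            "int p ^ (2 * d) dvd point_resultant d (affine P0 Q (insert_at (d + 1) q t))"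
            unfolding T1_def insert_at_def[symmetric] by blast+
          then show "t \<in> ?S"
            unfolding point_resultant_def forms_insert_middle[OF lq, of t] by blast
        qed
        then have "card {t \<in> {- int B..int B}. take (d + 1) q @ t # drop (d + 1) q \<in> T1} \<le> card ?S"
          by (rule card_mono[rotated]) (rule finite_subset[of _ "{- int B..int B}"], auto)
        moreover have "real (card ?S) \<le> ?c"
          using card_resultant_fibre_le[OF d pZ(1) False pZ(2), of B ?g] by simp
        ultimately show ?thesis by linarith
      qed
    qed
    then have "real (card T1) \<le> ?c * real (card {q \<in> box (2 * d + 1) B. \<exists>t. take (d + 1) q @ t # drop (d
        + 1) q \<in> T1})"
      by (intro card_fibre_le) (auto simp: T1_def)
    also have "\<dots> \<le> ?c * ?X ^ (2 * d + 1)" by (intro mult_left_mono cardQ c0)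
    finally show ?thesis .
  qed
  have T2: "real (card T2) \<le> ?c * ?X ^ (2 * d + 1)"
  proof -
    have "real (card {t \<in> {- int B..int B}. take 0 q @ t # drop 0 q \<in> T2}) \<le> ?c"
      if "q \<in> box (2 * d + 1) B" for q
    proof -
      have lq: "length q = 2 * d + 1" using that by (simp add: box_def)
      let ?f = "num_form d (affine P0 Q (insert_at 0 q 0))"
      let ?g = "den_form d (affine P0 Q (insert_at 0 q 0))"
      let ?S = "{t \<in> {- int B..int B}. int p ^ (2 * d) dvd resultant_sub d d ?g (?f + [:int Q * t:])}"
      have fd: "affine P0 Q (insert_at 0 q t) ! (2 * d + 1) = coeff ?g d" for t
        using lq P0 by (simp add: coeff_den_form nth_affine nth_insert_at mult_2)
      show ?thesis
      proof (cases "int p dvd coeff ?g d")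
        case True
        then have "{t \<in> {- int B..int B}. take 0 q @ t # drop 0 q \<in> T2} = {}"
          using fd unfolding T2_def insert_at_def[symmetric] by auto
        then show ?thesis using c0 by (simp only: card.empty of_nat_0)
      next
        case False
        \<comment> \<open>Exchanging the forms changes the resultant at most by a sign, so the fibre
          bound applies with \<open>?g\<close> as the form whose leading coefficient is prime to
          p.\<close>
        have swap: "k dvd resultant_sub d d u v \<longleftrightarrow> k dvd resultant_sub d d v u" for k :: int and u v
          using resultant_sub_swap[of d u v] by (cases "even d") auto
        have "{t \<in> {- int B..int B}. take 0 q @ t # drop 0 q \<in> T2} \<subseteq> ?S"
        proof
          fix t assume "t \<in> {t \<in> {- int B..int B}. take 0 q @ t # drop 0 q \<in> T2}"
          then have "t \<in> {- int B..int B}"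
            "int p ^ (2 * d) dvd point_resultant d (affine P0 Q (insert_at 0 q t))"
            unfolding T2_def insert_at_def[symmetric] by blast+
          then show "t \<in> ?S"
            unfolding point_resultant_def forms_insert_first[OF lq, of t]
            by (subst (asm) swap) blast
        qed
        then have "card {t \<in> {- int B..int B}. take 0 q @ t # drop 0 q \<in> T2} \<le> card ?S"
          by (rule card_mono[rotated]) (rule finite_subset[of _ "{- int B..int B}"], auto)
        moreover have "real (card ?S) \<le> ?c"
          using card_resultant_fibre_le[OF d pZ(1) False pZ(2), of B ?f] by simp
        ultimately show ?thesis by linarith
      qed
    qed
    then have "real (card T2) \<le> ?c * real (card {q \<in> box (2 * d + 1) B. \<exists>t. take 0 q @ t # drop 0 q \<in> T2})"
      by (intro card_fibre_le) (auto simp: T2_def)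
    also have "\<dots> \<le> ?c * ?X ^ (2 * d + 1)" by (intro mult_left_mono cardQ c0)
    finally show ?thesis .
  qed
  let ?e = "?X / real p + 1"
  have e0: "0 \<le> ?e" by simp
  have T4: "real (card T4) \<le> ?e * ?X ^ (2 * d)"
  proof -
    have "real (card {t \<in> {- int B..int B}. take d q @ t # drop d q \<in> T4}) \<le> ?e"
      if "q \<in> box (2 * d) B" for q
    proof -
      have lq: "length q = 2 * d" using that by (simp add: box_def)
      have "card {t \<in> {- int B..int B}. take d q @ t # drop d q \<in> T4} \<le>
         card {t \<in> {- int B..int B}. int p dvd P0 ! d + int Q * t}"
        by (rule card_mono, rule finite_subset[of _ "{- int B..int B}"])
          (use lq in \<open>auto simp: T4_def nth_insert_at simp flip: insert_at_def\<close>)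
      then show ?thesis using card_affine_multiple_le[OF p, of B "P0 ! d"] by linarith
    qed
    then have "real (card T4) \<le> ?e * real (card {q \<in> box (2 * d) B. \<exists>t. take d q @ t # drop d q \<in> T4})"
      by (intro card_fibre_le) (auto simp: T4_def)
    also have "\<dots> \<le> ?e * ?X ^ (2 * d)" by (intro mult_left_mono cardQ e0)
    finally show ?thesis .
  qed
  have T3: "real (card T3) \<le> ?e * real (card T4)"
  proof -
    have "real (card {t \<in> {- int B..int B}. take (2 * d + 1) q @ t # drop (2 * d + 1) q \<in> T3}) \<le> ?e"
      if "q \<in> box (2 * d + 1) B" for q
    proof -
      have lq: "length q = 2 * d + 1" using that by (simp add: box_def)
      have "affine P0 Q (insert_at (2 * d + 1) q t) ! (2 * d + 1) = P0 ! (2 * d + 1) + int Q * t" for t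
        using lq P0 by (simp add: nth_insert_at nth_affine)
      then have "card {t \<in> {- int B..int B}. take (2 * d + 1) q @ t # drop (2 * d + 1) q \<in> T3} \<le>
         card {t \<in> {- int B..int B}. int p dvd P0 ! (2 * d + 1) + int Q * t}"
        unfolding T3_def insert_at_def[symmetric]
        by (intro card_mono finite_subset[of "{t \<in> {- int B..int B}. _ t}" "{- int B..int B}"]) auto
      then show ?thesis using card_affine_multiple_le[OF p, of B "P0 ! (2 * d + 1)"] by linarith
    qed
    then have "real (card T3) \<le> ?e * real (card {q \<in> box (2 * d + 1) B. \<exists>t. take (2 * d + 1) q @ t #
        drop (2 * d + 1) q \<in> T3})"
      by (intro card_fibre_le) (auto simp: T3_def)
    also have "card {q \<in> box (2 * d + 1) B. \<exists>t. take (2 * d + 1) q @ t # drop (2 * d + 1) q \<in> T3} \<le> card T4"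
    proof (rule card_mono)
      show "finite T4" unfolding T4_def by simp
      show "{q \<in> box (2 * d + 1) B. \<exists>t. take (2 * d + 1) q @ t # drop (2 * d + 1) q \<in> T3} \<subseteq> T4"
      proof
        fix q assume "q \<in> {q \<in> box (2 * d + 1) B. \<exists>t. take (2 * d + 1) q @ t # drop (2 * d + 1) q \<in> T3}"
        then obtain t where q: "q \<in> box (2 * d + 1) B" "insert_at (2 * d + 1) q t \<in> T3"
          by (auto simp: insert_at_def)
        then have "length q = 2 * d + 1" by (simp add: box_def)
        then show "q \<in> T4" using q P0 by (simp add: T3_def T4_def nth_affine nth_insert_at)
      qed
    qed
    finally show ?thesis using e0 by (simp add: mult_left_mono)
  qed
  have "card ?N \<le> card (T1 \<union> T2 \<union> T3)"
    by (rule card_mono) (auto simp: T1_def T2_def T3_def)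
  also have "\<dots> \<le> card T1 + card T2 + card T3"
    using card_Un_le[of "T1 \<union> T2" T3] card_Un_le[of T1 T2] by linarith
  finally have "real (card ?N) \<le> real (card T1) + real (card T2) + real (card T3)" by linarith
  also have "real (card T3) \<le> ?e * (?e * ?X ^ (2 * d))"
    using T3 mult_left_mono[OF T4 e0] by linarith
  finally have "real (card ?N) \<le> real (card T1) + real (card T2) + ?e * (?e * ?X ^ (2 * d))" by simp
  moreover have "?e * (?e * ?X ^ (2 * d)) = ?e ^ 2 * ?X ^ (2 * d)"
      by (simp only: power2_eq_square mult.assoc)
  moreover have "2 * real d * (?X / real p ^ 2 + 1) * ?X ^ (2 * d + 1)
      = ?c * ?X ^ (2 * d + 1) + ?c * ?X ^ (2 * d + 1)"
    by (simp only: mult.assoc mult_2 distrib_right)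
  ultimately show ?thesis using T1 T2 by linarith
qed

end

section \<open>The size of the resultant and the summation over primes\<close>

lemma abs_det_le:
  fixes A :: "int mat"
  assumes A: "A \<in> carrier_mat n n" and E: "\<And>i j. i < n \<Longrightarrow> j < n \<Longrightarrow> \<bar>A $$ (i, j)\<bar> \<le> E"
  shows "\<bar>det A\<bar> \<le> fact n * E ^ n"
proof -
  have "\<bar>det A\<bar> \<le> (\<Sum>\<pi> | \<pi> permutes {0..<n}. \<bar>signof \<pi> * (\<Prod>i = 0..<n. A $$ (i, \<pi> i))\<bar>)"
    unfolding det_def'[OF A] by (rule sum_abs)
  also have "\<dots> \<le> (\<Sum>\<pi> | \<pi> permutes {0..<n}. E ^ n)"
  proof (rule sum_mono)
    fix \<pi> assume "\<pi> \<in> {\<pi>. \<pi> permutes {0..<n}}"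
    then have perm: "\<pi> permutes {0..<n}" by simp
    have "\<bar>signof \<pi> :: int\<bar> = 1" by (simp add: sign_def)
    then have "\<bar>signof \<pi> * (\<Prod>i = 0..<n. A $$ (i, \<pi> i))\<bar> = (\<Prod>i = 0..<n. \<bar>A $$ (i, \<pi> i)\<bar>)"
      by (simp add: abs_mult abs_prod)
    also have "\<dots> \<le> (\<Prod>i = 0..<n. E)"
    proof (rule prod_mono)
      fix i assume "i \<in> {0..<n}"
      moreover from this have "\<pi> i \<in> {0..<n}" using permutes_in_image[OF perm] by blast
      ultimately show "0 \<le> \<bar>A $$ (i, \<pi> i)\<bar> \<and> \<bar>A $$ (i, \<pi> i)\<bar> \<le> E" using E by simp
    qed
    finally show "\<bar>signof \<pi> * (\<Prod>i = 0..<n. A $$ (i, \<pi> i))\<bar> \<le> E ^ n" by simp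
  qed
  also have "\<dots> = fact n * E ^ n" by (simp add: card_permutations[of _ n])
  finally show ?thesis .
qed

lemma abs_point_resultant_le:
  assumes "length P = 2 * d + 2" "0 \<le> E" "\<And>x. x \<in> set P \<Longrightarrow> \<bar>x\<bar> \<le> E"
  shows "\<bar>point_resultant d P\<bar> \<le> fact (2 * d) * E ^ (2 * d)"
proof -
  have *: "\<bar>coeff (num_form d P) i\<bar> \<le> E" "\<bar>coeff (den_form d P) i\<bar> \<le> E" for i
    using assms by (simp_all add: coeff_num_form coeff_den_form)
  have "\<bar>sylvester_mat_sub d d (num_form d P) (den_form d P) $$ (i, j)\<bar> \<le> E"
    if "i < 2 * d" "j < 2 * d" for i j
  proof -
    have "sylvester_mat_sub d d (num_form d P) (den_form d P) $$ (i, j) \<in>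
        {0} \<union> range (coeff (num_form d P)) \<union> range (coeff (den_form d P))"
      using that by (auto simp: sylvester_mat_sub_index)
    with * show ?thesis using assms(2) by auto
  qed
  then show ?thesis
    unfolding point_resultant_def resultant_sub_def
    by (intro abs_det_le) (auto simp: mult_2)
qed

lemma abs_affine_le:
  assumes P: "P \<in> box n B" and P0: "length P0 = n" "\<And>x. x \<in> set P0 \<Longrightarrow> \<bar>x\<bar> \<le> int A"
    and x: "x \<in> set (affine P0 Q P)"
  shows "\<bar>x\<bar> \<le> int ((A + Q) * (2 * B + 1))"
proof -
  have lP: "length P = n" "set P \<subseteq> {- int B..int B}" using P by (auto simp: box_def)
  obtain k where k: "k < n" "x = affine P0 Q P ! k" using x lP P0 by (auto simp: in_set_conv_nth)
  have "P ! k \<in> {- int B..int B}" using lP k(1) nth_mem by blast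
  then have "\<bar>P ! k\<bar> \<le> int B" by auto
  then have "int Q * \<bar>P ! k\<bar> \<le> int Q * int B" by (rule mult_left_mono) simp
  moreover have "\<bar>P0 ! k\<bar> \<le> int A" using P0 k(1) by simp
  moreover have "x = P0 ! k + int Q * P ! k" using k lP P0 by (simp add: nth_affine)
  ultimately have "\<bar>x\<bar> \<le> int A + int Q * int B"
    by (simp add: abs_mult order.trans[OF abs_triangle_ineq])
  also have "\<dots> \<le> int ((A + Q) * (2 * B + 1))" by (simp add: algebra_simps)
  finally show ?thesis .
qed

text \<open>Telescoping, from 1/k^2 \<le> 1/(k-1) - 1/k.\<close>

lemma sum_inverse_squares_le:
  assumes "1 \<le> M" "M \<le> Y"
  shows "(\<Sum>k\<in>{M<..Y}. 1 / real k ^ 2) \<le> 1 / real M - 1 / real Y"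
  using assms(2)
proof (induction Y rule: dec_induct)
  case (step Y)
  have "1 / real (Suc Y) ^ 2 \<le> 1 / real Y - 1 / real (Suc Y)"
  proof -
    have Y: "real Y > 0" using step assms(1) by simp
    then have "1 / real (Suc Y) ^ 2 \<le> 1 / (real Y * real (Suc Y))"
      unfolding power2_eq_square by (intro divide_left_mono mult_right_mono mult_pos_pos) auto
    also have "\<dots> = 1 / real Y - 1 / real (Suc Y)" using Y by (simp add: field_simps)
    finally show ?thesis .
  qed
  moreover have "{M<..Suc Y} = insert (Suc Y) {M<..Y}" using step by auto
  ultimately show ?case using step.IH by simp
qed simp

text \<open>For one prime the proportion is at most (2d+2)(1/p^2 + 1/X) with X = 2B + 1, where 2d
  comes from the two fibrations over a constant coefficient and 2 from the vectors with p dividing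
  A_d and B_d. The squares sum to at most 1/M, and the terms 1/X, one for each prime up to C X,
  contribute o(1).\<close>

lemma resultant_tail_density:
  assumes d: "0 < d" and P0: "length P0 = 2 * d + 2"
    and M: "1 \<le> M" "\<And>p. prime p \<Longrightarrow> M < p \<Longrightarrow> \<not> p dvd Q" and \<epsilon>: "\<epsilon> > 0"
  shows "\<forall>\<^sub>F B in sequentially.
    density (2 * d + 2) {P. \<exists>p>M. prime p \<and> int p ^ (2 * d) dvd point_resultant d (affine P0 Q P)} B
      \<le> (2 * real d + 2) / real M + \<epsilon>"
proof -
  define A where "A = nat (Max (abs ` set P0))"
  have A: "\<bar>x\<bar> \<le> int A" if "x \<in> set P0" for x
  proof -
    have "\<bar>x\<bar> \<le> Max (abs ` set P0)" using that by (intro Max_ge) auto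
    then show ?thesis unfolding A_def by linarith
  qed
  \<comment> \<open>The resultant of a vector from the box is at most (2d)! times the 2d-th power of
    (A + Q) X, so for a nonzero resultant primes above C X cannot occur; the maximum with 1 keeps C
    positive.\<close>
  define C where "C = max 1 (fact (2 * d) * (A + Q))"
  have C: "C \<ge> 1" "fact (2 * d) * (A + Q) \<le> C" by (simp_all add: C_def)
  \<comment> \<open>Compensates the factor 2d + 2 in the bound for a single prime.\<close>
  define \<eta> where "\<eta> = \<epsilon> / (2 * real d + 2)"
  have \<eta>: "\<eta> > 0" using \<epsilon> by (simp add: \<eta>_def)
  have "\<forall>\<^sub>F B in sequentially. real (prime_count (C * (2 * B + 1))) + 2 \<le> \<eta> * real (2 * B + 1)"
    by (rule prime_count_sublinear[OF \<eta> C(1)])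
  then show ?thesis
  proof eventually_elim
    case (elim B)
    define X where "X = real (2 * B + 1)"
    define Y where "Y = C * (2 * B + 1)"
    have X1: "X \<ge> 1" by (simp add: X_def)
    have XY: "X \<le> real Y" 
      unfolding X_def Y_def of_nat_le_iff using mult_le_mono1[OF C(1), of "2 * B + 1"]
          by (simp only: mult_1)
    define N where "N = (\<lambda>p. {P \<in> box (2 * d + 2) B. int p ^ (2 * d) dvd point_resultant d (affine P0 Q
        P)})"
    let ?T = "{P. \<exists>p>M. prime p \<and> int p ^ (2 * d) dvd point_resultant d (affine P0 Q P)} \<inter> box (2 * d
        + 2) B"
    let ?Pr = "{p. prime p \<and> M < p \<and> p \<le> Y}"
    have finPr: "finite ?Pr" by (rule finite_subset[of _ "{..Y}"]) auto
    \<comment> \<open>A vector of resultant zero belongs to \<open>N q\<close> for every prime q, so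
      one prime beyond the range catches all of them; being larger than M, it does not divide
      Q.\<close>
    obtain q where q: "prime q" "max M Y < q" using bigger_prime by blast
    have bound: "real (card (N p)) / X ^ (2 * d + 2) \<le> (2 * real d + 2) * (1 / real p ^ 2 + 1 / X)"
      if "prime p" "M < p" for p
    proof -
      \<comment> \<open>From (a + 1)^2 \<le> 2 a^2 + 2, which separates the main term from the
        rounding error.\<close>
      have "(X / real p + 1) ^ 2 \<le> 2 * (X ^ 2 / real p ^ 2) + 2"
        using sum_squares_bound[of "X / real p" 1] by (simp add: power2_sum power_divide)
      then have "(X / real p + 1) ^ 2 * X ^ (2 * d) \<le> (2 * (X ^ 2 / real p ^ 2) + 2) * X ^ (2 * d)"
        using X1 by (intro mult_right_mono) auto
      also have "\<dots> = 2 * (X ^ (2 * d + 2) / real p ^ 2) + 2 * X ^ (2 * d)"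
        by (simp add: distrib_right power_add power2_eq_square)
      also have "X ^ (2 * d) \<le> X ^ (2 * d + 1)" using X1 by (intro power_increasing) auto
      finally have 2: "(X / real p + 1) ^ 2 * X ^ (2 * d)
          \<le> 2 * (X ^ (2 * d + 2) / real p ^ 2) + 2 * X ^ (2 * d + 1)"
        by simp
      have 1: "2 * real d * (X / real p ^ 2 + 1) * X ^ (2 * d + 1) =
          2 * real d * (X ^ (2 * d + 2) / real p ^ 2) + 2 * real d * X ^ (2 * d + 1)"
        by (simp add: algebra_simps)
      have "real (card (N p)) \<le> 2 * real d * (X / real p ^ 2 + 1) * X ^ (2 * d + 1) + (X / real p + 1) ^
          2 * X ^ (2 * d)"
        unfolding N_def X_def using card_resultant_divisible_le[OF d P0 that(1) M(2)[OF that]] .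
      also have "\<dots> \<le> (2 * real d + 2) * (X ^ (2 * d + 2) / real p ^ 2 + X ^ (2 * d + 1))"
      proof -
        have "2 * real d * a + 2 * real d * b + z \<le> (2 * real d + 2) * (a + b)"
            if "z \<le> 2 * a + 2 * b" for a b z
          using that by (simp add: algebra_simps)
        then show ?thesis unfolding 1 using 2 .
      qed
      also have "X ^ (2 * d + 2) / real p ^ 2 + X ^ (2 * d + 1)
          = (1 / real p ^ 2 + 1 / X) * X ^ (2 * d + 2)"
        using X1 by (simp add: field_simps)
      finally show ?thesis using X1 by (subst pos_divide_le_eq) (auto simp: mult.assoc)
    qed
    have "?T \<subseteq> (\<Union>p\<in>?Pr. N p) \<union> N q"
    proof
      fix P assume "P \<in> ?T"
      then obtain p where p: "M < p" "prime p" "int p ^ (2 * d) dvd point_resultant d (affine P0 Q P)"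
        and P: "P \<in> box (2 * d + 2) B" by blast
      show "P \<in> (\<Union>p\<in>?Pr. N p) \<union> N q"
      proof (cases "point_resultant d (affine P0 Q P) = 0")
        case True
        then show ?thesis using P by (simp add: N_def)
      next
        case False
        let ?E = "int ((A + Q) * (2 * B + 1))"
        have "int p ^ (2 * d) \<le> \<bar>point_resultant d (affine P0 Q P)\<bar>"
          using dvd_imp_le_int[OF False p(3)] by simp
        also have "\<dots> \<le> fact (2 * d) * ?E ^ (2 * d)"
        proof (rule abs_point_resultant_le)
          show "length (affine P0 Q P) = 2 * d + 2" using P P0 by (simp add: box_def)
          show "\<bar>x\<bar> \<le> ?E" if "x \<in> set (affine P0 Q P)" for x
            using abs_affine_le[OF P P0 A that] .
        qed simp
        \<comment> \<open>The factorial is enlarged to its 2d-th power so that roots can be taken on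
          both sides.\<close>
        also have "\<dots> \<le> fact (2 * d) ^ (2 * d) * ?E ^ (2 * d)"
          using d self_le_power[of "fact (2 * d) :: int" "2 * d"]
          by (intro mult_right_mono) (auto simp: fact_ge_1)
        also have "\<dots> = int (fact (2 * d) * ((A + Q) * (2 * B + 1))) ^ (2 * d)"
          by (simp add: power_mult_distrib)
        finally have "p ^ (2 * d) \<le> (fact (2 * d) * ((A + Q) * (2 * B + 1))) ^ (2 * d)"
          by (simp only: of_nat_power[symmetric] of_nat_le_iff)
        then have "p \<le> fact (2 * d) * ((A + Q) * (2 * B + 1))"
          using d by (subst (asm) power_mono_iff) auto
        also have "\<dots> \<le> Y" unfolding Y_def using mult_le_mono1[OF C(2), of "2 * B + 1"]
            by (simp only: mult.assoc)
        finally show ?thesis using p P by (auto simp: N_def)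
      qed
    qed
    then have "card ?T \<le> card ((\<Union>p\<in>?Pr. N p) \<union> N q)"
      by (rule card_mono[rotated]) (use finPr in \<open>auto simp: N_def\<close>)
    also have "\<dots> \<le> card (\<Union>p\<in>?Pr. N p) + card (N q)" by (rule card_Un_le)
    also have "card (\<Union>p\<in>?Pr. N p) \<le> (\<Sum>p\<in>?Pr. card (N p))" by (rule card_UN_le[OF finPr])
    finally have "real (card ?T) \<le> (\<Sum>p\<in>?Pr. real (card (N p))) + real (card (N q))"
      by (simp flip: of_nat_sum of_nat_add)
    then have "real (card ?T) / X ^ (2 * d + 2) \<le>
       ((\<Sum>p\<in>?Pr. real (card (N p))) + real (card (N q))) / X ^ (2 * d + 2)"
      using X1 by (intro divide_right_mono) auto
    also have "\<dots> = (\<Sum>p\<in>?Pr. real (card (N p)) / X ^ (2 * d + 2)) + real (card (N q)) / X ^ (2 * d + 2)"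
      by (simp add: add_divide_distrib sum_divide_distrib)
    also have "\<dots> \<le> (\<Sum>p\<in>?Pr. (2 * real d + 2) * (1 / real p ^ 2 + 1 / X)) + (2 * real d + 2) * (1 / real
        q ^ 2 + 1 / X)"
      using q by (intro add_mono sum_mono bound) auto
    also have "\<dots> = (2 * real d + 2) * ((\<Sum>p\<in>?Pr. 1 / real p ^ 2) + 1 / real q ^ 2 + (real (card ?Pr) + 1)
        / X)"
      unfolding sum_distrib_left[symmetric] sum.distrib by (simp add: algebra_simps add_divide_distrib)
    also have "\<dots> \<le> (2 * real d + 2) * (1 / real M + \<eta>)"
    proof (intro mult_left_mono)
      have "(\<Sum>p\<in>?Pr. 1 / real p ^ 2) \<le> 1 / real M"
      proof (cases "M \<le> Y")
        case True
        have "(\<Sum>p\<in>?Pr. 1 / real p ^ 2) \<le> (\<Sum>k\<in>{M<..Y}. 1 / real k ^ 2)"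
          by (rule sum_mono2) auto
        also have "\<dots> \<le> 1 / real M - 1 / real Y" by (rule sum_inverse_squares_le[OF M(1) True])
        also have "\<dots> \<le> 1 / real M" by simp
        finally show ?thesis .
      next
        case False
        then have "?Pr = {}" by auto
        then show ?thesis by (simp only: sum.empty) simp
      qed
      moreover have "1 / real q ^ 2 \<le> 1 / X"
      proof -
        have "X \<le> real q" using XY q(2) by linarith
        also have "real q * 1 \<le> real q * real q" using prime_ge_1_nat[OF q(1)]
            by (intro mult_left_mono) auto
        finally show ?thesis using X1 by (intro divide_left_mono) (auto simp: power2_eq_square)
      qed
      moreover have "(real (card ?Pr) + 2) / X \<le> \<eta>"
      proof -
        have "card ?Pr \<le> prime_count Y" unfolding prime_count_def by (rule card_mono) auto
        then have "real (card ?Pr) + 2 \<le> \<eta> * X" using elim by (simp only: X_def Y_def)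
        then show ?thesis using X1 by (simp add: pos_divide_le_eq)
      qed
      ultimately show "(\<Sum>p\<in>?Pr. 1 / real p ^ 2) + 1 / real q ^ 2 + (real (card ?Pr) + 1) / X
          \<le> 1 / real M + \<eta>"
        by (simp add: add_divide_distrib)
    qed simp
    also have "\<dots> = (2 * real d + 2) / real M + \<epsilon>" by (simp add: \<eta>_def distrib_left)
    finally show ?case unfolding density_def X_def[symmetric] .
  qed
qed

section \<open>The density of maps with power-free resultant\<close>

lemma det_mod_cong:
  fixes A A' :: "int mat"
  assumes A: "A \<in> carrier_mat n n" "A' \<in> carrier_mat n n"
    and cong: "\<And>i j. i < n \<Longrightarrow> j < n \<Longrightarrow> A $$ (i, j) mod m = A' $$ (i, j) mod m"
  shows "det A mod m = det A' mod m"
proof -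
  have prod: "(\<Prod>i = 0..<n. A $$ (i, \<pi> i)) mod m = (\<Prod>i = 0..<n. A' $$ (i, \<pi> i)) mod m"
    if "\<pi> permutes {0..<n}" for \<pi>
  proof -
    have "(\<Prod>i = 0..<n. A $$ (i, \<pi> i) mod m) = (\<Prod>i = 0..<n. A' $$ (i, \<pi> i) mod m)"
    proof (rule prod.cong[OF refl])
      fix i assume i: "i \<in> {0..<n}"
      then have "\<pi> i \<in> {0..<n}" using permutes_in_image[OF that] by blast
      then show "A $$ (i, \<pi> i) mod m = A' $$ (i, \<pi> i) mod m" using cong i by simp
    qed
    then have "(\<Prod>i = 0..<n. A $$ (i, \<pi> i) mod m) mod m = (\<Prod>i = 0..<n. A' $$ (i, \<pi> i) mod m) mod m"
      by (simp only:)
    then show ?thesis unfolding mod_prod_eq .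
  qed
  have "(\<Sum>\<pi> | \<pi> permutes {0..<n}. (signof \<pi> * (\<Prod>i = 0..<n. A $$ (i, \<pi> i))) mod m) =
     (\<Sum>\<pi> | \<pi> permutes {0..<n}. (signof \<pi> * (\<Prod>i = 0..<n. A' $$ (i, \<pi> i))) mod m)"
    by (intro sum.cong refl mod_mult_cong) (simp_all add: prod)
  then have "(\<Sum>\<pi> | \<pi> permutes {0..<n}. (signof \<pi> * (\<Prod>i = 0..<n. A $$ (i, \<pi> i))) mod m) mod m =
     (\<Sum>\<pi> | \<pi> permutes {0..<n}. (signof \<pi> * (\<Prod>i = 0..<n. A' $$ (i, \<pi> i))) mod m) mod m"
    by (simp only:)
  then show ?thesis unfolding det_def'[OF A(1)] det_def'[OF A(2)] mod_sum_eq .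
qed

lemma point_resultant_cong:
  assumes "length P = 2 * d + 2" "length P' = 2 * d + 2"
    and "\<And>i. i < 2 * d + 2 \<Longrightarrow> m dvd P ! i - P' ! i"
  shows "m dvd point_resultant d P - point_resultant d P'"
proof -
  have "P ! i mod m = P' ! i mod m" if "i < 2 * d + 2" for i
    using assms(3)[OF that] by (simp add: mod_eq_dvd_iff)
  then have "coeff (num_form d P) i mod m = coeff (num_form d P') i mod m"
    "coeff (den_form d P) i mod m = coeff (den_form d P') i mod m" for i
    using assms(1,2) by (simp_all add: coeff_num_form coeff_den_form)
  then have "point_resultant d P mod m = point_resultant d P' mod m"
    unfolding point_resultant_def resultant_sub_def
    by (intro det_mod_cong[of _ "d + d"]) (auto simp: sylvester_mat_sub_index)
  then show ?thesis by (simp add: mod_eq_dvd_iff)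
qed

lemma dvd_point_resultant_cong:
  assumes "length P = 2 * d + 2" "length P' = 2 * d + 2"
    and "\<And>i. i < 2 * d + 2 \<Longrightarrow> m dvd P ! i - P' ! i" "k dvd m"
  shows "k dvd point_resultant d P \<longleftrightarrow> k dvd point_resultant d P'"
proof -
  have "k dvd point_resultant d P - point_resultant d P'"
    using point_resultant_cong[OF assms(1-3)] assms(4) dvd_trans by blast
  then show ?thesis by (metis diff_add_cancel dvd_add_right_iff)
qed

lemma power_dvd_point_resultant:
  assumes l: "length P = 2 * d + 2" and dvd: "\<And>x. x \<in> set P \<Longrightarrow> k dvd x"
  shows "k ^ (2 * d) dvd point_resultant d P"
proof -
  define P' where "P' = map (\<lambda>x. x div k) P"
  have l': "length P' = 2 * d + 2" using l by (simp add: P'_def)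
  have nth: "P ! i = k * P' ! i" if "i < 2 * d + 2" for i
    using that l dvd[of "P ! i"] by (simp add: P'_def)
  have "num_form d P = smult k (num_form d P')" "den_form d P = smult k (den_form d P')"
    by (rule poly_eqI, simp add: coeff_num_form coeff_den_form l l' nth)+
  then show ?thesis unfolding point_resultant_def by (simp add: resultant_sub_smult)
qed

section \<open>The local conditions at each prime\<close>

definition bad :: "nat \<Rightarrow> nat set \<Rightarrow> nat \<Rightarrow> int list set" where
  "bad d \<Sigma> p = {P. int p ^ (2 * d) dvd point_resultant d P \<or> p \<in> \<Sigma> \<and> int p dvd point_resultant d P}"

definition imprimitive :: "nat \<Rightarrow> int list set" where
  "imprimitive p = {P. \<forall>x\<in>set P. int p dvd x}"

definition sieved :: "(nat \<Rightarrow> int list set) \<Rightarrow> int list set" where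
  "sieved Bad = {P. \<forall>p. prime p \<longrightarrow> P \<notin> Bad p}"

text \<open>The resultant is homogeneous of degree 2d, so a common factor p of the coordinates
  yields p^(2d). Hence vectors that pass the sieve are primitive, and the tail of the imprimitive
  vectors falls under the same estimate.\<close>

lemma imprimitive_subset_bad: "length P = 2 * d + 2 \<Longrightarrow> P \<in> imprimitive p \<Longrightarrow> P \<in> bad d \<Sigma> p"
  using power_dvd_point_resultant[of P d "int p"] by (simp add: imprimitive_def bad_def)

lemma periodic_bad:
  assumes "0 < d"
  shows "periodic (2 * d + 2) (int p ^ (2 * d)) (bad d \<Sigma> p)"
  unfolding periodic_def
proof (intro allI impI)
  fix P P' assume P: "length P = 2 * d + 2" "length P' = 2 * d + 2"
    "\<forall>i<2 * d + 2. int p ^ (2 * d) dvd P ! i - P' ! i" "P \<in> bad d \<Sigma> p"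
  have "int p dvd int p ^ (2 * d)" using assms by (simp add: dvd_power)
  then have "k dvd point_resultant d P \<longleftrightarrow> k dvd point_resultant d P'" if "k \<in> {int p, int p ^ (2 * d)}" for k
    by (intro dvd_point_resultant_cong[OF P(1,2), of "int p ^ (2 * d)"]) (use P(3) that in auto)
  then show "P' \<in> bad d \<Sigma> p" using P(4) unfolding bad_def by simp
qed

lemma periodic_imprimitive: "periodic n (int p) (imprimitive p)"
  unfolding periodic_def imprimitive_def
proof (intro allI impI CollectI ballI)
  fix P P' x assume P: "length P = n" "length P' = n" "\<forall>i<n. int p dvd P ! i - P' ! i"
    "P \<in> {P. \<forall>x\<in>set P. int p dvd x}" and "x \<in> set P'"
  then obtain i where i: "i < n" "x = P' ! i" by (auto simp: in_set_conv_nth)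
  then have "int p dvd P ! i" using P by auto
  moreover have "int p dvd P ! i - P' ! i" using P i by blast
  ultimately have "int p dvd P ! i - (P ! i - P' ! i)" by (rule dvd_diff)
  then show "int p dvd x" using i by simp
qed

text \<open>Beyond the largest element of \<Sigma> the only remaining condition is divisibility by
  p^(2d), and the affine map with zero offset and Q = 1 is the identity.\<close>

lemma bad_tail_density:
  assumes d: "0 < d" and \<Sigma>: "finite \<Sigma>" and \<epsilon>: "\<epsilon> > 0"
  shows "\<exists>M. \<forall>\<^sub>F B in sequentially. density (2 * d + 2) {P. \<exists>p>M. prime p \<and> P \<in> bad d \<Sigma> p} B \<le> \<epsilon>"
proof -
  \<comment> \<open>Makes (2d+2)/M at most half of \<epsilon>; the other half is the error allowed
    in the tail estimate.\<close>
  obtain m :: nat where m: "2 * (2 * real d + 2) / \<epsilon> < real m" using reals_Archimedean2 by blast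
  define s where "s = Max (insert 0 \<Sigma>)"
  define M where "M = max (max 1 m) s"
  have M: "1 \<le> M" "real m \<le> real M" by (simp_all add: M_def)
  have M\<Sigma>: "p \<le> M" if "p \<in> \<Sigma>" for p
  proof -
    have "p \<le> s" unfolding s_def by (rule Max_ge) (use that \<Sigma> in simp_all)
    then show ?thesis by (simp add: M_def)
  qed
  have "2 * (2 * real d + 2) / \<epsilon> \<le> real M" using m M by linarith
  then have "(2 * real d + 2) / real M \<le> \<epsilon> / 2" using \<epsilon> M(1) by (simp add: field_simps)
  moreover have "\<forall>\<^sub>F B in sequentially.
    density (2 * d + 2) {P. \<exists>p>M. prime p \<and> int p ^ (2 * d) dvd point_resultant d (affine (replicate (2
        * d + 2) 0) 1 P)} B
      \<le> (2 * real d + 2) / real M + \<epsilon> / 2"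
    using M(1) \<epsilon> by (intro resultant_tail_density[OF d]) (auto simp: dvd_def)
  ultimately have ev: "\<forall>\<^sub>F B in sequentially.
    density (2 * d + 2) {P. \<exists>p>M. prime p \<and> int p ^ (2 * d) dvd point_resultant d (affine (replicate (2
        * d + 2) 0) 1 P)} B
      \<le> \<epsilon>" by (elim eventually_mono) linarith
  have aff: "affine (replicate n 0) 1 P = P" if "length P = n" for n P
    using that by (intro nth_equalityI) (simp_all add: nth_affine)
  have "density (2 * d + 2) {P. \<exists>p>M. prime p \<and> P \<in> bad d \<Sigma> p} B \<le>
    density (2 * d + 2) {P. \<exists>p>M. prime p \<and> int p ^ (2 * d) dvd point_resultant d (affine (replicate (2
        * d + 2) 0) 1 P)} B" for B
  proof (rule density_mono, rule subsetI)
    fix P assume "P \<in> {P. \<exists>p>M. prime p \<and> P \<in> bad d \<Sigma> p} \<inter> box (2 * d + 2) B"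
    then obtain p where p: "p > M" "prime p" "P \<in> bad d \<Sigma> p" and l: "length P = 2 * d + 2"
      by (auto simp: box_def)
    have "p \<notin> \<Sigma>" using M\<Sigma>[of p] p(1) by auto
    then have "int p ^ (2 * d) dvd point_resultant d P" using p(3) by (simp add: bad_def)
    then show "P \<in> {P. \<exists>p>M. prime p \<and> int p ^ (2 * d) dvd point_resultant d (affine (replicate (2 * d
        + 2) 0) 1 P)}"
      using p aff[OF l] by auto
  qed
  then show ?thesis using ev by (meson eventually_mono order.trans)
qed

lemma sieved_bad_convergent:
  assumes "0 < d" "finite \<Sigma>"
  shows "convergent (density (2 * d + 2) (sieved (bad d \<Sigma>)))"
  unfolding sieved_def
proof (rule sieve_density_convergent)
  fix p :: nat assume "prime p"
  then show "\<exists>m>0. periodic (2 * d + 2) m (bad d \<Sigma> p)"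
    using periodic_bad[OF assms(1)] prime_gt_0_nat by (intro exI[of _ "int p ^ (2 * d)"]) auto
qed (rule bad_tail_density[OF assms])

lemma sieved_imprimitive_convergent:
  assumes d: "0 < d"
  shows "convergent (density (2 * d + 2) (sieved imprimitive))"
  unfolding sieved_def
proof (rule sieve_density_convergent)
  fix p :: nat assume "prime p"
  then show "\<exists>m>0. periodic (2 * d + 2) m (imprimitive p)"
    using periodic_imprimitive prime_gt_0_nat by (intro exI[of _ "int p"]) auto
next
  fix \<epsilon> :: real assume "\<epsilon> > 0"
  then obtain M where M: "\<forall>\<^sub>F B in sequentially. density (2 * d + 2) {P. \<exists>p>M. prime p
      \<and> P \<in> bad d {} p} B \<le> \<epsilon>"
    using bad_tail_density[OF d, of "{}"] by blast
  have "density (2 * d + 2) {P. \<exists>p>M. prime p \<and> P \<in> imprimitive p} B \<le>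
     density (2 * d + 2) {P. \<exists>p>M. prime p \<and> P \<in> bad d {} p} B" for B
  proof (rule density_mono, rule subsetI)
    fix P assume P: "P \<in> {P. \<exists>p>M. prime p \<and> P \<in> imprimitive p} \<inter> box (2 * d + 2) B"
    then have "length P = 2 * d + 2" by (simp add: box_def)
    then show "P \<in> {P. \<exists>p>M. prime p \<and> P \<in> bad d {} p}" using P imprimitive_subset_bad by blast
  qed
  then show "\<exists>M. \<forall>\<^sub>F B in sequentially. density (2 * d + 2) {P. \<exists>p>M. prime p \<and> P \<in> imprimitive p} B \<le> \<epsilon>"
    using M by (meson eventually_mono order.trans)
qed

text \<open>The point of the map \<open>z\<^sup>d\<close>, which has good reduction everywhere.\<close>

definition power_point :: "nat \<Rightarrow> int list" where
  "power_point d = replicate d 0 @ [1, 1] @ replicate d 0"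

lemma length_power_point [simp]: "length (power_point d) = 2 * d + 2"
  by (simp add: power_point_def)

lemma nth_power_point: "i < 2 * d + 2 \<Longrightarrow> power_point d ! i = (if i = d \<or> i = d + 1 then 1 else 0)"
  by (auto simp: power_point_def nth_append nth_Cons')

lemma point_resultant_power_point: "point_resultant d (power_point d) = 1"
proof -
  have "sylvester_mat_sub d d (num_form d (power_point d)) (den_form d (power_point d)) = 1\<^sub>m (d + d)"
    by (rule eq_matI)
      (auto simp: sylvester_mat_sub_index coeff_num_form coeff_den_form nth_power_point)
  then show ?thesis by (simp add: point_resultant_def resultant_sub_def)
qed

text \<open>The vectors \<open>affine (power_point d) Q P\<close> have resultant congruent to 1
  modulo every prime up to M, so they can fail only at larger primes, which by the tail estimate
  affects at most half of them. Radii of the form Q B + 1 suffice, since the density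
  converges.\<close>

lemma sieved_bad_density_lower_bound:
  assumes d: "0 < d" and \<Sigma>: "finite \<Sigma>"
  obtains Q :: nat and c :: real where "Q > 0" "c > 0"
    "\<forall>\<^sub>F B in sequentially. c \<le> density (2 * d + 2) (sieved (bad d \<Sigma>)) (Q * B + 1)"
proof -
  define s where "s = Max (insert 0 \<Sigma>)"
  \<comment> \<open>The factor 8 makes (2d+2)/M at most 1/4; with a further 1/4 for the error term,
    at most half of the box is lost.\<close>
  define M where "M = max (8 * (d + 1)) s"
  have M1: "8 * (d + 1) \<le> M" by (simp add: M_def)
  have M: "1 \<le> M" using M1 by simp
  have M\<Sigma>: "p \<le> M" if "p \<in> \<Sigma>" for p
  proof -
    have "p \<le> s" unfolding s_def by (rule Max_ge) (use that \<Sigma> in simp_all)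
    then show ?thesis by (simp add: M_def)
  qed
  define Q where "Q = \<Prod>{p. prime p \<and> p \<le> M}"
  have Q0: "Q > 0" unfolding Q_def by (rule prod_pos) (auto dest: prime_gt_0_nat)
  have Qdvd: "p dvd Q" if "prime p" "p \<le> M" for p
    unfolding Q_def by (rule dvd_prodI) (use that in auto)
  have Qndvd: "\<not> p dvd Q" if p: "prime p" "M < p" for p
  proof
    assume "p dvd Q"
    then obtain q where "prime q" "q \<le> M" "p dvd q"
      unfolding Q_def using prime_dvd_prod_iff[OF finite_primes_le p(1)] by auto
    then show False using p primes_dvd_imp_eq[of p q] by simp
  qed
  let ?n = "2 * d + 2"
  let ?T = "{P. \<exists>p>M. prime p \<and> int p ^ (2 * d) dvd point_resultant d (affine (power_point d) Q P)}"
  \<comment> \<open>Half of the box for \<open>P\<close>, divided by the growth of the box: the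
    image lies in a box of side 2 (Q B + 1) + 1 \<le> (Q + 3)(2B + 1).\<close>
  define c where "c = 1 / 2 * (1 / real (Q + 3)) ^ ?n"
  have c: "c > 0" by (simp add: c_def)
  have "(2 * real d + 2) / real M \<le> 1 / 4"
  proof -
    have "real (8 * (d + 1)) \<le> real M" using M1 by (simp only: of_nat_le_iff)
    then show ?thesis using M by (simp add: field_simps)
  qed
  moreover have "\<forall>\<^sub>F B in sequentially. density ?n ?T B \<le> (2 * real d + 2) / real M + 1 / 4"
    by (rule resultant_tail_density[OF d _ M Qndvd]) simp_all
  ultimately have "\<forall>\<^sub>F B in sequentially. density ?n ?T B \<le> 1 / 2" by (elim eventually_mono) linarith
  then have "\<forall>\<^sub>F B in sequentially. c \<le> density ?n (sieved (bad d \<Sigma>)) (Q * B + 1)"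
  proof eventually_elim
    case (elim B)
    let ?X = "real (2 * B + 1)"
    let ?aff = "affine (power_point d) Q"
    have good: "?aff P \<in> sieved (bad d \<Sigma>) \<inter> box ?n (Q * B + 1)" if P: "P \<in> box ?n B - ?T" for P
    proof
      have l: "length P = ?n" "set P \<subseteq> {- int B..int B}" using P by (auto simp: box_def)
      show "?aff P \<in> box ?n (Q * B + 1)"
        unfolding box_def
      proof (intro CollectI conjI subsetI)
        fix x assume "x \<in> set (?aff P)"
        then obtain i where i: "i < ?n" "x = ?aff P ! i" using l by (auto simp: in_set_conv_nth)
        then have x: "x = power_point d ! i + int Q * P ! i" using l by (simp add: nth_affine)
        have "P ! i \<in> set P" using l i by simp
        then have "P ! i \<in> {- int B..int B}" using l by blast
        then have "int Q * P ! i \<le> int Q * int B" "int Q * (- int B) \<le> int Q * P ! i"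
          by (intro mult_left_mono; simp)+
        then show "x \<in> {- int (Q * B + 1)..int (Q * B + 1)}"
          unfolding x using i by (simp add: nth_power_point)
      qed (use l in simp)
      have "?aff P \<notin> bad d \<Sigma> p" if p: "prime p" for p
      proof (cases "p \<le> M")
        case True
        have "int p dvd ?aff P ! i - power_point d ! i" if "i < ?n" for i
          using that l Qdvd[OF p True] by (simp add: nth_affine)
        then have "int p dvd point_resultant d (?aff P) \<longleftrightarrow> int p dvd point_resultant d (power_point d)"
          using l by (intro dvd_point_resultant_cong[of _ _ _ "int p"]) simp_all
        moreover have "\<not> int p dvd 1" using prime_gt_1_nat[OF p] by simp
        ultimately have "\<not> int p dvd point_resultant d (?aff P)"
          by (simp only: point_resultant_power_point not_False_eq_True)
        moreover have "int p dvd int p ^ (2 * d)" using d by (simp add: dvd_power)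
        ultimately show ?thesis unfolding bad_def using dvd_trans by blast
      next
        case False
        then have "p \<notin> \<Sigma>" using M\<Sigma> by blast
        moreover have "\<not> int p ^ (2 * d) dvd point_resultant d (?aff P)" using P p False
            by (auto simp: not_le)
        ultimately show ?thesis by (simp add: bad_def)
      qed
      then show "?aff P \<in> sieved (bad d \<Sigma>)" by (simp add: sieved_def)
    qed
    have "inj_on ?aff (box ?n B - ?T)"
    proof (rule inj_onI)
      fix P P' assume P: "P \<in> box ?n B - ?T" "P' \<in> box ?n B - ?T" "?aff P = ?aff P'"
      then have l: "length P = ?n" "length P' = ?n" by (auto simp: box_def)
      have "P ! i = P' ! i" if "i < ?n" for i
        using arg_cong[OF P(3), of "\<lambda>l. l ! i"] that l Q0 by (simp add: nth_affine)
      then show "P = P'" using l by (intro nth_equalityI) auto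
    qed
    then have "card (box ?n B - ?T) \<le> card (sieved (bad d \<Sigma>) \<inter> box ?n (Q * B + 1))"
      using good by (intro card_inj_on_le[of ?aff]) auto
    moreover have "card (box ?n B) \<le> card (box ?n B - ?T) + card (?T \<inter> box ?n B)"
      by (rule order.trans[OF card_mono card_Un_le]) auto
    ultimately have "real (card (box ?n B)) \<le> real (card (sieved (bad d \<Sigma>) \<inter> box ?n (Q * B + 1))) + real
        (card (?T \<inter> box ?n B))"
      by linarith
    moreover have "real (card (box ?n B)) = ?X ^ ?n" by (simp only: card_box of_nat_power)
    moreover have "real (card (?T \<inter> box ?n B)) \<le> 1 / 2 * ?X ^ ?n"
      using elim unfolding density_def by (subst (asm) pos_divide_le_eq) auto
    ultimately have half: "1 / 2 * ?X ^ ?n \<le> real (card (sieved (bad d \<Sigma>) \<inter> box ?n (Q * B + 1)))"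
        by linarith
    let ?Z = "real (2 * (Q * B + 1) + 1)"
    have "?Z \<le> real (Q + 3) * ?X" by (simp add: algebra_simps)
    then have "1 / real (Q + 3) * ?Z \<le> ?X" by (simp add: field_simps)
    then have "(1 / real (Q + 3) * ?Z) ^ ?n \<le> ?X ^ ?n" by (intro power_mono) simp_all
    then have "c * ?Z ^ ?n \<le> 1 / 2 * ?X ^ ?n" unfolding c_def power_mult_distrib by simp
    also note half
    finally have A: "c * ?Z ^ ?n \<le> real (card (sieved (bad d \<Sigma>) \<inter> box ?n (Q * B + 1)))" .
    have "0 < ?Z ^ ?n" by (intro zero_less_power) (simp only: of_nat_0_less_iff zero_less_Suc
        Suc_eq_plus1[symmetric])
    then show ?case unfolding density_def using A by (rule pos_le_divide_eq[THEN iffD2])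
  qed
  then show ?thesis using that[OF Q0 c] by blast
qed

lemma sieved_bad_density_limit:
  assumes d: "0 < d" and \<Sigma>: "finite \<Sigma>"
  obtains L where "L > 0" "density (2 * d + 2) (sieved (bad d \<Sigma>)) \<longlonglongrightarrow> L"
proof -
  obtain L where L: "density (2 * d + 2) (sieved (bad d \<Sigma>)) \<longlonglongrightarrow> L"
    using sieved_bad_convergent[OF assms] unfolding convergent_def by blast
  obtain Q :: nat and c :: real where Q: "Q > 0" "c > 0"
    "\<forall>\<^sub>F B in sequentially. c \<le> density (2 * d + 2) (sieved (bad d \<Sigma>)) (Q * B + 1)"
    using sieved_bad_density_lower_bound[OF assms] .
  have "strict_mono (\<lambda>B. Q * B + 1)" using Q by (simp add: strict_mono_def)
  then have "(\<lambda>B. density (2 * d + 2) (sieved (bad d \<Sigma>)) (Q * B + 1)) \<longlonglongrightarrow> L"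
    using LIMSEQ_subseq_LIMSEQ[OF L] by (simp add: o_def)
  then have "c \<le> L" using Q(3) by (rule tendsto_lowerbound) simp
  with Q(2) have "L > 0" by linarith
  then show ?thesis using L by (rule that)
qed

section \<open>Passage to projective points of bounded height\<close>

definition sign_normalized :: "int list set" where
  "sign_normalized = {P. \<exists>i<length P. 0 < P ! i \<and> (\<forall>j<i. P ! j = 0)}"

text \<open>Negation acts freely on nonzero vectors, and each orbit has exactly one sign-normalized
  member.\<close>

lemma card_sign_normalized:
  assumes neg: "\<And>P. P \<in> S \<Longrightarrow> map uminus P \<in> S"
    and nz: "\<And>P. P \<in> S \<inter> box n B \<Longrightarrow> \<exists>x\<in>set P. x \<noteq> 0"
  shows "card (S \<inter> box n B) = 2 * card (S \<inter> sign_normalized \<inter> box n B)"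
proof -
  let ?A = "S \<inter> sign_normalized \<inter> box n B"
  have neg_box: "map uminus P \<in> box n B" if "P \<in> box n B" for P using that by (auto simp: box_def)
  have idem: "map uminus (map uminus P) = P" for P :: "int list" by (simp add: o_def)
  have inj: "inj_on (map uminus) ?A" by (metis idem inj_onI)
  have disj: "?A \<inter> map uminus ` ?A = {}"
  proof (rule ccontr)
    assume "?A \<inter> map uminus ` ?A \<noteq> {}"
    then obtain P where P: "P \<in> sign_normalized" "map uminus P \<in> sign_normalized"
      using idem by fastforce
    then obtain i i' where i: "i < length P" "0 < P ! i" "\<forall>j<i. P ! j = 0"
      and i': "i' < length P" "P ! i' < 0" "\<forall>j<i'. P ! j = 0"
      unfolding sign_normalized_def by auto
    then show False by (metis less_irrefl linorder_neqE_nat order.asym)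
  qed
  have "S \<inter> box n B = ?A \<union> map uminus ` ?A"
  proof (intro equalityI subsetI)
    fix P assume P: "P \<in> S \<inter> box n B"
    then obtain k where k: "k < length P" "P ! k \<noteq> 0" using nz by (metis in_set_conv_nth)
    define i where "i = (LEAST i. P ! i \<noteq> 0)"
    have i: "P ! i \<noteq> 0" "i \<le> k" unfolding i_def by (rule LeastI, rule k, rule Least_le, rule k)
    have min: "\<forall>j<i. P ! j = 0" using not_less_Least unfolding i_def by blast
    show "P \<in> ?A \<union> map uminus ` ?A"
    proof (cases "0 < P ! i")
      case True
      moreover have "i < length P" using i k by linarith
      ultimately have "P \<in> sign_normalized" unfolding sign_normalized_def using min by blast
      then show ?thesis using P by blast
    next
      case False
      then have "map uminus P \<in> sign_normalized"
        unfolding sign_normalized_def using i k min by (intro CollectI exI[of _ i]) auto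
      then have "map uminus P \<in> ?A" using P neg neg_box by blast
      then show ?thesis using idem by (metis UnI2 image_eqI)
    qed
  qed (use neg neg_box in auto)
  moreover have "finite ?A" by simp
  ultimately show ?thesis
    using disj card_image[OF inj] by (simp add: card_Un_disjoint)
qed

lemma proj_points_eq:
  "proj_points (2 * d + 1) = sieved imprimitive \<inter> sign_normalized \<inter> {P. length P = 2 * d + 2}"
proof -
  have "Gcd (set P) = 1 \<longleftrightarrow> P \<in> sieved imprimitive" for P
  proof
    assume g: "Gcd (set P) = 1"
    have "P \<notin> imprimitive p" if "prime p" for p
    proof
      assume "P \<in> imprimitive p"
      then have "int p dvd Gcd (set P)" by (auto simp: imprimitive_def intro: Gcd_greatest)
      then show False using g that by (simp add: not_prime_unit)
    qed
    then show "P \<in> sieved imprimitive" by (simp add: sieved_def)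
  next
    assume P: "P \<in> sieved imprimitive"
    show "Gcd (set P) = 1"
    proof (rule ccontr)
      assume "Gcd (set P) \<noteq> 1"
      moreover have "Gcd (set P) = int (nat (Gcd (set P)))" by simp
      ultimately have "nat (Gcd (set P)) \<noteq> 1" by linarith
      then obtain p where p: "prime p" "p dvd nat (Gcd (set P))" using prime_factor_nat by blast
      then have "int p dvd int (nat (Gcd (set P)))" by (simp only: int_dvd_int_iff)
      then have "int p dvd Gcd (set P)" by simp
      then have "P \<in> imprimitive p" unfolding imprimitive_def using Gcd_dvd dvd_trans by blast
      then show False using P p(1) by (simp add: sieved_def)
    qed
  qed
  then show ?thesis
    by (auto simp: proj_points_def sign_normalized_def less_Suc_eq_le)
qed

lemma height_le_iff:
  assumes "length P = n" "0 < n" "0 \<le> x"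
  shows "real_of_int (height P) \<le> x \<longleftrightarrow> P \<in> box n (nat \<lfloor>x\<rfloor>)"
proof -
  have "real_of_int (height P) \<le> x \<longleftrightarrow> height P \<le> \<lfloor>x\<rfloor>" by (simp add: le_floor_iff)
  also have "\<dots> \<longleftrightarrow> (\<forall>y\<in>set P. \<bar>y\<bar> \<le> \<lfloor>x\<rfloor>)"
    unfolding height_def using assms by (subst Max_le_iff) auto
  also have "\<dots> \<longleftrightarrow> P \<in> box n (nat \<lfloor>x\<rfloor>)"
    using assms by (auto simp: box_def abs_le_iff)
  finally show ?thesis .
qed

lemma height_box_eq:
  assumes "S \<subseteq> {P. length P = n}" "0 < n" "0 \<le> x"
  shows "{P \<in> S. real_of_int (height P) \<le> x} = S \<inter> box n (nat \<lfloor>x\<rfloor>)"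
  using assms height_le_iff by blast

text \<open>As the elements of \<Sigma> are prime, good reduction there is part of a sieve indexed
  by the primes. Power-freeness, stated with integer primes, is transferred to natural ones, and it
  excludes resultant zero.\<close>

lemma map_point_W:
  assumes "0 < d" "\<forall>p\<in>\<Sigma>. prime p"
  shows "map_point ` W d \<Sigma> = sieved (bad d \<Sigma>) \<inter> proj_points (2 * d + 1)"
proof -
  let ?Q = "\<lambda>n. power_free (2 * d) n \<and> (\<forall>p\<in>\<Sigma>. \<not> int p dvd n)"
  have "?Q n \<Longrightarrow> n \<noteq> 0" for n
    unfolding power_free_def by (metis dvd_0_right two_is_prime_nat prime_int_numeral_eq
        prime_nat_int_transfer)
  then have "map_point ` W d \<Sigma> = {P \<in> proj_points (2 * d + 1). ?Q (point_resultant d P)}"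
    unfolding W_def good_reduction_def using map_point_image[OF assms(1), of ?Q] by blast
  moreover have "?Q (point_resultant d P) \<longleftrightarrow> P \<in> sieved (bad d \<Sigma>)" for P
  proof -
    have "power_free (2 * d) m \<longleftrightarrow> (\<forall>p::nat. prime p \<longrightarrow> \<not> int p ^ (2 * d) dvd m)" for m
    proof
      assume "power_free (2 * d) m"
      then show "\<forall>p::nat. prime p \<longrightarrow> \<not> int p ^ (2 * d) dvd m" by (simp add: power_free_def)
    next
      assume *: "\<forall>p::nat. prime p \<longrightarrow> \<not> int p ^ (2 * d) dvd m"
      have "\<not> p ^ (2 * d) dvd m" if "prime p" for p :: int
      proof -
        have "p = int (nat p)" using prime_ge_0_int[OF that] by simp
        then obtain q where q: "p = int q" by blast
        then show ?thesis using * that by simp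
      qed
      then show "power_free (2 * d) m" by (simp add: power_free_def)
    qed
    then show ?thesis using assms(2) by (auto simp: sieved_def bad_def)
  qed
  ultimately show ?thesis by blast
qed

lemma filterlim_nat_floor: "filterlim (\<lambda>x::real. nat \<lfloor>x\<rfloor>) sequentially at_top"
  unfolding filterlim_at_top
proof
  fix Z :: nat
  show "\<forall>\<^sub>F x in at_top. Z \<le> nat \<lfloor>x :: real\<rfloor>"
    using eventually_ge_at_top[of "real Z"] by eventually_elim (simp add: le_nat_floor)
qed

lemma finite_bounded_height: "finite {P \<in> proj_points (2 * d + 1). real_of_int (height P) \<le> x}"
proof (cases "0 \<le> x")
  case True
  have "{P \<in> proj_points (2 * d + 1). real_of_int (height P) \<le> x}
      = proj_points (2 * d + 1) \<inter> box (2 * d + 2) (nat \<lfloor>x\<rfloor>)"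
    by (rule height_box_eq) (use True in \<open>auto simp: proj_points_def\<close>)
  then show ?thesis by simp
next
  case False
  \<comment> \<open>For negative x the radius given by \<open>nat\<close> would be 0, whose box is
    not empty, so the set is shown to be empty directly.\<close>
  have "0 \<le> height P" if "length P = 2 * d + 2" for P
  proof -
    have "P \<noteq> []" using that by auto
    then have "\<bar>hd P\<bar> \<le> height P" unfolding height_def by (intro Max_ge) auto
    then show ?thesis by linarith
  qed
  then have "{P \<in> proj_points (2 * d + 1). real_of_int (height P) \<le> x} = {}"
    using False by (fastforce simp: proj_points_def)
  then show ?thesis by (simp only: finite.emptyI)
qed

lemma height_proportion_mono:
  assumes "S \<subseteq> S'" "S' \<subseteq> proj_points (2 * d + 1)"
  shows "height_proportion (2 * d + 1) S x \<le> height_proportion (2 * d + 1) S' x"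
  unfolding height_proportion_def
  by (intro divide_right_mono of_nat_mono card_mono finite_subset[OF _ finite_bounded_height[of d x]])
    (use assms in auto)

text \<open>The height density is L / L', the quotient of the densities of sieved and of primitive
  vectors. Sieved vectors are primitive, so 0 < L \<le> L', which makes the quotient meaningful and
  positive.\<close>

lemma W_has_positive_density:
  assumes d: "0 < d" and \<Sigma>: "finite \<Sigma>" "\<forall>p\<in>\<Sigma>. prime p"
  obtains \<delta> where "\<delta> > 0" "has_height_density d (W d \<Sigma>) \<delta>"
proof -
  let ?n = "2 * d + 2"
  let ?G = "sieved (bad d \<Sigma>)" and ?P = "sieved imprimitive"
  obtain L where L: "L > 0" "density ?n ?G \<longlonglongrightarrow> L" using sieved_bad_density_limit[OF d \<Sigma>(1)] .
  obtain L' where L': "density ?n ?P \<longlonglongrightarrow> L'"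
    using sieved_imprimitive_convergent[OF d] unfolding convergent_def by blast
  have sub: "?G \<inter> box ?n B \<subseteq> ?P" for B
  proof
    fix P assume P: "P \<in> ?G \<inter> box ?n B"
    then have "length P = ?n" by (simp add: box_def)
    then show "P \<in> ?P" using P imprimitive_subset_bad unfolding sieved_def by blast
  qed
  have "L \<le> L'" using L(2) L' by (rule LIMSEQ_le) (use density_mono[OF sub] in blast)
  then have pos: "L / L' > 0" "L' \<noteq> 0" using L(1) by auto
  have nz: "\<exists>x\<in>set P. x \<noteq> 0" if "P \<in> ?P" for P
  proof (rule ccontr)
    assume "\<not> ?thesis"
    then have "P \<in> imprimitive 2" by (auto simp: imprimitive_def)
    then show False using that two_is_prime_nat unfolding sieved_def by blast
  qed
  have neg_forms: "num_form d (map uminus P) = smult (- 1) (num_form d P)"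
      "den_form d (map uminus P) = smult (- 1) (den_form d P)" for P
    by (rule poly_eqI, simp add: num_form_def den_form_def nth_default_map_eq[of uminus 0 0] take_map
        drop_map)+
  have "point_resultant d (map uminus P) = point_resultant d P" for P
    unfolding point_resultant_def neg_forms resultant_sub_smult by simp
  then have negG: "map uminus P \<in> ?G" if "P \<in> ?G" for P using that by (simp add: sieved_def bad_def)
  have negP: "map uminus P \<in> ?P" if "P \<in> ?P" for P using that by (simp add: sieved_def imprimitive_def)
  have quotient: "height_proportion (2 * d + 1) (map_point ` W d \<Sigma>) x
      = density ?n ?G (nat \<lfloor>x\<rfloor>) / density ?n ?P (nat \<lfloor>x\<rfloor>)"
    if "0 \<le> x" for x
  proof -
    let ?B = "nat \<lfloor>x\<rfloor>"
    have box_len: "box ?n ?B \<subseteq> {P. length P = ?n}" by (auto simp: box_def)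
    have "{P \<in> map_point ` W d \<Sigma>. real_of_int (height P) \<le> x} = map_point ` W d \<Sigma> \<inter> box ?n ?B"
      by (rule height_box_eq) (use that in \<open>auto simp: map_point_W[OF d \<Sigma>(2)] proj_points_def\<close>)
    also have "\<dots> = ?G \<inter> sign_normalized \<inter> box ?n ?B"
      unfolding map_point_W[OF d \<Sigma>(2)] proj_points_eq using sub[of ?B] box_len by blast
    finally have eq: "{P \<in> map_point ` W d \<Sigma>. real_of_int (height P) \<le> x} = \<dots>" .
    have nzG: "\<exists>x\<in>set P. x \<noteq> 0" if "P \<in> ?G \<inter> box ?n ?B" for P using nz sub[of ?B] that by blast
    have 1: "2 * card {P \<in> map_point ` W d \<Sigma>. real_of_int (height P) \<le> x} = card (?G \<inter> box ?n ?B)"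
      unfolding eq by (rule card_sign_normalized[OF negG nzG, symmetric])
    have "{P \<in> proj_points (2 * d + 1). real_of_int (height P) \<le> x} = proj_points (2 * d + 1) \<inter> box ?n ?B"
      by (rule height_box_eq) (use that in \<open>auto simp: proj_points_def\<close>)
    also have "\<dots> = ?P \<inter> sign_normalized \<inter> box ?n ?B"
      unfolding proj_points_eq by (auto simp: box_def)
    finally have 2: "2 * card {P \<in> proj_points (2 * d + 1). real_of_int (height P) \<le> x}
        = card (?P \<inter> box ?n ?B)"
      using card_sign_normalized[of ?P ?n ?B, OF negP] nz by simp
    show ?thesis unfolding height_proportion_def density_def 1[symmetric] 2[symmetric] by simp
  qed
  have "(\<lambda>B. density ?n ?G B / density ?n ?P B) \<longlonglongrightarrow> L / L'"
    by (rule tendsto_divide[OF L(2) L' pos(2)])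
  then have "((\<lambda>x. density ?n ?G (nat \<lfloor>x\<rfloor>) / density ?n ?P (nat \<lfloor>x\<rfloor>)) \<longlongrightarrow> L / L') (at_top :: real filter)"
    by (rule filterlim_compose[OF _ filterlim_nat_floor])
  moreover have "\<forall>\<^sub>F x in at_top. density ?n ?G (nat \<lfloor>x\<rfloor>) / density ?n ?P (nat \<lfloor>x\<rfloor>) =
      height_proportion (2 * d + 1) (map_point ` W d \<Sigma>) x"
    using eventually_ge_at_top[of 0] by eventually_elim (rule quotient[symmetric])
  ultimately have "has_height_density d (W d \<Sigma>) (L / L')"
    unfolding has_height_density_def by (rule Lim_transform_eventually)
  then show ?thesis using that pos(1) by blast
qed

theorem theoremA:
  fixes d :: nat and \<Sigma> :: "nat set"
  assumes "d \<ge> 3" and "odd d"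
    and "finite \<Sigma>" and "\<forall>p\<in>\<Sigma>. prime p"
  shows "(\<forall>\<phi>\<in>W d \<Sigma>. globally_minimal \<phi>)
    \<and> (\<exists>\<delta>>0. has_height_density d (W d \<Sigma>) \<delta>)
    \<and> lower_height_density d
        {\<phi> \<in> rat_maps d. (\<forall>p\<in>\<Sigma>. good_reduction p \<phi>) \<and> globally_minimal \<phi>} > 0"
proof -
  have d: "0 < d" using assms(1) by simp
  have minimal: "globally_minimal \<phi>" if "\<phi> \<in> W d \<Sigma>" for \<phi>
    using that globally_minimal_of_power_free[OF d assms(2)] by (simp add: W_def)
  obtain \<delta> where \<delta>: "\<delta> > 0" "has_height_density d (W d \<Sigma>) \<delta>"
    using W_has_positive_density[OF d assms(3,4)] .
  let ?V = "{\<phi> \<in> rat_maps d. (\<forall>p\<in>\<Sigma>. good_reduction p \<phi>) \<and> globally_minimal \<phi>}"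
  have "W d \<Sigma> \<subseteq> ?V" using minimal by (auto simp: W_def)
  moreover have "map_point ` ?V \<subseteq> proj_points (2 * d + 1)"
    using map_point_in_proj_points(1) by (auto simp: rat_maps_def)
  ultimately have le: "height_proportion (2 * d + 1) (map_point ` W d \<Sigma>) x \<le>
      height_proportion (2 * d + 1) (map_point ` ?V) x" for x
    by (intro height_proportion_mono image_mono)
  \<comment> \<open>For the larger set only the comparison with \<open>W d \<Sigma>\<close> is
    available, so the limit is read as a lower limit, which is monotone.\<close>
  have "Liminf at_top (\<lambda>x. ereal (height_proportion (2 * d + 1) (map_point ` W d \<Sigma>) x)) = ereal \<delta>"
    using \<delta>(2) unfolding has_height_density_def by (intro lim_imp_Liminf) simp_all
  moreover have "Liminf at_top (\<lambda>x. ereal (height_proportion (2 * d + 1) (map_point ` W d \<Sigma>) x)) \<le>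
      lower_height_density d ?V"
    unfolding lower_height_density_def
    by (intro Liminf_mono always_eventually allI) (simp only: ereal_less_eq(3) le)
  ultimately have "ereal \<delta> \<le> lower_height_density d ?V" by simp
  moreover have "0 < ereal \<delta>" using \<delta>(1) by simp
  ultimately have "lower_height_density d ?V > 0" by (rule less_le_trans[rotated])
  then show ?thesis using minimal \<delta> by blast
qed

end
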